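(* Let $T>0$, let $\alpha\in\,]\tfrac13,1[$ and let $\delta>0$. Let $v_0^E\in H$ and let $v^E$ be a weak solution on $(0,T)\times\mathbb{T}^3$ of the Euler equations $$\partial_t v^E+(v^E\cdot\nabla)v^E+\nabla p^E=0,\qquad \operatorname{div} v^E=0,\qquad v^E(0,x)=v_0^E(x),$$ such that $$v^E\in L^{\frac1\alpha+\delta}(0,T;\dot C^{\alpha}(\mathbb{T}^3)).$$ Then $v^E$ conserves the energy, i.e. $\|v^E(t)\|=\|v^E_0\|$ for all $t\in[0,T]$.
   Context: $\mathbb{T}^3$ is the three-dimensional torus; functions on $\mathbb{T}^3$ are functions on $\mathbb{R}^3$ that are $2\pi$-periodic in each coordinate. $(\cdot,\cdot)$ and $\|\cdot\|$ denote the scalar product and norm of $L^2(\mathbb{T}^3)$. $H$ is the closure in $L^2(\mathbb{T}^3)$ of the smooth, periodic, divergence-free vector fields with zero mean value. Test functions: $\mathcal{D}_T:=\{\varphi\in C_0^\infty([0,T[\times\mathbb{T}^3):\operatorname{div}\varphi=0\}$ (vector-valued). Weak solution of the Euler equations: given $v_0^E\in H$, a measurable function $v^E:(0,T)\times\mathbb{T}^3\to\mathbb{R}^3$ is a weak solution if $v^E\in L^\infty(0,T;H)$ and $$\int_0^T\Big[(v^E,\partial_t\varphi)+(v^E\otimes v^E,\nabla\varphi)\Big]\,dt=-(v_0^E,\varphi(0))\qquad\text{for all }\varphi\in\mathcal{D}_T.$$ As usual, $v^E$ is identified with its representative that is weakly continuous from $[0,T]$ into $L^2(\mathbb{T}^3)$,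 with $v^E(0)=v_0^E$, so that $v^E(t)$ is meaningful for every $t\in[0,T]$. Hölder semi-norm: for $0<\alpha\le1$, $[u]_\alpha:=\sup_{x\ne y}\frac{|u(x)-u(y)|}{|x-y|^\alpha}$, and $\dot C^\alpha(\mathbb{T}^3)$ is the space of measurable functions with $[u]_\alpha<\infty$. One says $u\in L^\beta(0,T;\dot C^\alpha(\mathbb{T}^3))$ if there exists $f_\alpha:[0,T]\to\mathbb{R}^+$ such that $|u(t,x)-u(t,y)|\le f_\alpha(t)|x-y|^\alpha$ for all $x,y\in\mathbb{T}^3$ and a.e. $t\in[0,T]$, and $\int_0^T f_\alpha^\beta(t)\,dt<\infty$. *)

theory Defs
  imports "HOL-Analysis.Analysis"
begin

text \<open>Functions on the torus are functions on \<open>\<real>\<^sup>3\<close> that are \<open>2\<pi>\<close>-periodic in each coordinate;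
  integrals over the torus are Lebesgue integrals over the cell \<open>[0, 2\<pi>]\<^sup>3\<close>, without normalisation.\<close>

definition periodic :: "(real ^ 3 \<Rightarrow> 'b) \<Rightarrow> bool" where
  "periodic u \<longleftrightarrow> (\<forall>x i. u (x + axis i (2 * pi)) = u x)"

definition torus :: "(real ^ 3) measure" where
  "torus = lebesgue_on (cbox 0 (\<chi> i. 2 * pi))"

definition L2_inner :: "(real ^ 3 \<Rightarrow> real ^ 3) \<Rightarrow> (real ^ 3 \<Rightarrow> real ^ 3) \<Rightarrow> real" where
  "L2_inner u v = (\<integral>x. u x \<bullet> v x \<partial>torus)"

definition L2_norm :: "(real ^ 3 \<Rightarrow> real ^ 3) \<Rightarrow> real" where
  "L2_norm u = sqrt (L2_inner u u)"

definition L2_torus :: "(real ^ 3 \<Rightarrow> real ^ 3) set" where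
  "L2_torus = {u. periodic u \<and> u \<in> borel_measurable lebesgue \<and>
     integrable torus (\<lambda>x. (norm (u x))\<^sup>2)}"

text \<open>All derivatives are taken relative to \<open>S\<close>, so on \<open>[0,T[ \<times> \<real>\<^sup>3\<close> the time derivatives at
  \<open>0\<close> are one-sided.  Meaningful only for sets \<open>S\<close> on which derivatives relative to \<open>S\<close> are unique,
  such as \<open>UNIV\<close> and \<open>[0,T[ \<times> \<real>\<^sup>3\<close>.\<close>

primrec C_k_on :: "nat \<Rightarrow> 'a::euclidean_space set \<Rightarrow> ('a \<Rightarrow> 'b::real_normed_vector) \<Rightarrow> bool" where
  "C_k_on 0 S f \<longleftrightarrow> continuous_on S f"
| "C_k_on (Suc k) S f \<longleftrightarrow> f differentiable_on S \<and>
     (\<forall>b\<in>Basis. C_k_on k S (\<lambda>x. frechet_derivative f (at x within S) b))"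

definition smooth_on :: "'a::euclidean_space set \<Rightarrow> ('a \<Rightarrow> 'b::real_normed_vector) \<Rightarrow> bool" where
  "smooth_on S f \<longleftrightarrow> (\<forall>k. C_k_on k S f)"

definition partial :: "3 \<Rightarrow> (real ^ 3 \<Rightarrow> real ^ 3) \<Rightarrow> real ^ 3 \<Rightarrow> real ^ 3" where
  "partial j u x = frechet_derivative u (at x) (axis j 1)"

definition divergence :: "(real ^ 3 \<Rightarrow> real ^ 3) \<Rightarrow> real ^ 3 \<Rightarrow> real" where
  "divergence u x = (\<Sum>i\<in>UNIV. partial i u x $ i)"

definition solenoidal_fields :: "(real ^ 3 \<Rightarrow> real ^ 3) set" where
  "solenoidal_fields = {\<psi>. periodic \<psi> \<and> smooth_on UNIV \<psi> \<and> (\<forall>x. divergence \<psi> x = 0) \<and>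
     (\<integral>x. \<psi> x \<partial>torus) = 0}"

definition H_space :: "(real ^ 3 \<Rightarrow> real ^ 3) set" where
  "H_space = {u \<in> L2_torus. \<forall>\<epsilon>>0. \<exists>\<psi>\<in>solenoidal_fields. L2_norm (\<lambda>x. u x - \<psi> x) < \<epsilon>}"

text \<open>Since the torus is compact, compact support in \<open>[0,T[ \<times> \<bbbT>\<^sup>3\<close> means vanishing for
  times close to \<open>T\<close>; test functions need not vanish at time \<open>0\<close>.\<close>

definition test_functions :: "real \<Rightarrow> (real \<Rightarrow> real ^ 3 \<Rightarrow> real ^ 3) set" where
  "test_functions T = {\<phi>.
     smooth_on ({0..<T} \<times> UNIV) (\<lambda>(t, x). \<phi> t x) \<and>
     (\<forall>t\<in>{0..<T}. periodic (\<phi> t)) \<and>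
     (\<exists>\<tau><T. \<forall>t x. \<tau> < t \<and> 0 \<le> t \<and> t < T \<longrightarrow> \<phi> t x = 0) \<and>
     (\<forall>t\<in>{0..<T}. \<forall>x. divergence (\<phi> t) x = 0)}"

definition time_deriv :: "(real \<Rightarrow> real ^ 3 \<Rightarrow> real ^ 3) \<Rightarrow> real \<Rightarrow> real ^ 3 \<Rightarrow> real ^ 3" where
  "time_deriv \<phi> t x = vector_derivative (\<lambda>s. \<phi> s x) (at t)"

definition convective_form :: "(real ^ 3 \<Rightarrow> real ^ 3) \<Rightarrow> (real ^ 3 \<Rightarrow> real ^ 3) \<Rightarrow> real" where
  \<comment> \<open>\<open>(v \<otimes> v, \<nabla>\<phi>)\<close>\<close>
  "convective_form v \<phi> =
     (\<integral>x. (\<Sum>i\<in>UNIV. \<Sum>j\<in>UNIV. v x $ i * v x $ j * partial j \<phi> x $ i) \<partial>torus)"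

text \<open>Measurability of \<open>t \<mapsto> v t\<close> with values in \<open>H\<close>, implicit in \<open>L\<^sup>\<infinity>(0,T;H)\<close>, comes from the joint
  measurability of \<open>v\<close> in \<open>weak_euler_solution\<close>.\<close>

definition ess_bounded_in_H :: "real \<Rightarrow> (real \<Rightarrow> real ^ 3 \<Rightarrow> real ^ 3) \<Rightarrow> bool" where
  "ess_bounded_in_H T v \<longleftrightarrow>
     (\<exists>C. AE t in lebesgue_on {0<..<T}. v t \<in> H_space \<and> L2_norm (v t) \<le> C)"

definition weak_euler_solution ::
  "real \<Rightarrow> (real ^ 3 \<Rightarrow> real ^ 3) \<Rightarrow> (real \<Rightarrow> real ^ 3 \<Rightarrow> real ^ 3) \<Rightarrow> bool" where
  "weak_euler_solution T v\<^sub>0 v \<longleftrightarrow>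
     (\<lambda>(t, x). v t x) \<in> borel_measurable (lebesgue_on ({0<..<T} \<times> UNIV)) \<and>
     (\<forall>t\<in>{0<..<T}. periodic (v t)) \<and>
     ess_bounded_in_H T v \<and>
     (\<forall>\<phi>\<in>test_functions T.
        (\<integral>t. L2_inner (v t) (time_deriv \<phi> t) + convective_form (v t) (\<phi> t)
           \<partial>lebesgue_on {0<..<T})
        = - L2_inner v\<^sub>0 (\<phi> 0))"

text \<open>\<open>w\<close> is the representative of \<open>v\<close>, as an element of \<open>L\<^sup>\<infinity>(0,T;H)\<close>, that is weakly continuous
  from \<open>[0,T]\<close> into \<open>L\<^sup>2\<close> with initial value \<open>v\<^sub>0\<close>. For each \<open>t\<close>, \<open>w t\<close> is determined up to a null set.\<close>

definition weakly_continuous_representative ::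
  "real \<Rightarrow> (real ^ 3 \<Rightarrow> real ^ 3) \<Rightarrow> (real \<Rightarrow> real ^ 3 \<Rightarrow> real ^ 3) \<Rightarrow>
   (real \<Rightarrow> real ^ 3 \<Rightarrow> real ^ 3) \<Rightarrow> bool" where
  "weakly_continuous_representative T v\<^sub>0 v w \<longleftrightarrow>
     (AE t in lebesgue_on {0<..<T}. AE x in lebesgue. w t x = v t x) \<and>
     (\<forall>t\<in>{0..T}. w t \<in> L2_torus) \<and>
     (\<forall>\<psi>\<in>L2_torus. continuous_on {0..T} (\<lambda>t. L2_inner (w t) \<psi>)) \<and>
     (AE x in lebesgue. w 0 x = v\<^sub>0 x)"

text \<open>\<open>u \<in> L\<^sup>\<beta>(0,T; C\<^sup>\<alpha>)\<close> with the homogeneous Hoelder space.  For periodic \<open>u\<close> the estimate with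
  the distance of \<open>\<real>\<^sup>3\<close> is the same as that with the distance of the torus.\<close>

definition L_beta_Holder ::
  "real \<Rightarrow> real \<Rightarrow> real \<Rightarrow> (real \<Rightarrow> real ^ 3 \<Rightarrow> real ^ 3) \<Rightarrow> bool" where
  "L_beta_Holder \<beta> T \<alpha> u \<longleftrightarrow>
     (\<exists>f :: real \<Rightarrow> real.
        (\<forall>t\<in>{0..T}. 0 \<le> f t) \<and>
        (AE t in lebesgue_on {0..T}. \<forall>x y. norm (u t x - u t y) \<le> f t * norm (x - y) powr \<alpha>) \<and>
        integrable (lebesgue_on {0..T}) (\<lambda>t. f t powr \<beta>))"

end

theory Submission
  imports Defs
begin

text \<open>
  For an even averaging kernel \<open>L\<close> on the torus consider the regularised energy
  \<open>g(t) = (w(t), L * w(t))\<close>.  Two identities carry the proof.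

  First, \<open>\<parallel>u\<parallel>\<^sup>2 - (u, L * u)\<close> is half the integral of \<open>L(x - y) |u(x) - u(y)|\<^sup>2\<close>.  So \<open>g(t)\<close> never
  exceeds \<open>\<parallel>w(t)\<parallel>\<^sup>2\<close>, and it approaches \<open>\<parallel>u\<parallel>\<^sup>2\<close> for \<open>u\<close> in \<open>H\<close> when \<open>L\<close> concentrates at the origin
  (\<open>energy_defect\<close>, \<open>energy_defect_bound\<close>).

  Second, \<open>L * w(t)\<close> is smooth and divergence free, so the weak formulation shows that \<open>g\<close> changes at
  the rate \<open>2 (v \<otimes> v, \<nabla>(L * v))\<close>, and by the identity of Duchon and Robert
  (\<open>Duchon_Robert_identity\<close>) this flux is \<open>-1/2\<close> times the integral of
  \<open>\<nabla>L(x - y) \<cdot> \<delta>u |\<delta>u|\<^sup>2\<close> with \<open>\<delta>u = u(x) - u(y)\<close>.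
  If \<open>u\<close> has Hoelder constant \<open>f\<close>, then \<open>|\<delta>u|\<^sup>3 \<le> f\<^sup>b |x - y|\<^bsup>\<alpha> b\<^esup> (1 + |\<delta>u|\<^sup>2)\<close> for every
  \<open>1 \<le> b \<le> 3\<close>: the part of the cubic term that is not estimated by the Hoelder constant is absorbed
  by the energy, which is bounded anyway.  Hence only \<open>f\<^sup>b\<close> must be integrable in time
  (\<open>flux_bound\<close>), while the kernel contributes the integral of \<open>|\<nabla>L(z)| |z|\<^bsup>\<alpha> b\<^esup>\<close>, which tends to zero
  as \<open>L\<close> concentrates provided that \<open>\<alpha> b > 1\<close>.  The choice \<open>b = min 3 (1 / \<alpha> + \<delta>)\<close> meets both
  demands because \<open>\<alpha> > 1 / 3\<close>.

  The kernels are powers of \<open>(1 + cos z\<^sub>i) / 2\<close> (\<open>concentrating_kernels\<close>).  They are trigonometric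
  polynomials, so \<open>L * u\<close> is a finite sum of waves whose coefficients are continuous in time along
  \<open>w\<close>; this makes the mollified fields legitimate test functions and controls their gradients
  uniformly in time.

  Consequently \<open>g(t) - g(0)\<close> tends to zero for every \<open>t\<close> (\<open>regularized_energy_drift\<close>).  This gives
  \<open>\<parallel>v\<^sub>0\<parallel> \<le> \<parallel>w(t)\<parallel>\<close> for all \<open>t\<close>, and \<open>\<parallel>w(t)\<parallel> \<le> \<parallel>v\<^sub>0\<parallel>\<close> for almost all \<open>t\<close>, since \<open>v(t) \<in> H\<close> for almost
  all \<open>t\<close>; weak continuity extends the second inequality to all \<open>t\<close>.\<close>

section \<open>Integration over the torus\<close>

text \<open>Half open, so that its translates by the lattice tile space without overlap.\<close>

definition cell :: "(real ^ 3) set" where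
  "cell = {x. \<forall>i. 0 \<le> x $ i \<and> x $ i < 2 * pi}"

lemma cell_borel [measurable]: "cell \<in> sets borel"
  unfolding cell_def by measurable

lemma space_torus [simp]: "space torus = cbox 0 (\<chi> i. 2 * pi)"
  by (simp add: torus_def)

lemma finite_measure_torus: "finite_measure torus"
  unfolding torus_def by (rule finite_measure_lebesgue_on) simp

lemma borel_measurable_torusI:
  "f \<in> borel_measurable lebesgue \<Longrightarrow> f \<in> borel_measurable torus"
  unfolding torus_def by (rule measurable_restrict_space1)

lemma AE_torusI: "AE x in lebesgue. P x \<Longrightarrow> AE x in torus. P x"
  unfolding torus_def by (subst AE_restrict_space_iff) auto

lemma continuous_measurable_torus:
  fixes F :: "real ^ 3 \<Rightarrow> 'b::euclidean_space"
  assumes "continuous_on UNIV F"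
  shows "F \<in> borel_measurable torus"
  by (intro borel_measurable_torusI measurable_completion)
     (use borel_measurable_continuous_onI[OF assms] in simp)

lemma continuous_bounded_on_cbox:
  fixes F :: "real ^ 3 \<Rightarrow> 'b::real_normed_vector"
  assumes "continuous_on UNIV F"
  obtains B where "B > 0" "\<And>x. x \<in> cbox a b \<Longrightarrow> norm (F x) \<le> B"
proof -
  have "bounded (F ` cbox a b)"
    by (intro compact_imp_bounded compact_continuous_image continuous_on_subset[OF assms]) auto
  then show thesis using that unfolding bounded_pos by auto
qed

lemma continuous_integrable_torus:
  fixes F :: "real ^ 3 \<Rightarrow> 'b::euclidean_space"
  assumes "continuous_on UNIV F"
  shows "integrable torus F"
proof -
  interpret finite_measure torus by (rule finite_measure_torus)
  obtain B where "\<And>x. x \<in> cbox 0 (\<chi> i. 2 * pi) \<Longrightarrow> norm (F x) \<le> B"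
    using continuous_bounded_on_cbox[OF assms] by metis
  then show ?thesis
    by (intro integrable_const_bound[where B = B] continuous_measurable_torus assms AE_I2) simp
qed

lemma torus_integral_cell:
  fixes F :: "real ^ 3 \<Rightarrow> real"
  assumes F: "F \<in> borel_measurable borel"
  shows "(\<integral>x. F x \<partial>torus) = (\<integral>x. indicator cell x * F x \<partial>lborel)"
proof -
  let ?c = "\<chi> i. 2 * pi :: real ^ 3"
  have "(\<integral>x. F x \<partial>torus) = (\<integral>x. indicator (cbox 0 ?c) x * F x \<partial>lebesgue)"
    unfolding torus_def by (subst integral_restrict_space) auto
  also have "\<dots> = (\<integral>x. indicator cell x * F x \<partial>lebesgue)"
  proof (rule integral_cong_AE)
    have "AE x in lebesgue. x \<notin> cbox 0 ?c - box 0 ?c"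
      using negligible_frontier_interval[of 0 ?c] unfolding negligible_iff_null_sets by (rule AE_not_in)
    then show "AE x in lebesgue. indicator (cbox 0 ?c) x * F x = indicator cell x * F x"
    proof eventually_elim
      case (elim x)
      have "box 0 ?c \<subseteq> cell" "cell \<subseteq> cbox 0 ?c"
        by (auto simp: cell_def mem_box_cart less_imp_le)
      then show ?case using elim by (auto simp: indicator_def)
    qed
  qed (use F in \<open>auto intro!: borel_measurable_times measurable_completion\<close>)
  also have "\<dots> = (\<integral>x. indicator cell x * F x \<partial>lborel)"
    by (rule integral_completion) (use F in measurable)
  finally show ?thesis .
qed

text \<open>The shifted cell arises from the cell by moving the slab below height \<open>h\<close> up by one period, and
  periodicity makes the moved slab contribute what it contributed before.\<close>

lemma torus_integral_shift_small:
  fixes F :: "real ^ 3 \<Rightarrow> real"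
  assumes F: "continuous_on UNIV F" and per: "periodic F" and h: "0 \<le> h" "h < 2 * pi"
  shows "(\<integral>x. F (x + axis i h) \<partial>torus) = (\<integral>x. F x \<partial>torus)"
proof -
  let ?e = "axis i h :: real ^ 3" and ?p = "axis i (2 * pi) :: real ^ 3"
  let ?A = "cell \<inter> {x. x $ i < h}"
  have Fb [measurable]: "F \<in> borel_measurable borel"
    by (rule borel_measurable_continuous_onI[OF F])
  have Am [measurable]: "?A \<in> sets borel" by measurable
  have shift: "(\<integral>x. g (c + x) \<partial>lborel) = (\<integral>x. g x \<partial>lborel)"
    if [measurable]: "g \<in> borel_measurable borel" for g :: "real ^ 3 \<Rightarrow> real" and c
  proof -
    have "(\<integral>x. g x \<partial>lborel) = (\<integral>x. g x \<partial>(distr lborel borel ((+) c)))"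
      by (simp add: lborel_distr_plus)
    also have "\<dots> = (\<integral>x. g (c + x) \<partial>lborel)"
      by (rule integral_distr) auto
    finally show ?thesis by simp
  qed
  have int: "integrable lborel (\<lambda>x. indicator S x * F x)" if "S \<subseteq> cell" "S \<in> sets borel" for S
  proof -
    obtain B where B: "\<And>x. x \<in> cbox 0 (\<chi> i. 2 * pi) \<Longrightarrow> norm (F x) \<le> B"
      using continuous_bounded_on_cbox[OF F] by metis
    have sub: "S \<subseteq> cbox 0 (\<chi> i. 2 * pi)"
      using that by (auto simp: cell_def mem_box_cart less_imp_le)
    have "integrable lborel (\<lambda>x. indicator (cbox 0 (\<chi> i. 2 * pi)) x * B :: real)"
      by (intro integrable_mult_left integrable_real_indicator) (auto simp: emeasure_lborel_cbox_eq)
    then show ?thesis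
    proof (rule Bochner_Integration.integrable_bound)
      show "(\<lambda>x. indicator S x * F x) \<in> borel_measurable lborel" using that by measurable
      have "norm (indicator S x * F x) \<le> norm (indicator (cbox 0 (\<chi> i. 2 * pi)) x * B)" for x
        using B[of x] sub by (cases "x \<in> S") (auto simp: subset_iff)
      then show "AE x in lborel. norm (indicator S x * F x) \<le> norm (indicator (cbox 0 (\<chi> i. 2 * pi)) x * B)"
        by simp
    qed
  qed
  have eq: "indicator cell (x - ?e) = (indicator (cell - ?A) x + indicator ?A (x - ?p) :: real)" for x
  proof -
    have ax: "axis i c $ j = (if j = i then c else 0)" for j and c :: real
      by (auto simp: axis_def)
    have "x - ?e \<in> cell \<longleftrightarrow> (x \<in> cell - ?A) \<or> (x - ?p \<in> ?A)"
    proof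
      assume a: "x - ?e \<in> cell"
      then have j: "0 \<le> x $ j \<and> x $ j < 2 * pi" if "j \<noteq> i" for j
        using that unfolding cell_def by (auto simp: ax dest!: spec[of _ j])
      have i: "h \<le> x $ i" "x $ i < 2 * pi + h"
        using a unfolding cell_def by (auto simp: ax dest!: spec[of _ i])
      show "(x \<in> cell - ?A) \<or> (x - ?p \<in> ?A)"
      proof (cases "x $ i < 2 * pi")
        case True
        have "0 \<le> x $ k \<and> x $ k < 2 * pi" for k
          by (cases "k = i") (use i j[of k] h True in auto)
        then have "x \<in> cell" unfolding cell_def by simp
        then show ?thesis using i by auto
      next
        case False
        have "0 \<le> (x - ?p) $ k \<and> (x - ?p) $ k < 2 * pi" for k
          by (cases "k = i") (use i j[of k] h False in \<open>auto simp: ax\<close>)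
        then have "x - ?p \<in> cell" unfolding cell_def by simp
        then show ?thesis using i by (auto simp: ax)
      qed
    next
      assume "(x \<in> cell - ?A) \<or> (x - ?p \<in> ?A)"
      then show "x - ?e \<in> cell"
      proof
        assume a: "x \<in> cell - ?A"
        then have "h \<le> x $ i" by auto
        moreover have "0 \<le> x $ k \<and> x $ k < 2 * pi" for k
          using a unfolding cell_def by simp
        ultimately have "0 \<le> (x - ?e) $ k \<and> (x - ?e) $ k < 2 * pi" for k
          using h by (cases "k = i") (simp_all add: ax, smt (verit))
        then show ?thesis unfolding cell_def by simp
      next
        assume a: "x - ?p \<in> ?A"
        then have "x $ i < 2 * pi + h" by (auto simp: ax)
        moreover have "0 \<le> x $ j \<and> x $ j < 2 * pi" if "j \<noteq> i" for j
          using a that unfolding cell_def by (auto simp: ax dest!: spec[of _ j])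
        moreover have "2 * pi \<le> x $ i"
          using a unfolding cell_def by (auto simp: ax dest!: spec[of _ i])
        ultimately have "0 \<le> (x - ?e) $ k \<and> (x - ?e) $ k < 2 * pi" for k
          using h by (cases "k = i") (auto simp: ax)
        then show ?thesis unfolding cell_def by simp
      qed
    qed
    moreover have "\<not> ((x \<in> cell - ?A) \<and> (x - ?p \<in> ?A))"
      unfolding cell_def by (auto simp: ax dest!: spec[of _ i])
    ultimately show ?thesis by (auto simp: indicator_def)
  qed
  have perp: "F (?p + x) = F x" for x
    using per unfolding periodic_def by (metis add.commute)
  have "(\<integral>x. F (x + ?e) \<partial>torus) = (\<integral>x. indicator cell x * F (x + ?e) \<partial>lborel)"
    by (rule torus_integral_cell) measurable
  also have "\<dots> = (\<integral>x. indicator cell ((?e + x) - ?e) * F (?e + x) \<partial>lborel)"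
    by (simp add: add.commute)
  also have "\<dots> = (\<integral>x. indicator cell (x - ?e) * F x \<partial>lborel)"
    by (rule shift[where g = "\<lambda>x. indicator cell (x - ?e) * F x"]) measurable
  also have "\<dots> = (\<integral>x. indicator (cell - ?A) x * F x + indicator ?A (x - ?p) * F x \<partial>lborel)"
    by (simp only: eq distrib_right)
  also have "\<dots> = (\<integral>x. indicator (cell - ?A) x * F x \<partial>lborel) + (\<integral>x. indicator ?A (x - ?p) * F x \<partial>lborel)"
  proof (rule Bochner_Integration.integral_add)
    show "integrable lborel (\<lambda>x. indicator (cell - ?A) x * F x)" by (rule int) auto
    have "integrable (distr lborel borel ((+) ?p)) (\<lambda>x. indicator ?A (x - ?p) * F x)"
      by (subst integrable_distr_eq) (auto simp: perp intro!: int)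
    then show "integrable lborel (\<lambda>x. indicator ?A (x - ?p) * F x)"
      by (simp add: lborel_distr_plus)
  qed
  also have "(\<integral>x. indicator ?A (x - ?p) * F x \<partial>lborel) = (\<integral>x. indicator ?A ((?p + x) - ?p) * F (?p + x) \<partial>lborel)"
    by (rule shift[where g = "\<lambda>x. indicator ?A (x - ?p) * F x", symmetric]) measurable
  also have "\<dots> = (\<integral>x. indicator ?A x * F x \<partial>lborel)" by (simp add: perp)
  also have "(\<integral>x. indicator (cell - ?A) x * F x \<partial>lborel) + (\<integral>x. indicator ?A x * F x \<partial>lborel)
     = (\<integral>x. indicator (cell - ?A) x * F x + indicator ?A x * F x \<partial>lborel)"
    by (rule Bochner_Integration.integral_add[symmetric]; rule int; auto)
  also have "\<dots> = (\<integral>x. indicator cell x * F x \<partial>lborel)"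
    by (rule Bochner_Integration.integral_cong) (auto simp: indicator_def)
  also have "\<dots> = (\<integral>x. F x \<partial>torus)"
    by (rule torus_integral_cell[symmetric]) measurable
  finally show ?thesis .
qed

lemma periodic_axis_int:
  assumes "periodic u"
  shows "u (x + axis i (2 * pi * of_int k)) = u x"
proof -
  have nat: "u (x + axis i (2 * pi * real n)) = u x" for n x
  proof (induction n arbitrary: x)
    case (Suc n)
    have "axis i (2 * pi * real (Suc n)) = axis i (2 * pi * real n) + axis i (2 * pi)"
      by (auto simp: vec_eq_iff axis_def algebra_simps)
    then have "u (x + axis i (2 * pi * real (Suc n))) = u (x + axis i (2 * pi * real n) + axis i (2 * pi))"
      by (simp add: add.assoc)
    also have "\<dots> = u (x + axis i (2 * pi * real n))" using assms unfolding periodic_def by blast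
    finally show ?case using Suc by simp
  qed (auto simp: axis_def zero_vec_def[symmetric])
  show ?thesis
  proof (cases "k \<ge> 0")
    case True
    then show ?thesis using nat[of x "nat k"] by simp
  next
    case False
    have "axis i (2 * pi * of_int k) + axis i (2 * pi * real (nat (- k))) = 0"
      using False by (auto simp: vec_eq_iff axis_def)
    then show ?thesis using nat[of "x + axis i (2 * pi * of_int k)" "nat (- k)"]
      by (simp add: add.assoc)
  qed
qed

lemma periodic_lattice:
  assumes "periodic u"
  shows "u (x + (\<chi> i. 2 * pi * of_int (k i))) = u x"
proof -
  have "(\<chi> i. 2 * pi * of_int (k i)) = axis 1 (2 * pi * of_int (k 1)) + axis 2 (2 * pi * of_int (k 2))
      + axis 3 (2 * pi * of_int (k (3::3)))"
    by (simp add: vec_eq_iff forall_3 axis_def)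
  then show ?thesis
    by (metis (no_types, lifting) add.assoc periodic_axis_int[OF assms])
qed

lemma torus_integral_shift_axis:
  fixes F :: "real ^ 3 \<Rightarrow> real"
  assumes F: "continuous_on UNIV F" and per: "periodic F"
  shows "(\<integral>x. F (x + axis i h) \<partial>torus) = (\<integral>x. F x \<partial>torus)"
proof -
  define k where "k = \<lfloor>h / (2 * pi)\<rfloor>"
  define r where "r = h - 2 * pi * of_int k"
  have r: "0 \<le> r" "r < 2 * pi"
  proof -
    have "of_int k \<le> h / (2 * pi)" "h / (2 * pi) < of_int k + 1" unfolding k_def by linarith+
    then show "0 \<le> r" "r < 2 * pi" unfolding r_def by (auto simp: field_simps)
  qed
  have "F (x + axis i h) = F (x + axis i r)" for x
  proof -
    have "x + axis i h = x + axis i r + axis i (2 * pi * of_int k)"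
      by (auto simp: vec_eq_iff axis_def r_def)
    then show ?thesis using periodic_axis_int[OF per] by metis
  qed
  then show ?thesis using torus_integral_shift_small[OF F per r] by simp
qed

lemma torus_integral_shift:
  fixes F :: "real ^ 3 \<Rightarrow> real"
  assumes F: "continuous_on UNIV F" and per: "periodic F"
  shows "(\<integral>x. F (x + a) \<partial>torus) = (\<integral>x. F x \<partial>torus)"
proof -
  have c: "continuous_on UNIV (\<lambda>x. F (x + b))" for b
    by (intro continuous_on_compose2[OF F] continuous_intros) auto
  have p: "periodic (\<lambda>x. F (x + b))" for b
    using per unfolding periodic_def by (metis add.commute add.left_commute)
  have "a = axis 3 (a $ 3) + axis 2 (a $ 2) + axis (1::3) (a $ 1)"
    by (simp add: vec_eq_iff forall_3 axis_def)
  then have "(\<integral>x. F (x + a) \<partial>torus)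
      = (\<integral>x. F (x + axis 3 (a $ 3) + axis 2 (a $ 2) + axis 1 (a $ 1)) \<partial>torus)"
    by (metis (no_types, lifting) add.assoc)
  also have "\<dots> = (\<integral>x. F (x + axis 2 (a $ 2) + axis 1 (a $ 1)) \<partial>torus)"
    using torus_integral_shift_axis[OF c[of "axis 2 (a $ 2) + axis 1 (a $ 1)"] p, of 3 "a $ 3"]
    by (simp add: add.assoc)
  also have "\<dots> = (\<integral>x. F (x + axis 1 (a $ 1)) \<partial>torus)"
    using torus_integral_shift_axis[OF c[of "axis 1 (a $ 1)"] p, of 2 "a $ 2"] by (simp add: add.assoc)
  also have "\<dots> = (\<integral>x. F x \<partial>torus)" by (rule torus_integral_shift_axis[OF F per])
  finally show ?thesis .
qed

lemma has_derivative_along_axis: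
  fixes f :: "real ^ 3 \<Rightarrow> 'b::real_normed_vector"
  assumes "(f has_derivative f') (at x)"
  shows "((\<lambda>h. f (x + axis i h)) has_derivative (\<lambda>h. h *\<^sub>R f' (axis i 1))) (at 0)"
proof -
  have ax: "axis i h = h *\<^sub>R (axis i 1 :: real ^ 3)" for h :: real
    by (auto simp: vec_eq_iff axis_def)
  have a: "((\<lambda>h. x + h *\<^sub>R axis i 1) has_derivative (\<lambda>h. h *\<^sub>R axis i 1)) (at 0)"
    by (auto intro!: derivative_eq_intros)
  have "(f has_derivative f') (at (x + 0 *\<^sub>R axis i 1))" using assms by simp
  from has_derivative_compose[OF a this]
  have "((\<lambda>h. f (x + h *\<^sub>R axis i 1)) has_derivative (\<lambda>h. f' (h *\<^sub>R axis i 1))) (at 0)" .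
  moreover have "f' (h *\<^sub>R axis i 1) = h *\<^sub>R f' (axis i 1)" for h
    by (rule linear_scale[OF has_derivative_linear[OF assms]])
  moreover have "(\<lambda>h. f (x + axis i h)) = (\<lambda>h. f (x + h *\<^sub>R axis i 1))"
    by (rule ext, subst ax, rule refl)
  ultimately show ?thesis by (simp only:)
qed

text \<open>This is integration by parts on the torus: difference quotients of a periodic function integrate
  to zero by translation invariance, and dominated convergence passes to the derivative.\<close>

lemma torus_integral_partial_derivative:
  fixes F G :: "real ^ 3 \<Rightarrow> real"
  assumes F: "continuous_on UNIV F" and per: "periodic F"
    and der: "\<And>x. ((\<lambda>h. F (x + axis i h)) has_real_derivative G x) (at 0)"
    and G: "continuous_on UNIV G"
  shows "(\<integral>x. G x \<partial>torus) = 0"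
proof -
  interpret finite_measure torus by (rule finite_measure_torus)
  define h where "h n = inverse (real (Suc n))" for n
  have h: "0 < h n" "h n \<le> 1" for n by (auto simp: h_def field_simps)
  have ax0: "x + axis i 0 = x" for x :: "real ^ 3" by (auto simp: vec_eq_iff axis_def)
  define D where "D n x = (F (x + axis i (h n)) - F x) / h n" for n x
  have der': "((\<lambda>h. F (x + axis i h)) has_real_derivative G (x + axis i t)) (at t)" for x t
  proof -
    have "((\<lambda>s. F ((x + axis i t) + axis i (s - t))) has_real_derivative G (x + axis i t) * 1) (at t)"
      by (rule DERIV_chain2[where g = "\<lambda>s. s - t"]) (use der[of "x + axis i t"] in \<open>auto intro!: derivative_eq_intros\<close>)
    moreover have "(x + axis i t) + axis i (s - t) = x + axis i s" for s
      by (auto simp: vec_eq_iff axis_def)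
    ultimately show ?thesis by simp
  qed
  have c: "continuous_on UNIV (\<lambda>x. F (x + b))" for b
    by (intro continuous_on_compose2[OF F] continuous_intros) auto
  have D0: "(\<integral>x. D n x \<partial>torus) = 0" for n
    using torus_integral_shift_axis[OF F per, of i "h n"] unfolding D_def
    by (simp add: Bochner_Integration.integral_diff continuous_integrable_torus c F)
  obtain B where B: "\<And>x. x \<in> cbox 0 (\<chi> i. 2 * pi + 1) \<Longrightarrow> norm (G x) \<le> B"
    using continuous_bounded_on_cbox[OF G] by metis
  have "(\<lambda>n. \<integral>x. D n x \<partial>torus) \<longlonglongrightarrow> (\<integral>x. G x \<partial>torus)"
  proof (rule integral_dominated_convergence[where w = "\<lambda>_. B"])
    show "G \<in> borel_measurable torus" by (rule continuous_measurable_torus[OF G])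
    show "D n \<in> borel_measurable torus" for n
      unfolding D_def by (intro continuous_measurable_torus continuous_intros c F) (use h(1)[of n] in simp)
    show "AE x in torus. (\<lambda>n. D n x) \<longlonglongrightarrow> G x"
    proof (rule AE_I2)
      fix x
      have "(\<lambda>h. (F (x + axis i h) - F x) / h) \<midarrow>0\<rightarrow> G x"
        using der[of x] unfolding DERIV_def by (simp add: ax0)
      moreover have "filterlim h (at 0) sequentially"
        unfolding filterlim_at using LIMSEQ_inverse_real_of_nat
        by (simp add: h_def[abs_def] eventually_sequentially)
      ultimately show "(\<lambda>n. D n x) \<longlonglongrightarrow> G x"
        unfolding D_def by (rule filterlim_compose)
    qed
    show "AE x in torus. norm (D n x) \<le> B" for n
    proof (rule AE_I2)
      fix x assume "x \<in> space torus"
      then have x: "x \<in> cbox 0 (\<chi> i. 2 * pi)" by simp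
      obtain z where z: "0 < z" "z < h n" "F (x + axis i (h n)) - F (x + axis i 0) = (h n - 0) * G (x + axis i z)"
        using MVT2[OF h(1)[of n], of "\<lambda>t. F (x + axis i t)" "\<lambda>t. G (x + axis i t)"] der' by blast
      have "D n x = G (x + axis i z)"
        using z h(1)[of n] unfolding D_def by (simp add: ax0 field_simps)
      moreover have "x + axis i z \<in> cbox 0 (\<chi> i. 2 * pi + 1)"
      proof -
        have "0 \<le> x $ j" "x $ j \<le> 2 * pi" for j using x by (auto simp: mem_box_cart)
        moreover have "0 \<le> axis i z $ j" "axis i z $ j \<le> 1" for j
          using z(1,2) h(2)[of n] by (auto simp: axis_def)
        ultimately show ?thesis by (simp add: mem_box_cart add_nonneg_nonneg add_mono)
      qed
      ultimately show "norm (D n x) \<le> B" using B by simp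
    qed
  qed auto
  then have "(\<lambda>n. 0 :: real) \<longlonglongrightarrow> (\<integral>x. G x \<partial>torus)" by (simp only: D0)
  then show ?thesis by (simp add: LIMSEQ_const_iff)
qed

section \<open>Square integrable fields and even kernels\<close>

interpretation torus: finite_measure torus by (rule finite_measure_torus)
interpretation torus2: pair_sigma_finite torus torus ..

abbreviation torus2 :: "((real ^ 3) \<times> (real ^ 3)) measure" where
  "torus2 \<equiv> torus \<Otimes>\<^sub>M torus"

lemma L2_torusD:
  assumes "u \<in> L2_torus"
  shows "periodic u" "u \<in> borel_measurable torus" "integrable torus (\<lambda>x. (norm (u x))\<^sup>2)"
    "integrable torus u"
proof -
  show *: "periodic u" "u \<in> borel_measurable torus" "integrable torus (\<lambda>x. (norm (u x))\<^sup>2)"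
    using assms by (auto simp: L2_torus_def intro: borel_measurable_torusI)
  have "integrable torus (\<lambda>x. 1 + (norm (u x))\<^sup>2)" using * by simp
  moreover have "norm (u x) \<le> norm (1 + (norm (u x))\<^sup>2)" for x
    using sum_squares_bound[of 1 "norm (u x)"] by (simp add: power2_eq_square)
       (use zero_le_square[of "norm (u x)"] in linarith)
  then have "AE x in torus. norm (u x) \<le> norm (1 + (norm (u x))\<^sup>2)" by (intro AE_I2)
  ultimately show "integrable torus u" using *(2)
    by (intro Bochner_Integration.integrable_bound[of torus "\<lambda>x. 1 + (norm (u x))\<^sup>2" u])
qed

lemma L2_inner_integrable:
  assumes "u \<in> L2_torus" "v \<in> L2_torus"
  shows "integrable torus (\<lambda>x. u x \<bullet> v x)"
proof (rule Bochner_Integration.integrable_bound)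
  show "integrable torus (\<lambda>x. (norm (u x))\<^sup>2 + (norm (v x))\<^sup>2)"
    using L2_torusD assms by auto
  show "(\<lambda>x. u x \<bullet> v x) \<in> borel_measurable torus"
    using L2_torusD(2)[OF assms(1)] L2_torusD(2)[OF assms(2)] by measurable
  have "norm (u x \<bullet> v x) \<le> norm ((norm (u x))\<^sup>2 + (norm (v x))\<^sup>2)" for x
  proof -
    have "\<bar>u x \<bullet> v x\<bar> \<le> norm (u x) * norm (v x)" by (rule Cauchy_Schwarz_ineq2)
    moreover have "2 * (norm (u x) * norm (v x)) \<le> (norm (u x))\<^sup>2 + (norm (v x))\<^sup>2"
      using sum_squares_bound[of "norm (u x)" "norm (v x)"] by (simp add: mult.assoc)
    moreover have "0 \<le> norm (u x) * norm (v x)" by simp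
    ultimately show ?thesis by simp
  qed
  then show "AE x in torus. norm (u x \<bullet> v x) \<le> norm ((norm (u x))\<^sup>2 + (norm (v x))\<^sup>2)" by simp
qed

lemma L2_inner_self: "L2_inner u u = (\<integral>x. (norm (u x))\<^sup>2 \<partial>torus)"
  by (simp add: L2_inner_def dot_square_norm)

lemma L2_inner_self_nonneg [simp]: "0 \<le> L2_inner u u"
  unfolding L2_inner_self by (rule Bochner_Integration.integral_nonneg) simp

lemma L2_inner_le_square:
  assumes "L2_norm u \<le> c"
  shows "L2_inner u u \<le> c\<^sup>2"
proof -
  have "0 \<le> L2_norm u" by (simp add: L2_norm_def)
  then have "(L2_norm u)\<^sup>2 \<le> c\<^sup>2" using assms by (intro power_mono)
  then show ?thesis by (simp add: L2_norm_def)
qed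

text \<open>A weighted form of the Cauchy-Schwarz inequality; the weight \<open>c\<close> is tuned to the smallness of
  one factor.\<close>

lemma L2_inner_Young:
  assumes u: "u \<in> L2_torus" and v: "v \<in> L2_torus" and c: "c > 0"
  shows "2 * \<bar>L2_inner u v\<bar> \<le> c * L2_inner u u + L2_inner v v / c"
proof -
  have "2 * \<bar>L2_inner u v\<bar> \<le> 2 * (\<integral>x. \<bar>u x \<bullet> v x\<bar> \<partial>torus)"
    unfolding L2_inner_def by simp
  also have "\<dots> = (\<integral>x. 2 * \<bar>u x \<bullet> v x\<bar> \<partial>torus)" by simp
  also have "\<dots> \<le> (\<integral>x. c * (norm (u x))\<^sup>2 + (norm (v x))\<^sup>2 / c \<partial>torus)"
  proof (rule integral_mono)
    show "integrable torus (\<lambda>x. 2 * \<bar>u x \<bullet> v x\<bar>)"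
      using L2_inner_integrable[OF u v] by simp
    show "integrable torus (\<lambda>x. c * (norm (u x))\<^sup>2 + (norm (v x))\<^sup>2 / c)"
      using L2_torusD(3)[OF u] L2_torusD(3)[OF v] by simp
    fix x
    have "2 * (sqrt c * norm (u x)) * (norm (v x) / sqrt c) \<le> (sqrt c * norm (u x))\<^sup>2 + (norm (v x) / sqrt c)\<^sup>2"
      by (rule sum_squares_bound)
    then have "2 * (norm (u x) * norm (v x)) \<le> c * (norm (u x))\<^sup>2 + (norm (v x))\<^sup>2 / c"
      using c by (simp add: power_mult_distrib power_divide)
    then show "2 * \<bar>u x \<bullet> v x\<bar> \<le> c * (norm (u x))\<^sup>2 + (norm (v x))\<^sup>2 / c"
      using Cauchy_Schwarz_ineq2[of "u x" "v x"] by linarith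
  qed
  also have "\<dots> = c * L2_inner u u + L2_inner v v / c"
    unfolding L2_inner_self using L2_torusD(3)[OF u] L2_torusD(3)[OF v] by simp
  finally show ?thesis .
qed

lemma L2_torus_continuous:
  assumes "continuous_on UNIV u" "periodic u"
  shows "u \<in> L2_torus"
  unfolding L2_torus_def
  using assms borel_measurable_continuous_onI[OF assms(1)]
  by (auto intro!: continuous_integrable_torus continuous_intros measurable_completion)

lemma L2_torus_diff:
  assumes u: "u \<in> L2_torus" and v: "v \<in> L2_torus"
  shows "(\<lambda>x. u x - v x) \<in> L2_torus"
proof -
  have "integrable torus (\<lambda>x. (norm (u x - v x))\<^sup>2)"
  proof -
    have "(norm (u x - v x))\<^sup>2 = (norm (u x))\<^sup>2 + (norm (v x))\<^sup>2 - 2 * (u x \<bullet> v x)" for x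
      by (simp add: power2_norm_eq_inner inner_diff_left inner_diff_right inner_commute)
    then show ?thesis using L2_torusD(3)[OF u] L2_torusD(3)[OF v] L2_inner_integrable[OF u v] by simp
  qed
  then show ?thesis using u v by (auto simp: L2_torus_def periodic_def)
qed

lemma L2_inner_cong_AE:
  assumes "u \<in> borel_measurable torus" "u' \<in> borel_measurable torus" "v \<in> borel_measurable torus"
    and "AE x in lebesgue. u x = u' x"
  shows "L2_inner u v = L2_inner u' v"
  unfolding L2_inner_def
proof (rule integral_cong_AE)
  show "AE x in torus. u x \<bullet> v x = u' x \<bullet> v x" using AE_torusI[OF assms(4)] by eventually_elim simp
qed (use assms in measurable)

lemma L2_inner_self_cong_AE:
  assumes "u \<in> L2_torus" "u' \<in> L2_torus" and ae: "AE x in lebesgue. u x = u' x"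
  shows "L2_inner u u = L2_inner u' u'"
proof -
  have "L2_inner u u = L2_inner u' u" using assms by (intro L2_inner_cong_AE L2_torusD)
  also have "\<dots> = L2_inner u u'" by (simp add: L2_inner_def inner_commute)
  also have "\<dots> = L2_inner u' u'" using assms by (intro L2_inner_cong_AE L2_torusD)
  finally show ?thesis .
qed

lemma integrable_continuous_scaleR:
  fixes f :: "real ^ 3 \<Rightarrow> 'b::euclidean_space"
  assumes c: "continuous_on UNIV c" and f: "integrable torus f"
  shows "integrable torus (\<lambda>x. c x *\<^sub>R f x)"
proof -
  obtain B where B: "B > 0" "\<And>x. x \<in> cbox 0 (\<chi> i. 2 * pi) \<Longrightarrow> norm (c x :: real) \<le> B"
    using continuous_bounded_on_cbox[OF c] by metis
  show ?thesis
  proof (rule Bochner_Integration.integrable_bound)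
    show "integrable torus (\<lambda>x. B *\<^sub>R f x)" using f by simp
    show "(\<lambda>x. c x *\<^sub>R f x) \<in> borel_measurable torus"
      using continuous_measurable_torus[OF c] borel_measurable_integrable[OF f] by measurable
    show "AE x in torus. norm (c x *\<^sub>R f x) \<le> norm (B *\<^sub>R f x)"
      by (rule AE_I2) (use B in \<open>auto intro: mult_right_mono\<close>)
  qed
qed

lemma torus_borel_fst [measurable]: "fst \<in> borel_measurable torus2"
  by (rule measurable_compose[OF measurable_fst continuous_measurable_torus[of "\<lambda>x. x"]]) simp

lemma torus_borel_snd [measurable]: "snd \<in> borel_measurable torus2"
  by (rule measurable_compose[OF measurable_snd continuous_measurable_torus[of "\<lambda>x. x"]]) simp

lemma even_kernel_shift:
  fixes M :: "real ^ 3 \<Rightarrow> real"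
  assumes M: "continuous_on UNIV M" "periodic M" and even: "\<And>z. M (- z) = M z"
  shows "(\<integral>y. M (x - y) \<partial>torus) = (\<integral>y. M y \<partial>torus)" "(\<integral>x. M (x - y) \<partial>torus) = (\<integral>y. M y \<partial>torus)"
proof -
  show "(\<integral>x. M (x - y) \<partial>torus) = (\<integral>y. M y \<partial>torus)"
    using torus_integral_shift[OF M, of "- y"] by simp
  have "(\<integral>y. M (x - y) \<partial>torus) = (\<integral>y. M (y - x) \<partial>torus)"
    using even by (metis minus_diff_eq)
  then show "(\<integral>y. M (x - y) \<partial>torus) = (\<integral>y. M y \<partial>torus)"
    using torus_integral_shift[OF M, of "- x"] by simp
qed

text \<open>Integrating out the variable on which \<open>h\<close> does not depend leaves the full integral of \<open>M\<close>, by
  translation invariance and evenness.  All double integrals below are estimated by this.\<close>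

lemma even_kernel_integral:
  fixes M h :: "real ^ 3 \<Rightarrow> real"
  assumes M: "continuous_on UNIV M" "periodic M" and even: "\<And>z. M (- z) = M z"
    and h: "integrable torus h"
  shows "integrable torus2 (\<lambda>(x, y). M (x - y) * h x)"
    and "integrable torus2 (\<lambda>(x, y). M (x - y) * h y)"
    and "(\<integral>(x, y). M (x - y) * h x \<partial>torus2) = (\<integral>z. M z \<partial>torus) * (\<integral>x. h x \<partial>torus)"
    and "(\<integral>(x, y). M (x - y) * h y \<partial>torus2) = (\<integral>z. M z \<partial>torus) * (\<integral>x. h x \<partial>torus)"
proof -
  have Mb [measurable]: "M \<in> borel_measurable borel" by (rule borel_measurable_continuous_onI[OF M(1)])
  have hb [measurable]: "h \<in> borel_measurable torus" using h by (rule borel_measurable_integrable)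
  have c: "continuous_on UNIV (\<lambda>y. M (x - y))" for x
    by (intro continuous_on_compose2[OF M(1)] continuous_intros) auto
  have shift: "(\<integral>y. \<bar>M (x - y)\<bar> \<partial>torus) = (\<integral>y. \<bar>M y\<bar> \<partial>torus)" for x
  proof (rule even_kernel_shift)
    show "continuous_on UNIV (\<lambda>x. \<bar>M x\<bar>)" by (intro continuous_intros M)
  qed (use M even in \<open>auto simp: periodic_def\<close>)
  have int: "integrable torus2 (\<lambda>(x, y). M (x - y) * h x)"
  proof (rule torus2.Fubini_integrable)
    show "(\<lambda>(x, y). M (x - y) * h x) \<in> borel_measurable torus2"
      unfolding split_beta by measurable
    show "integrable torus (\<lambda>x. \<integral>y. norm (case (x, y) of (x, y) \<Rightarrow> M (x - y) * h x) \<partial>torus)"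
      using h by (simp add: abs_mult shift)
    show "AE x in torus. integrable torus (\<lambda>y. case (x, y) of (x, y) \<Rightarrow> M (x - y) * h x)"
      using c by (auto intro!: AE_I2 integrable_mult_left continuous_integrable_torus)
  qed
  then show "integrable torus2 (\<lambda>(x, y). M (x - y) * h x)" .
  have eq: "(\<lambda>(x, y). case (y, x) of (x, y) \<Rightarrow> M (x - y) * h x) = (\<lambda>(x, y). M (x - y) * h y)"
    using even by (auto simp: fun_eq_iff) (metis minus_diff_eq)
  show "integrable torus2 (\<lambda>(x, y). M (x - y) * h y)"
    using torus2.integrable_product_swap[OF int] unfolding eq by simp
  have val: "(\<integral>(x, y). M (x - y) * h x \<partial>torus2) = (\<integral>z. M z \<partial>torus) * (\<integral>x. h x \<partial>torus)"
    by (subst torus2.integral_fst[OF int, symmetric]) (simp add: even_kernel_shift[OF M even])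
  then show "(\<integral>(x, y). M (x - y) * h x \<partial>torus2) = (\<integral>z. M z \<partial>torus) * (\<integral>x. h x \<partial>torus)" .
  show "(\<integral>(x, y). M (x - y) * h y \<partial>torus2) = (\<integral>z. M z \<partial>torus) * (\<integral>x. h x \<partial>torus)"
    using torus2.integral_product_swap[OF borel_measurable_integrable[OF int]] val unfolding eq by simp
qed

section \<open>Mollification by cosine polynomials\<close>

lemma cos_plus_mode:
  assumes "m $ i \<in> \<int>"
  shows "cos (m \<bullet> (z + axis i (2 * pi)) + c) = cos (m \<bullet> z + c)"
proof -
  obtain j where "m $ i = of_int j" using assms by (auto elim: Ints_cases)
  then have "m \<bullet> (z + axis i (2 * pi)) + c = (m \<bullet> z + c) + of_int j * (2 * pi)"
    by (simp add: inner_add_right inner_axis)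
  then show ?thesis using cos.plus_of_int[of "m \<bullet> z + c" j] by (simp add: ac_simps)
qed

lemma sin_plus_mode:
  assumes "m $ i \<in> \<int>"
  shows "sin (m \<bullet> (z + axis i (2 * pi))) = sin (m \<bullet> z)"
proof -
  obtain j where "m $ i = of_int j" using assms by (auto elim: Ints_cases)
  then have "m \<bullet> (z + axis i (2 * pi)) = m \<bullet> z + of_int j * (2 * pi)"
    by (simp add: inner_add_right inner_axis)
  then show ?thesis using sin.plus_of_int[of "m \<bullet> z" j] by simp
qed

text \<open>A kernel \<open>L(z) = \<Sum> a\<^sub>k cos (m\<^sub>k \<cdot> z)\<close> with integer wave vectors.  Mollification by it involves only
  finitely many Fourier modes, so it is smooth by inspection and needs no differentiation under the
  integral.  Integrality is imposed for all indices, so that statements about a single mode carry no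
  bound on the index.\<close>

locale cosine_kernel =
  fixes N :: nat and a :: "nat \<Rightarrow> real" and m :: "nat \<Rightarrow> real ^ 3"
  assumes integer_modes: "\<And>k i. m k $ i \<in> \<int>"
begin

definition L :: "real ^ 3 \<Rightarrow> real" where
  "L z = (\<Sum>k<N. a k * cos (m k \<bullet> z))"

definition grad :: "real ^ 3 \<Rightarrow> real ^ 3" where
  "grad z = - (\<Sum>k<N. (a k * sin (m k \<bullet> z)) *\<^sub>R m k)"

definition cos_coeff :: "(real ^ 3 \<Rightarrow> real ^ 3) \<Rightarrow> nat \<Rightarrow> real ^ 3" where
  "cos_coeff u k = (\<integral>y. cos (m k \<bullet> y) *\<^sub>R u y \<partial>torus)"

definition sin_coeff :: "(real ^ 3 \<Rightarrow> real ^ 3) \<Rightarrow> nat \<Rightarrow> real ^ 3" where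
  "sin_coeff u k = (\<integral>y. sin (m k \<bullet> y) *\<^sub>R u y \<partial>torus)"

definition mollify :: "(real ^ 3 \<Rightarrow> real ^ 3) \<Rightarrow> real ^ 3 \<Rightarrow> real ^ 3" where
  "mollify u x = (\<Sum>k<N. a k *\<^sub>R (cos (m k \<bullet> x) *\<^sub>R cos_coeff u k + sin (m k \<bullet> x) *\<^sub>R sin_coeff u k))"

text \<open>Incompressibility as seen by the modes of the kernel: each Fourier coefficient is orthogonal to its
  wave vector.\<close>

definition transversal :: "(real ^ 3 \<Rightarrow> real ^ 3) \<Rightarrow> bool" where
  "transversal u \<longleftrightarrow> (\<forall>k. m k \<bullet> cos_coeff u k = 0 \<and> m k \<bullet> sin_coeff u k = 0)"

lemma continuous_L: "continuous_on UNIV L"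
  unfolding L_def by (intro continuous_intros)

lemma periodic_L: "periodic L"
  unfolding periodic_def L_def using cos_plus_mode[OF integer_modes, of _ _ _ 0] by simp

lemma even_L: "L (- z) = L z"
  unfolding L_def by simp

lemma continuous_grad: "continuous_on UNIV grad"
  unfolding grad_def by (intro continuous_intros)

lemma odd_grad: "grad (- z) = - grad z"
  unfolding grad_def by (simp add: sum_negf)

lemma L_has_derivative: "(L has_derivative (\<lambda>h. grad z \<bullet> h)) (at z)"
  unfolding L_def[abs_def] grad_def
  by (auto intro!: derivative_eq_intros simp: fun_eq_iff inner_sum_left sum_negf[symmetric] intro!: sum.cong)

lemma L_has_axis_derivative: "((\<lambda>h. L (z + axis i h)) has_real_derivative grad z $ i) (at 0)"
  using has_derivative_along_axis[OF L_has_derivative[of z], of i]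
  by (simp add: has_field_derivative_def inner_axis mult_commute_abs)

lemma integrable_mode:
  assumes "integrable torus (u :: _ \<Rightarrow> real ^ 3)"
  shows "integrable torus (\<lambda>y. cos (m k \<bullet> y) *\<^sub>R u y)" "integrable torus (\<lambda>y. sin (m k \<bullet> y) *\<^sub>R u y)"
  by (intro integrable_continuous_scaleR assms continuous_intros)+

lemma mollify_convolution:
  assumes u: "integrable torus u"
  shows "mollify u x = (\<integral>y. L (x - y) *\<^sub>R u y \<partial>torus)"
proof -
  have "L (x - y) *\<^sub>R u y = (\<Sum>k<N. (a k * cos (m k \<bullet> x)) *\<^sub>R (cos (m k \<bullet> y) *\<^sub>R u y)
      + (a k * sin (m k \<bullet> x)) *\<^sub>R (sin (m k \<bullet> y) *\<^sub>R u y))" for y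
    unfolding L_def by (simp add: inner_diff_right cos_diff scaleR_sum_left algebra_simps sum.distrib)
  then show ?thesis
    using u unfolding mollify_def cos_coeff_def sin_coeff_def
    by (simp add: integrable_mode scaleR_add_right mult.assoc del: scaleR_scaleR)
       (simp add: mult.assoc[symmetric])
qed

lemma mollify_has_derivative:
  "(mollify u has_derivative (\<lambda>h. \<Sum>k<N. (a k * (m k \<bullet> h)) *\<^sub>R
     (cos (m k \<bullet> x) *\<^sub>R sin_coeff u k - sin (m k \<bullet> x) *\<^sub>R cos_coeff u k))) (at x)"
  unfolding mollify_def[abs_def]
  by (auto intro!: derivative_eq_intros sum.cong simp: fun_eq_iff algebra_simps)

lemma partial_mollify_modes:
  "partial j (mollify u) x = (\<Sum>k<N. (a k * m k $ j) *\<^sub>R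
     (cos (m k \<bullet> x) *\<^sub>R sin_coeff u k - sin (m k \<bullet> x) *\<^sub>R cos_coeff u k))"
  unfolding partial_def using frechet_derivative_at[OF mollify_has_derivative[where u = u and x = x], symmetric]
  by (simp add: inner_axis)

lemma partial_mollify:
  assumes u: "integrable torus u"
  shows "partial j (mollify u) x = (\<integral>y. grad (x - y) $ j *\<^sub>R u y \<partial>torus)"
proof -
  have "grad (x - y) $ j *\<^sub>R u y = (\<Sum>k<N. (a k * m k $ j * cos (m k \<bullet> x)) *\<^sub>R (sin (m k \<bullet> y) *\<^sub>R u y)
      - (a k * m k $ j * sin (m k \<bullet> x)) *\<^sub>R (cos (m k \<bullet> y) *\<^sub>R u y))" for y
    unfolding grad_def
    by (simp add: inner_diff_right sin_diff scaleR_sum_left algebra_simps sum.distrib sum_subtractf)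
  then show ?thesis
    using u unfolding partial_mollify_modes cos_coeff_def sin_coeff_def
    by (simp add: integrable_mode scaleR_diff_right mult.assoc del: scaleR_scaleR)
       (simp add: mult.assoc[symmetric])
qed

lemma divergence_mollify:
  assumes "transversal u"
  shows "divergence (mollify u) x = 0"
proof -
  have "divergence (mollify u) x = (\<Sum>k<N. a k * (m k \<bullet> (cos (m k \<bullet> x) *\<^sub>R sin_coeff u k - sin (m k \<bullet> x) *\<^sub>R cos_coeff u k)))"
    unfolding divergence_def partial_mollify_modes
    by (simp add: inner_vec_def sum_distrib_left sum.swap[of _ "UNIV :: 3 set"] mult.assoc)
  then show ?thesis using assms by (simp add: transversal_def inner_diff_right)
qed

lemma continuous_mollify: "continuous_on UNIV (mollify u)"
  unfolding mollify_def by (intro continuous_intros)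

lemma periodic_mollify: "periodic (mollify u)"
  unfolding periodic_def mollify_def
  using cos_plus_mode[OF integer_modes, of _ _ _ 0] sin_plus_mode[OF integer_modes] by simp

lemma mollify_L2: "mollify u \<in> L2_torus"
  by (intro L2_torus_continuous continuous_mollify periodic_mollify)

lemma inner_mollify:
  assumes u: "integrable torus u"
  shows "L2_inner u (mollify w) = (\<Sum>k<N. a k * (cos_coeff u k \<bullet> cos_coeff w k + sin_coeff u k \<bullet> sin_coeff w k))"
proof -
  have "u x \<bullet> mollify w x = (\<Sum>k<N. a k * ((cos (m k \<bullet> x) *\<^sub>R u x) \<bullet> cos_coeff w k + (sin (m k \<bullet> x) *\<^sub>R u x) \<bullet> sin_coeff w k))" for x
    unfolding mollify_def by (simp add: inner_sum_right inner_add_right algebra_simps)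
  then show ?thesis
    unfolding L2_inner_def using integrable_mode[OF u]
    by (simp add: cos_coeff_def sin_coeff_def integral_inner_left integrable_inner_left del: inner_scaleR_left)
qed

text \<open>Expanding the square, the two diagonal terms give the energy because \<open>L\<close> has integral one, and
  the mixed term is the pairing of \<open>u\<close> with its mollification.\<close>

lemma energy_defect:
  assumes u: "u \<in> L2_torus" and one: "(\<integral>z. L z \<partial>torus) = 1"
  shows "integrable torus2 (\<lambda>(x, y). L (x - y) * (norm (u x - u y))\<^sup>2)"
    and "L2_inner u u - L2_inner u (mollify u) =
      1 / 2 * (\<integral>(x, y). L (x - y) * (norm (u x - u y))\<^sup>2 \<partial>torus2)"
proof -
  note ub [measurable] = L2_torusD(2)[OF u] and ui = L2_torusD(4)[OF u] and u2 = L2_torusD(3)[OF u]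
  have Lb [measurable]: "L \<in> borel_measurable borel" by (rule borel_measurable_continuous_onI[OF continuous_L])
  note E = even_kernel_integral[OF continuous_L periodic_L even_L u2]
  have Ea: "integrable torus2 (\<lambda>(x, y). \<bar>L (x - y)\<bar> * (norm (u x))\<^sup>2)"
    "integrable torus2 (\<lambda>(x, y). \<bar>L (x - y)\<bar> * (norm (u y))\<^sup>2)"
    by (rule even_kernel_integral[where M = "\<lambda>z. \<bar>L z\<bar>"], intro continuous_intros continuous_L,
        use periodic_L even_L u2 in \<open>auto simp: periodic_def\<close>)+
  have cross: "integrable torus2 (\<lambda>(x, y). L (x - y) * (u x \<bullet> u y))"
  proof (rule Bochner_Integration.integrable_bound[OF Bochner_Integration.integrable_add[OF Ea]])
    show "(\<lambda>(x, y). L (x - y) * (u x \<bullet> u y)) \<in> borel_measurable torus2"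
      unfolding split_beta by measurable
    have "\<bar>L (x - y) * (u x \<bullet> u y)\<bar> \<le> \<bar>L (x - y)\<bar> * (norm (u x))\<^sup>2 + \<bar>L (x - y)\<bar> * (norm (u y))\<^sup>2" for x y
    proof -
      have "\<bar>u x \<bullet> u y\<bar> \<le> (norm (u x))\<^sup>2 + (norm (u y))\<^sup>2"
        using Cauchy_Schwarz_ineq2[of "u x" "u y"] sum_squares_bound[of "norm (u x)" "norm (u y)"]
          mult_nonneg_nonneg[OF norm_ge_zero[of "u x"] norm_ge_zero[of "u y"]] by linarith
      then have "\<bar>L (x - y)\<bar> * \<bar>u x \<bullet> u y\<bar> \<le> \<bar>L (x - y)\<bar> * ((norm (u x))\<^sup>2 + (norm (u y))\<^sup>2)"
        by (rule mult_left_mono) simp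
      then show ?thesis by (simp add: abs_mult distrib_left)
    qed
    then show "AE z in torus2. norm (case z of (x, y) \<Rightarrow> L (x - y) * (u x \<bullet> u y)) \<le>
      norm ((case z of (x, y) \<Rightarrow> \<bar>L (x - y)\<bar> * (norm (u x))\<^sup>2) + (case z of (x, y) \<Rightarrow> \<bar>L (x - y)\<bar> * (norm (u y))\<^sup>2))"
      by (auto intro!: AE_I2)
  qed
  have cross_val: "(\<integral>(x, y). L (x - y) * (u x \<bullet> u y) \<partial>torus2) = L2_inner u (mollify u)"
  proof -
    have "integrable torus (\<lambda>y. L (x - y) *\<^sub>R u y)" for x
      by (intro integrable_continuous_scaleR ui continuous_on_compose2[OF continuous_L] continuous_intros) auto
    then have "(\<integral>y. L (x - y) * (u x \<bullet> u y) \<partial>torus) = u x \<bullet> mollify u x" for x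
      unfolding mollify_convolution[OF ui] by (simp flip: integral_inner_right)
    then show ?thesis
      unfolding L2_inner_def by (subst torus2.integral_fst[OF cross, symmetric]) simp
  qed
  have eq: "(\<lambda>(x, y). L (x - y) * (norm (u x - u y))\<^sup>2) =
     (\<lambda>z. (case z of (x, y) \<Rightarrow> L (x - y) * (norm (u x))\<^sup>2) + (case z of (x, y) \<Rightarrow> L (x - y) * (norm (u y))\<^sup>2)
        - 2 * (case z of (x, y) \<Rightarrow> L (x - y) * (u x \<bullet> u y)))"
    by (auto simp: fun_eq_iff power2_norm_eq_inner inner_diff_left inner_diff_right inner_commute algebra_simps)
  show "integrable torus2 (\<lambda>(x, y). L (x - y) * (norm (u x - u y))\<^sup>2)"
    unfolding eq using E(1,2) cross by (intro Bochner_Integration.integrable_diff Bochner_Integration.integrable_add integrable_mult_right)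
  show "L2_inner u u - L2_inner u (mollify u) =
      1 / 2 * (\<integral>(x, y). L (x - y) * (norm (u x - u y))\<^sup>2 \<partial>torus2)"
    unfolding eq using E cross cross_val one by (simp add: L2_inner_self)
qed

definition averaging :: bool where
  "averaging \<longleftrightarrow> (\<forall>z. 0 \<le> L z) \<and> (\<integral>z. L z \<partial>torus) = 1"

lemma mollified_energy_le:
  assumes avg: averaging and u: "u \<in> L2_torus"
  shows "L2_inner u (mollify u) \<le> L2_inner u u"
proof -
  have "0 \<le> (\<integral>(x, y). L (x - y) * (norm (u x - u y))\<^sup>2 \<partial>torus2)"
    by (rule Bochner_Integration.integral_nonneg) (use avg in \<open>auto simp: averaging_def\<close>)
  then show ?thesis using energy_defect(2)[OF u] avg unfolding averaging_def by linarith
qed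

end

text \<open>Comparable to the squared distance from the lattice \<open>2\<pi>\<int>\<^sup>3\<close>, but a trigonometric polynomial: the
  moments of the kernels with respect to it are explicit.\<close>

definition torus_dist2 :: "real ^ 3 \<Rightarrow> real" where
  "torus_dist2 z = (\<Sum>i\<in>UNIV. (1 - cos (z $ i)) / 2)"

lemma torus_dist2_nonneg: "0 \<le> torus_dist2 z"
  unfolding torus_dist2_def by (intro sum_nonneg) simp

lemma continuous_torus_dist2: "continuous_on UNIV torus_dist2"
  unfolding torus_dist2_def by (intro continuous_intros) auto

lemma periodic_torus_dist2: "periodic torus_dist2"
  unfolding periodic_def torus_dist2_def by (auto simp: axis_def intro!: sum.cong)

lemma even_torus_dist2: "torus_dist2 (- z) = torus_dist2 z"
  unfolding torus_dist2_def by simp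

text \<open>The right-hand side is \<open>36 sin\<^sup>2 (t / 2)\<close>, and \<open>sin s \<ge> s / 3\<close> on \<open>[0, \<pi> / 2]\<close>: up to \<open>\<pi> / 3\<close> by
  comparing derivatives, beyond it because \<open>sin s \<ge> sin (\<pi> / 3)\<close> there.\<close>

lemma square_le_one_minus_cos:
  fixes t :: real
  assumes "\<bar>t\<bar> \<le> pi"
  shows "t\<^sup>2 \<le> 36 * ((1 - cos t) / 2)"
proof -
  have pos: "s / 3 \<le> sin s" if s: "0 \<le> s" "s \<le> pi / 2" for s :: real
  proof (cases "s \<le> pi / 3")
    case True
    have "sin 0 - 0 / 3 \<le> sin s - s / 3"
    proof (rule DERIV_nonneg_imp_nondecreasing[OF s(1)])
      fix x assume x: "0 \<le> x" "x \<le> s"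
      have "cos x \<ge> cos (pi / 3)" using x True by (intro cos_monotone_0_pi_le) auto
      then show "\<exists>y. ((\<lambda>s. sin s - s / 3) has_real_derivative y) (at x) \<and> 0 \<le> y"
        by (intro exI[of _ "cos x - 1 / 3"]) (auto intro!: derivative_eq_intros simp: cos_60)
    qed
    then show ?thesis by simp
  next
    case False
    have "sin (pi / 3) \<le> sin s" using False s by (intro sin_monotone_2pi_le) auto
    moreover have "s / 3 \<le> 2 / 3" using s pi_less_4 by simp
    moreover have "4 / 3 \<le> sqrt 3" by (rule real_le_rsqrt) (simp add: power2_eq_square)
    ultimately show ?thesis by (simp add: sin_60)
  qed
  have "\<bar>t\<bar> / 6 \<le> sin (\<bar>t\<bar> / 2)" using pos[of "\<bar>t\<bar> / 2"] assms by simp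
  then have "(\<bar>t\<bar> / 6)\<^sup>2 \<le> (sin (\<bar>t\<bar> / 2))\<^sup>2" by (intro power_mono) auto
  also have "(sin (\<bar>t\<bar> / 2))\<^sup>2 = (1 - cos t) / 2"
    using cos_double_sin[of "\<bar>t\<bar> / 2"] by simp
  finally show ?thesis by (simp add: power_divide)
qed

text \<open>Round every coordinate to the nearest multiple of the period.\<close>

lemma lattice_reduction:
  obtains k :: "3 \<Rightarrow> int" and d where "z = d + (\<chi> i. 2 * pi * of_int (k i))"
    "\<And>i. \<bar>d $ i\<bar> \<le> pi" "(norm d)\<^sup>2 \<le> 36 * torus_dist2 z"
proof -
  define k where "k i = \<lfloor>z $ i / (2 * pi) + 1 / 2\<rfloor>" for i
  define d :: "real ^ 3" where "d = z - (\<chi> i. 2 * pi * of_int (k i))"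
  have d: "\<bar>d $ i\<bar> \<le> pi" for i
  proof -
    have "of_int (k i) \<le> z $ i / (2 * pi) + 1 / 2" "z $ i / (2 * pi) + 1 / 2 < of_int (k i) + 1"
      unfolding k_def by linarith+
    then have "2 * pi * of_int (k i) \<le> z $ i + pi" "z $ i + pi < 2 * pi * (of_int (k i) + 1)"
      by (simp_all add: field_simps)
    then show ?thesis unfolding d_def by (simp add: algebra_simps abs_le_iff)
  qed
  have "cos (d $ i) = cos (z $ i)" for i
    using cos.minus_of_int[of "z $ i" "k i"] by (simp add: d_def mult.commute mult.left_commute)
  then have "(d $ i)\<^sup>2 \<le> 36 * ((1 - cos (z $ i)) / 2)" for i
    using square_le_one_minus_cos[OF d[of i]] by simp
  then have "(\<Sum>i\<in>UNIV. (d $ i)\<^sup>2) \<le> (\<Sum>i\<in>UNIV. 36 * ((1 - cos (z $ i)) / 2))"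
    by (intro sum_mono)
  then have "(norm d)\<^sup>2 \<le> 36 * torus_dist2 z"
    unfolding torus_dist2_def sum_distrib_left[symmetric]
    by (simp add: norm_vec_def L2_set_def sum_nonneg)
  then show thesis using that[of d k] d by (simp add: d_def)
qed

text \<open>After a lattice translation of \<open>y\<close>, the two points lie in a fixed compact box, on which the
  derivative is bounded.\<close>

lemma periodic_Lipschitz_torus:
  fixes \<psi> :: "real ^ 3 \<Rightarrow> real ^ 3"
  assumes per: "periodic \<psi>" and smooth: "smooth_on UNIV \<psi>"
  obtains K where "K \<ge> 0" "\<And>x y. x \<in> space torus \<Longrightarrow> (norm (\<psi> x - \<psi> y))\<^sup>2 \<le> K * torus_dist2 (x - y)"
proof -
  let ?S = "cbox (\<chi> i. - pi) (\<chi> i. 3 * pi) :: (real ^ 3) set"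
  have C1: "C_k_on (Suc 0) UNIV \<psi>" using smooth unfolding smooth_on_def by blast
  then have der: "(\<psi> has_derivative frechet_derivative \<psi> (at x)) (at x)" for x
    by (simp add: differentiable_on_def frechet_derivative_works)
  have "\<exists>B. \<forall>x\<in>?S. norm (frechet_derivative \<psi> (at x) b) \<le> B" if "b \<in> Basis" for b
    using C1 that continuous_bounded_on_cbox[of "\<lambda>x. frechet_derivative \<psi> (at x) b"]
    by (metis C_k_on.simps)
  then obtain B where B: "\<And>b x. b \<in> Basis \<Longrightarrow> x \<in> ?S \<Longrightarrow> norm (frechet_derivative \<psi> (at x) b) \<le> B b"
    by metis
  define M where "M = (\<Sum>b\<in>(Basis :: (real ^ 3) set). \<bar>B b\<bar>)"
  have M0: "M \<ge> 0" unfolding M_def by (simp add: sum_nonneg)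
  have on: "onorm (frechet_derivative \<psi> (at x)) \<le> M" if x: "x \<in> ?S" for x
  proof (rule onorm_bound[OF M0])
    fix h :: "real ^ 3"
    interpret bounded_linear "frechet_derivative \<psi> (at x)" by (rule has_derivative_bounded_linear[OF der])
    have "frechet_derivative \<psi> (at x) h = frechet_derivative \<psi> (at x) (\<Sum>b\<in>Basis. (h \<bullet> b) *\<^sub>R b)"
      by (simp add: euclidean_representation)
    also have "\<dots> = (\<Sum>b\<in>Basis. (h \<bullet> b) *\<^sub>R frechet_derivative \<psi> (at x) b)"
      by (simp add: sum scaleR)
    also have "norm \<dots> \<le> (\<Sum>b\<in>Basis. norm h * \<bar>B b\<bar>)"
    proof (rule sum_norm_le)
      fix b :: "real ^ 3" assume b: "b \<in> Basis"
      show "norm ((h \<bullet> b) *\<^sub>R frechet_derivative \<psi> (at x) b) \<le> norm h * \<bar>B b\<bar>"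
        using Basis_le_norm[OF b, of h] B[OF b x] by (auto intro!: mult_mono)
    qed
    finally show "norm (frechet_derivative \<psi> (at x) h) \<le> M * norm h"
      unfolding M_def by (simp add: sum_distrib_left mult.commute)
  qed
  have lip: "norm (\<psi> x - \<psi> y) \<le> M * norm (x - y)" if "x \<in> ?S" "y \<in> ?S" for x y
    by (rule differentiable_bound[of ?S \<psi> "\<lambda>x. frechet_derivative \<psi> (at x)" M])
       (use on that der in \<open>auto intro: has_derivative_at_withinI\<close>)
  show thesis
  proof (rule that[of "36 * M\<^sup>2"])
    fix x y assume "x \<in> space torus"
    obtain k d where kd: "x - y = d + (\<chi> i. 2 * pi * of_int (k i))"
      "\<And>i. \<bar>d $ i\<bar> \<le> pi" "(norm d)\<^sup>2 \<le> 36 * torus_dist2 (x - y)"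
      using lattice_reduction[of "x - y"] by metis
    have "\<psi> y = \<psi> (y + (\<chi> i. 2 * pi * of_int (k i)))" using periodic_lattice[OF per] by metis
    also have "y + (\<chi> i. 2 * pi * of_int (k i)) = x - d" using kd(1) by (simp add: algebra_simps)
    finally have "\<psi> y = \<psi> (x - d)" .
    moreover have "x \<in> ?S" "x - d \<in> ?S"
    proof -
      have "0 \<le> x $ i" "x $ i \<le> 2 * pi" for i using \<open>x \<in> space torus\<close> by (auto simp: mem_box_cart)
      moreover have "- pi \<le> d $ i" "d $ i \<le> pi" for i using kd(2)[of i] by auto
      ultimately show "x \<in> ?S" "x - d \<in> ?S"
        by (auto simp: mem_box_cart) (smt (verit, best) pi_gt_zero)+
    qed
    ultimately have "norm (\<psi> x - \<psi> y) \<le> M * norm d" using lip[of x "x - d"] by simp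
    then have "(norm (\<psi> x - \<psi> y))\<^sup>2 \<le> (M * norm d)\<^sup>2" by (intro power_mono) auto
    also have "\<dots> \<le> 36 * M\<^sup>2 * torus_dist2 (x - y)"
      using mult_left_mono[OF kd(3), of "M\<^sup>2"] by (simp add: power_mult_distrib)
    finally show "(norm (\<psi> x - \<psi> y))\<^sup>2 \<le> 36 * M\<^sup>2 * torus_dist2 (x - y)" .
  qed simp
qed

text \<open>Split \<open>u\<close> into a smooth field and a remainder of small norm.  The remainder costs at most \<open>\<epsilon>\<close>
  whatever the kernel; the smooth part is Lipschitz and costs a second moment of the kernel.  The
  constant \<open>K\<close> precedes the kernel, which may therefore be chosen in dependence on \<open>K\<close>.\<close>

lemma energy_defect_bound:
  assumes u: "u \<in> H_space" and e: "\<epsilon> > 0"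
  obtains K where "K \<ge> 0" "\<And>N a m. cosine_kernel m \<Longrightarrow> cosine_kernel.averaging N a m \<Longrightarrow>
     L2_inner u u - L2_inner u (cosine_kernel.mollify N a m u)
       \<le> \<epsilon> + K * (\<integral>z. cosine_kernel.L N a m z * torus_dist2 z \<partial>torus)"
proof -
  have uL: "u \<in> L2_torus" using u by (simp add: H_space_def)
  obtain \<psi> where psi: "\<psi> \<in> solenoidal_fields" "L2_norm (\<lambda>x. u x - \<psi> x) < sqrt (\<epsilon> / 4)"
    using u e unfolding H_space_def by (auto dest!: spec[of _ "sqrt (\<epsilon> / 4)"])
  have per: "periodic \<psi>" and sm: "smooth_on UNIV \<psi>" using psi(1) by (auto simp: solenoidal_fields_def)
  have "continuous_on UNIV \<psi>"
    using sm unfolding smooth_on_def by (metis C_k_on.simps(1))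
  then have psiL: "\<psi> \<in> L2_torus" using per by (rule L2_torus_continuous)
  define e where "e x = u x - \<psi> x" for x
  have eL: "e \<in> L2_torus" unfolding e_def using L2_torus_diff[OF uL psiL] by simp
  have e2: "L2_inner e e \<le> \<epsilon> / 4"
    using L2_inner_le_square[of e "sqrt (\<epsilon> / 4)"] psi(2) \<open>\<epsilon> > 0\<close> by (simp add: e_def[abs_def])
  obtain K where K: "K \<ge> 0" "\<And>x y. x \<in> space torus \<Longrightarrow> (norm (\<psi> x - \<psi> y))\<^sup>2 \<le> K * torus_dist2 (x - y)"
    using periodic_Lipschitz_torus[OF per sm] by metis
  show thesis
  proof (rule that[of "K * measure torus (space torus)"])
    fix N a and m :: "nat \<Rightarrow> real ^ 3"
    assume "cosine_kernel m"
    then interpret cosine_kernel N a m .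
    assume averaging
    then have pos: "\<And>z. L z \<ge> 0" and one: "(\<integral>z. L z \<partial>torus) = 1"
      by (auto simp: averaging_def)
      define M where "M z = L z * torus_dist2 z" for z
    have M: "continuous_on UNIV M" "periodic M" "\<And>z. M (- z) = M z"
      using periodic_L periodic_torus_dist2 unfolding M_def
      by (auto intro!: continuous_intros continuous_L continuous_torus_dist2 simp: periodic_def even_L even_torus_dist2)
    note E1 = even_kernel_integral[OF M, of "\<lambda>_. K"]
    note E2 = even_kernel_integral[OF continuous_L periodic_L even_L L2_torusD(3)[OF eL]]
    have "L2_inner u u - L2_inner u (mollify u) =
      1 / 2 * (\<integral>(x, y). L (x - y) * (norm (u x - u y))\<^sup>2 \<partial>torus2)"
      by (rule energy_defect(2)[OF uL one])
    also have "\<dots> \<le> 1 / 2 * (\<integral>z. 2 * (case z of (x, y) \<Rightarrow> M (x - y) * K) +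
       (4 * (case z of (x, y) \<Rightarrow> L (x - y) * (norm (e x))\<^sup>2) + 4 * (case z of (x, y) \<Rightarrow> L (x - y) * (norm (e y))\<^sup>2)) \<partial>torus2)"
    proof (rule mult_left_mono[OF integral_mono])
      show "integrable torus2 (\<lambda>(x, y). L (x - y) * (norm (u x - u y))\<^sup>2)" by (rule energy_defect(1)[OF uL one])
      show "integrable torus2 (\<lambda>z. 2 * (case z of (x, y) \<Rightarrow> M (x - y) * K) +
         (4 * (case z of (x, y) \<Rightarrow> L (x - y) * (norm (e x))\<^sup>2) + 4 * (case z of (x, y) \<Rightarrow> L (x - y) * (norm (e y))\<^sup>2)))"
        using E1 E2 by (intro Bochner_Integration.integrable_add integrable_mult_right) auto
      fix z assume "z \<in> space torus2"
      then obtain x y where z: "z = (x, y)" "x \<in> space torus" by (auto simp: space_pair_measure)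
      have par: "(norm (p + q))\<^sup>2 \<le> 2 * (norm p)\<^sup>2 + 2 * (norm q)\<^sup>2" for p q :: "real ^ 3"
      proof -
        have "(norm (p + q))\<^sup>2 \<le> (norm p + norm q)\<^sup>2" by (intro power_mono norm_triangle_ineq) auto
        also have "\<dots> \<le> 2 * (norm p)\<^sup>2 + 2 * (norm q)\<^sup>2"
          using sum_squares_bound[of "norm p" "norm q"] by (simp add: power2_sum)
        finally show ?thesis .
      qed
      have "(norm (u x - u y))\<^sup>2 \<le> 2 * (norm (\<psi> x - \<psi> y))\<^sup>2 + 2 * (norm (e x - e y))\<^sup>2"
        using par[of "\<psi> x - \<psi> y" "e x - e y"] by (simp add: e_def algebra_simps)
      also have "(norm (e x - e y))\<^sup>2 \<le> 2 * (norm (e x))\<^sup>2 + 2 * (norm (e y))\<^sup>2"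
        using par[of "e x" "- e y"] by simp
      also have "(norm (\<psi> x - \<psi> y))\<^sup>2 \<le> K * torus_dist2 (x - y)" by (rule K(2)[OF z(2)])
      finally have "(norm (u x - u y))\<^sup>2 \<le> 2 * (K * torus_dist2 (x - y)) + 2 * (2 * (norm (e x))\<^sup>2 + 2 * (norm (e y))\<^sup>2)"
        by simp
      then have "L (x - y) * (norm (u x - u y))\<^sup>2 \<le> L (x - y) * (2 * (K * torus_dist2 (x - y)) + 2 * (2 * (norm (e x))\<^sup>2 + 2 * (norm (e y))\<^sup>2))"
        by (intro mult_left_mono pos)
      then show "(case z of (x, y) \<Rightarrow> L (x - y) * (norm (u x - u y))\<^sup>2) \<le> 2 * (case z of (x, y) \<Rightarrow> M (x - y) * K) +
         (4 * (case z of (x, y) \<Rightarrow> L (x - y) * (norm (e x))\<^sup>2) + 4 * (case z of (x, y) \<Rightarrow> L (x - y) * (norm (e y))\<^sup>2))"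
        unfolding z M_def by (simp add: algebra_simps)
    qed simp
    also have "\<dots> = K * measure torus (space torus) * (\<integral>z. M z \<partial>torus) + 4 * L2_inner e e"
      using E1 E2 one by (simp add: L2_inner_self)
    also have "4 * L2_inner e e \<le> \<epsilon>" using e2 by simp
    finally show "L2_inner u u - L2_inner u (mollify u)
       \<le> \<epsilon> + K * measure torus (space torus) * (\<integral>z. L z * torus_dist2 z \<partial>torus)"
      unfolding M_def by simp
  qed (use K in simp)
qed

section \<open>The energy flux through the mollification\<close>

lemma integrable_torus2_continuous:
  fixes G :: "real ^ 3 \<Rightarrow> real ^ 3 \<Rightarrow> real"
  assumes G: "continuous_on UNIV (\<lambda>z. G (fst z) (snd z))"
  shows "integrable torus2 (\<lambda>(x, y). G x y)"
proof -
  let ?Q = "cbox 0 (\<chi> i. 2 * pi) :: (real ^ 3) set"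
  have meas: "(\<lambda>(x, y). G x y) \<in> borel_measurable torus2"
  proof -
    have "(\<lambda>z. (fst z, snd z)) \<in> torus2 \<rightarrow>\<^sub>M borel"
      by measurable
    from measurable_compose[OF this borel_measurable_continuous_onI[OF G]] show ?thesis
      by (simp add: split_beta)
  qed
  have "bounded ((\<lambda>z. G (fst z) (snd z)) ` (?Q \<times> ?Q))"
    by (intro compact_imp_bounded compact_continuous_image continuous_on_subset[OF G] compact_Times) auto
  then obtain B where B: "\<And>x y. x \<in> ?Q \<Longrightarrow> y \<in> ?Q \<Longrightarrow> \<bar>G x y\<bar> \<le> B"
    unfolding bounded_iff by force
  have one: "integrable torus2 (\<lambda>(x, y). 1 * B)"
    using even_kernel_integral(1)[of "\<lambda>_. 1" "\<lambda>_. B"] by (simp add: periodic_def)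
  show ?thesis
    by (rule Bochner_Integration.integrable_bound[OF one meas])
       (use B in \<open>auto simp: space_pair_measure intro!: AE_I2 order.trans[OF B abs_ge_self]\<close>)
qed

text \<open>By periodicity the distance to the nearest lattice translate may be used.\<close>

lemma Holder_torus_dist:
  assumes per: "periodic u" and f: "f \<ge> 0" and \<alpha>: "\<alpha> > 0"
    and hol: "\<And>x y. norm (u x - u y) \<le> f * norm (x - y) powr \<alpha>"
  shows "norm (u x - u y) \<le> f * (36 * torus_dist2 (x - y)) powr (\<alpha> / 2)"
proof -
  obtain k d where kd: "x - y = d + (\<chi> i. 2 * pi * of_int (k i))"
    "(norm d)\<^sup>2 \<le> 36 * torus_dist2 (x - y)"
    using lattice_reduction[of "x - y"] by metis
  have "u y = u (y + (\<chi> i. 2 * pi * of_int (k i)))" using periodic_lattice[OF per] by metis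
  also have "y + (\<chi> i. 2 * pi * of_int (k i)) = x - d" using kd(1) by (simp add: algebra_simps)
  finally have "norm (u x - u y) \<le> f * norm d powr \<alpha>" using hol[of x "x - d"] by simp
  also have "norm d powr \<alpha> = ((norm d)\<^sup>2) powr (\<alpha> / 2)"
    by (cases "d = 0") (simp_all add: powr_powr flip: powr_numeral)
  also have "\<dots> \<le> (36 * torus_dist2 (x - y)) powr (\<alpha> / 2)"
    using kd(2) \<alpha> by (intro powr_mono2) auto
  finally show ?thesis using f by (simp add: mult_left_mono)
qed

lemma Holder_imp_continuous:
  fixes u :: "real ^ 3 \<Rightarrow> real ^ 3"
  assumes \<alpha>: "\<alpha> > 0" and hol: "\<And>x y. norm (u x - u y) \<le> f * norm (x - y) powr \<alpha>"
  shows "continuous_on UNIV u"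
proof -
  have "(u \<longlongrightarrow> u x) (at x)" for x
  proof -
    have lim: "((\<lambda>y. f * norm (y - x) powr \<alpha>) \<longlongrightarrow> f * 0) (at x)"
      using \<alpha> by (intro tendsto_mult tendsto_const tendsto_zero_powrI[OF _ tendsto_const])
         (auto intro!: tendsto_norm_zero LIM_zero)
    have "((\<lambda>y. norm (u y - u x)) \<longlongrightarrow> 0) (at x)"
    proof (rule tendsto_sandwich[OF _ _ tendsto_const])
      show "((\<lambda>y. f * norm (y - x) powr \<alpha>) \<longlongrightarrow> 0) (at x)" using lim by simp
    qed (simp_all add: hol)
    then show ?thesis by (rule LIM_zero_cancel[OF tendsto_norm_zero_cancel])
  qed
  then show ?thesis by (auto simp: continuous_on_def)
qed

context cosine_kernel
begin

lemma integral_grad_zero: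
  "(\<integral>y. grad (y - x) \<bullet> e \<partial>torus) = 0" "(\<integral>y. grad (x - y) \<bullet> e \<partial>torus) = 0"
proof -
  have c: "continuous_on UNIV (\<lambda>y. grad (y - x))"
    by (intro continuous_on_compose2[OF continuous_grad] continuous_intros) auto
  have z: "(\<integral>y. grad (y - x) $ i \<partial>torus) = 0" for i
  proof (rule torus_integral_partial_derivative)
    show "continuous_on UNIV (\<lambda>y. L (y - x))"
      by (intro continuous_on_compose2[OF continuous_L] continuous_intros) auto
    show "periodic (\<lambda>y. L (y - x))"
      using periodic_L unfolding periodic_def by (metis add_diff_eq diff_add_eq)
    show "continuous_on UNIV (\<lambda>y. grad (y - x) $ i)"
      by (intro continuous_intros c)
    fix y
    have "(y - x) + axis i h = y + axis i h - x" for h by simp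
    then show "((\<lambda>h. L (y + axis i h - x)) has_real_derivative grad (y - x) $ i) (at 0)"
      using L_has_axis_derivative[of "y - x" i] by (simp only:)
  qed
  have "integrable torus (\<lambda>y. grad (y - x) $ i)" for i
    by (intro continuous_integrable_torus continuous_intros c)
  then show *: "(\<integral>y. grad (y - x) \<bullet> e \<partial>torus) = 0" using z by (simp add: inner_vec_def)
  have "grad (x - y) \<bullet> e = - (grad (y - x) \<bullet> e)" for y
    using odd_grad[of "y - x"] by simp
  then show "(\<integral>y. grad (x - y) \<bullet> e \<partial>torus) = 0" using * by simp
qed

lemma integral_grad_transversal:
  assumes u: "integrable torus u" and t: "transversal u"
  shows "(\<integral>x. grad (x - y) \<bullet> u x \<partial>torus) = 0" "(\<integral>x. grad (y - x) \<bullet> u x \<partial>torus) = 0"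
proof -
  have "grad (x - y) \<bullet> u x = (\<Sum>k<N. a k * sin (m k \<bullet> y) * ((cos (m k \<bullet> x) *\<^sub>R u x) \<bullet> m k)
      - a k * cos (m k \<bullet> y) * ((sin (m k \<bullet> x) *\<^sub>R u x) \<bullet> m k))" for x
    unfolding grad_def
    by (simp add: inner_diff_right sin_diff inner_sum_left sum_negf[symmetric] inner_commute)
       (simp add: algebra_simps inner_sum_right inner_diff_right inner_sum_left inner_diff_left inner_commute[of "u x"])
  then show *: "(\<integral>x. grad (x - y) \<bullet> u x \<partial>torus) = 0"
    using t integrable_mode[OF u] unfolding transversal_def cos_coeff_def sin_coeff_def
    by (simp add: integrable_inner_left integral_inner_left inner_commute[of _ "m _"] del: inner_scaleR_left inner_scaleR_right)
  have "grad (y - x) \<bullet> u x = - (grad (x - y) \<bullet> u x)" for x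
    using odd_grad[of "x - y"] by simp
  then show "(\<integral>x. grad (y - x) \<bullet> u x \<partial>torus) = 0" using * by simp
qed

lemma convective_form_mollify:
  assumes u: "integrable torus u"
  shows "convective_form u (mollify u) = (\<integral>x. (\<integral>y. (grad (x - y) \<bullet> u x) * (u x \<bullet> u y) \<partial>torus) \<partial>torus)"
proof -
  have c: "continuous_on UNIV (\<lambda>y. grad (x - y) $ j)" for x j
    by (intro continuous_intros continuous_on_compose2[OF continuous_grad]) auto
  have int: "integrable torus (\<lambda>y. grad (x - y) $ j *\<^sub>R u y)" for x j
    by (intro integrable_continuous_scaleR c u)
  have comp: "partial j (mollify u) x $ i = (\<integral>y. grad (x - y) $ j * u y $ i \<partial>torus)"
    and intc: "integrable torus (\<lambda>y. grad (x - y) $ j * u y $ i)" for i j x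
  proof -
    have "partial j (mollify u) x $ i = (\<integral>y. grad (x - y) $ j *\<^sub>R u y \<partial>torus) \<bullet> axis i 1"
      unfolding partial_mollify[OF u] by (simp add: inner_axis)
    also have "\<dots> = (\<integral>y. (grad (x - y) $ j *\<^sub>R u y) \<bullet> axis i 1 \<partial>torus)"
      using int by (subst integral_inner_left) auto
    finally show "partial j (mollify u) x $ i = (\<integral>y. grad (x - y) $ j * u y $ i \<partial>torus)"
      by (simp add: inner_axis)
    have "integrable torus (\<lambda>y. (grad (x - y) $ j *\<^sub>R u y) \<bullet> axis i 1)"
      using int by (intro integrable_inner_left)
    then show "integrable torus (\<lambda>y. grad (x - y) $ j * u y $ i)" by (simp add: inner_axis)
  qed
  have "(\<Sum>i\<in>UNIV. \<Sum>j\<in>UNIV. u x $ i * u x $ j * partial j (mollify u) x $ i)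
     = (\<integral>y. (grad (x - y) \<bullet> u x) * (u x \<bullet> u y) \<partial>torus)" for x
  proof -
    have "(\<integral>y. (grad (x - y) \<bullet> u x) * (u x \<bullet> u y) \<partial>torus)
      = (\<integral>y. (\<Sum>i\<in>UNIV. \<Sum>j\<in>UNIV. u x $ i * u x $ j * (grad (x - y) $ j * u y $ i)) \<partial>torus)"
      by (intro Bochner_Integration.integral_cong refl)
         (simp add: inner_vec_def sum_3 algebra_simps)
    then show ?thesis using intc by (simp add: comp)
  qed
  then show ?thesis unfolding convective_form_def by simp
qed

text \<open>The product \<open>(\<nabla>L \<cdot> \<delta>u) |\<delta>u|\<^sup>2\<close> has six terms.  The four that contain \<open>|u(x)|\<^sup>2\<close> or \<open>|u(y)|\<^sup>2\<close>
  vanish: two because \<open>\<nabla>L\<close> has mean zero, two because \<open>u\<close> is incompressible.  The other two agree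
  because \<open>\<nabla>L\<close> is odd, and together they are \<open>-4\<close> times the flux.\<close>

lemma Duchon_Robert_identity:
  assumes u: "continuous_on UNIV u" and t: "transversal u"
  shows "integrable torus2 (\<lambda>(x, y). (grad (x - y) \<bullet> (u x - u y)) * (norm (u x - u y))\<^sup>2)"
    and "convective_form u (mollify u) =
      - 1 / 4 * (\<integral>(x, y). (grad (x - y) \<bullet> (u x - u y)) * (norm (u x - u y))\<^sup>2 \<partial>torus2)"
proof -
  note ui = continuous_integrable_torus[OF u]
  have cg: "continuous_on UNIV (\<lambda>z. grad (fst z - snd z))"
    by (intro continuous_on_compose2[OF continuous_grad] continuous_intros) auto
  have c1: "continuous_on UNIV (\<lambda>z. u (fst z))" and c2: "continuous_on UNIV (\<lambda>z. u (snd z))"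
    by (intro continuous_on_compose2[OF u] continuous_intros; auto)+
  note ci = cg c1 c2
  \<comment> \<open>\<open>T1\<close> and \<open>T5\<close> vanish by the mean value of \<open>grad\<close>, \<open>T2\<close> and \<open>T4\<close> by incompressibility; \<open>T3\<close> is the flux,
    and \<open>T6\<close> is its negative.\<close>
  define T1 where "T1 x y = (grad (x - y) \<bullet> u x) * (norm (u x))\<^sup>2" for x y
  define T2 where "T2 x y = (grad (x - y) \<bullet> u x) * (norm (u y))\<^sup>2" for x y
  define T3 where "T3 x y = (grad (x - y) \<bullet> u x) * (u x \<bullet> u y)" for x y
  define T4 where "T4 x y = (grad (x - y) \<bullet> u y) * (norm (u x))\<^sup>2" for x y
  define T5 where "T5 x y = (grad (x - y) \<bullet> u y) * (norm (u y))\<^sup>2" for x y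
  define T6 where "T6 x y = (grad (x - y) \<bullet> u y) * (u x \<bullet> u y)" for x y
  have i1: "integrable torus2 (\<lambda>(x, y). T1 x y)" and i2: "integrable torus2 (\<lambda>(x, y). T2 x y)"
    and i3: "integrable torus2 (\<lambda>(x, y). T3 x y)" and i4: "integrable torus2 (\<lambda>(x, y). T4 x y)"
    and i5: "integrable torus2 (\<lambda>(x, y). T5 x y)" and i6: "integrable torus2 (\<lambda>(x, y). T6 x y)"
    unfolding T1_def T2_def T3_def T4_def T5_def T6_def
    by (intro integrable_torus2_continuous continuous_intros ci)+
  have v1: "(\<integral>(x, y). T1 x y \<partial>torus2) = 0"
    by (subst torus2.integral_fst[OF i1, symmetric]) (simp add: T1_def[abs_def] integral_grad_zero)
  have v5: "(\<integral>(x, y). T5 x y \<partial>torus2) = 0"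
    by (subst torus2.integral_snd[OF i5, symmetric]) (simp add: T5_def[abs_def] integral_grad_zero)
  have v2: "(\<integral>(x, y). T2 x y \<partial>torus2) = 0"
    by (subst torus2.integral_snd[OF i2, symmetric]) (simp add: T2_def[abs_def] integral_grad_transversal[OF ui t])
  have v4: "(\<integral>(x, y). T4 x y \<partial>torus2) = 0"
    by (subst torus2.integral_fst[OF i4, symmetric]) (simp add: T4_def[abs_def] integral_grad_transversal[OF ui t])
  have v3: "(\<integral>(x, y). T3 x y \<partial>torus2) = convective_form u (mollify u)"
    by (subst torus2.integral_fst[OF i3, symmetric]) (simp add: T3_def[abs_def] convective_form_mollify[OF ui])
  have v6: "(\<integral>(x, y). T6 x y \<partial>torus2) = - convective_form u (mollify u)"
  proof -
    have "(\<lambda>(x, y). case (y, x) of (x, y) \<Rightarrow> T3 x y) = (\<lambda>z. - (case z of (x, y) \<Rightarrow> T6 x y))"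
    proof -
      have "T3 y x = - T6 x y" for x y
        using odd_grad[of "x - y"] by (simp add: T3_def T6_def inner_commute)
      then show ?thesis by (simp add: fun_eq_iff)
    qed
    then have "- (\<integral>(x, y). T6 x y \<partial>torus2) = (\<integral>(x, y). T3 x y \<partial>torus2)"
      using torus2.integral_product_swap[OF borel_measurable_integrable[OF i3]] by simp
    then show ?thesis using v3 by simp
  qed
  have eq: "(\<lambda>(x, y). (grad (x - y) \<bullet> (u x - u y)) * (norm (u x - u y))\<^sup>2) =
    (\<lambda>z. (case z of (x, y) \<Rightarrow> T1 x y) + (case z of (x, y) \<Rightarrow> T2 x y) - 2 * (case z of (x, y) \<Rightarrow> T3 x y)
       - (case z of (x, y) \<Rightarrow> T4 x y) - (case z of (x, y) \<Rightarrow> T5 x y) + 2 * (case z of (x, y) \<Rightarrow> T6 x y))"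
    unfolding T1_def T2_def T3_def T4_def T5_def T6_def
    by (auto simp: fun_eq_iff power2_norm_eq_inner inner_diff_left inner_diff_right inner_commute algebra_simps)
  show "integrable torus2 (\<lambda>(x, y). (grad (x - y) \<bullet> (u x - u y)) * (norm (u x - u y))\<^sup>2)"
    unfolding eq using i1 i2 i3 i4 i5 i6 by simp
  show "convective_form u (mollify u) =
      - 1 / 4 * (\<integral>(x, y). (grad (x - y) \<bullet> (u x - u y)) * (norm (u x - u y))\<^sup>2 \<partial>torus2)"
    unfolding eq using i1 i2 i3 i4 i5 i6 v1 v2 v3 v4 v5 v6 by simp
qed

text \<open>Only the power \<open>b\<close> of the Hoelder constant is spent.  The rest of the cubic term satisfies
  \<open>|\<delta>u|\<^bsup>3 - b\<^esup> \<le> 1 + |\<delta>u|\<^sup>2\<close>, because \<open>0 \<le> 3 - b \<le> 2\<close>, and is absorbed by the energy.  The majorant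
  \<open>M\<close> makes the kernel factor continuous, even and easy to integrate.\<close>

lemma flux_bound:
  assumes u: "continuous_on UNIV u" "periodic u" and t: "transversal u"
    and f: "f \<ge> 0" and \<alpha>: "\<alpha> > 0" and b: "1 \<le> b" "b \<le> 3"
    and hol: "\<And>x y. norm (u x - u y) \<le> f * norm (x - y) powr \<alpha>"
    and M: "continuous_on UNIV M" "periodic M" "\<And>z. M (- z) = M z"
    and dom: "\<And>z. norm (grad z) * torus_dist2 z powr (\<alpha> * b / 2) \<le> M z"
  shows "\<bar>convective_form u (mollify u)\<bar> \<le>
    f powr b * 36 powr (\<alpha> * b / 2) * (\<integral>z. M z \<partial>torus) * (measure torus (space torus) + L2_inner u u)"
proof -
  define C where "C = f powr b * 36 powr (\<alpha> * b / 2)"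
  have C: "C \<ge> 0" unfolding C_def by simp
  have uL: "u \<in> L2_torus" by (rule L2_torus_continuous[OF u])
  note E1 = even_kernel_integral[OF M, of "\<lambda>_. 1"]
  note E2 = even_kernel_integral[OF M L2_torusD(3)[OF uL]]
  have M0: "M z \<ge> 0" for z
    by (rule order.trans[OF _ dom]) simp
  define D where "D x y = (grad (x - y) \<bullet> (u x - u y)) * (norm (u x - u y))\<^sup>2" for x y
  define R where "R x y = C * (M (x - y) * 1 + 2 * (M (x - y) * (norm (u x))\<^sup>2) + 2 * (M (x - y) * (norm (u y))\<^sup>2))" for x y
  have pt: "\<bar>D x y\<bar> \<le> R x y" for x y
  proof -
    define s where "s = norm (u x - u y)"
    have s0: "s \<ge> 0" by (simp add: s_def)
    have s1: "s powr b \<le> C * torus_dist2 (x - y) powr (\<alpha> * b / 2)"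
    proof -
      have "s \<le> f * (36 * torus_dist2 (x - y)) powr (\<alpha> / 2)"
        unfolding s_def by (rule Holder_torus_dist[OF u(2) f \<alpha> hol])
      then have "s powr b \<le> (f * (36 * torus_dist2 (x - y)) powr (\<alpha> / 2)) powr b"
        using b s0 by (intro powr_mono2) auto
      then show ?thesis using f torus_dist2_nonneg
        by (simp add: powr_mult powr_powr C_def mult.assoc)
    qed
    have s3: "s ^ 3 \<le> s powr b * (1 + s\<^sup>2)"
    proof (cases "s = 0")
      case False
      then have sp: "s > 0" using s0 by simp
      have "s ^ 3 = s powr (b + (3 - b))" using sp by (simp add: powr_numeral)
      also have "\<dots> = s powr b * s powr (3 - b)" by (rule powr_add)
      also have "s powr (3 - b) \<le> 1 + s\<^sup>2"
      proof (cases "s \<le> 1")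
        case True
        then have "s powr (3 - b) \<le> 1" using sp b by (intro powr_le1) auto
        then show ?thesis by (simp add: add_increasing2)
      next
        case False
        then have "s powr (3 - b) \<le> s powr 2" using b by (intro powr_mono) auto
        then show ?thesis using sp by (simp add: powr_numeral)
      qed
      finally show ?thesis by (simp add: mult_left_mono)
    qed simp
    have s2: "1 + s\<^sup>2 \<le> 1 + 2 * (norm (u x))\<^sup>2 + 2 * (norm (u y))\<^sup>2"
    proof -
      have "s\<^sup>2 \<le> (norm (u x) + norm (u y))\<^sup>2"
        unfolding s_def by (intro power_mono norm_triangle_ineq4) auto
      then show ?thesis using sum_squares_bound[of "norm (u x)" "norm (u y)"] by (simp add: power2_sum)
    qed
    have "\<bar>D x y\<bar> \<le> norm (grad (x - y)) * s ^ 3"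
    proof -
      have "\<bar>D x y\<bar> \<le> (norm (grad (x - y)) * s) * s\<^sup>2"
        unfolding D_def s_def abs_mult by (intro mult_mono Cauchy_Schwarz_ineq2) auto
      then show ?thesis by (simp add: power2_eq_square power3_eq_cube mult.assoc)
    qed
    also have "\<dots> \<le> norm (grad (x - y)) * (s powr b * (1 + s\<^sup>2))"
      using s3 by (rule mult_left_mono) simp
    also have "\<dots> \<le> norm (grad (x - y)) * ((C * torus_dist2 (x - y) powr (\<alpha> * b / 2)) * (1 + s\<^sup>2))"
      using s1 by (intro mult_left_mono mult_right_mono) auto
    also have "\<dots> = C * (norm (grad (x - y)) * torus_dist2 (x - y) powr (\<alpha> * b / 2)) * (1 + s\<^sup>2)"
      by simp
    also have "\<dots> \<le> C * M (x - y) * (1 + 2 * (norm (u x))\<^sup>2 + 2 * (norm (u y))\<^sup>2)"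
      using s2 dom[of "x - y"] C M0 by (intro mult_mono mult_left_mono) (auto intro: add_nonneg_nonneg)
    also have "\<dots> = R x y" unfolding R_def by (simp add: algebra_simps)
    finally show ?thesis .
  qed
  have Ri: "integrable torus2 (\<lambda>(x, y). R x y)"
    and Rv: "(\<integral>(x, y). R x y \<partial>torus2) = C * (\<integral>z. M z \<partial>torus) * (measure torus (space torus) + 4 * L2_inner u u)"
  proof -
    have eq: "(\<lambda>(x, y). R x y) = (\<lambda>z. C * ((case z of (x, y) \<Rightarrow> M (x - y) * 1) + 2 * (case z of (x, y) \<Rightarrow> M (x - y) * (norm (u x))\<^sup>2)
       + 2 * (case z of (x, y) \<Rightarrow> M (x - y) * (norm (u y))\<^sup>2)))"
      by (auto simp: R_def fun_eq_iff)
    show "integrable torus2 (\<lambda>(x, y). R x y)" unfolding eq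
      using E1(1) E2 by (intro integrable_mult_right Bochner_Integration.integrable_add) auto
    show "(\<integral>(x, y). R x y \<partial>torus2) = C * (\<integral>z. M z \<partial>torus) * (measure torus (space torus) + 4 * L2_inner u u)"
      unfolding eq using E1 E2 by (simp add: L2_inner_self algebra_simps)
  qed
  have "\<bar>convective_form u (mollify u)\<bar> = 1 / 4 * \<bar>\<integral>(x, y). D x y \<partial>torus2\<bar>"
    unfolding Duchon_Robert_identity(2)[OF u(1) t] D_def by (simp add: abs_mult)
  also have "\<bar>\<integral>(x, y). D x y \<partial>torus2\<bar> \<le> (\<integral>(x, y). R x y \<partial>torus2)"
  proof -
    have "integrable torus2 (\<lambda>(x, y). D x y)"
      unfolding D_def by (rule Duchon_Robert_identity(1)[OF u(1) t])
    then have "norm (\<integral>(x, y). D x y \<partial>torus2) \<le> (\<integral>(x, y). R x y \<partial>torus2)"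
      using pt by (intro Bochner_Integration.integral_norm_bound_integral Ri) auto
    then show ?thesis by simp
  qed
  also have "1 / 4 * (\<integral>(x, y). R x y \<partial>torus2) \<le> C * (\<integral>z. M z \<partial>torus) * (measure torus (space torus) + L2_inner u u)"
  proof -
    have "0 \<le> C * (\<integral>z. M z \<partial>torus)" using C M0 by (simp add: Bochner_Integration.integral_nonneg)
    then have "C * (\<integral>z. M z \<partial>torus) * (1 / 4 * (measure torus (space torus) + 4 * L2_inner u u))
      \<le> C * (\<integral>z. M z \<partial>torus) * (measure torus (space torus) + L2_inner u u)"
      by (intro mult_left_mono) auto
    then show ?thesis unfolding Rv by (simp add: algebra_simps)
  qed
  finally show ?thesis unfolding C_def by simp
qed

end

section \<open>Concentrating kernels made of powers of cosines\<close>

text \<open>A list of amplitudes and wave vectors, since multiplying two such sums makes wave vectors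
  coincide.\<close>

definition cosine_polynomial :: "(real ^ 3 \<Rightarrow> real) \<Rightarrow> bool" where
  "cosine_polynomial f \<longleftrightarrow> (\<exists>xs. (\<forall>(c, k)\<in>set xs. \<forall>i. k $ i \<in> \<int>) \<and> f = (\<lambda>z. \<Sum>(c, k)\<leftarrow>xs. c * cos (k \<bullet> z)))"

lemma cosine_polynomial_mono: "\<forall>i. k $ i \<in> \<int> \<Longrightarrow> cosine_polynomial (\<lambda>z. c * cos (k \<bullet> z))"
  unfolding cosine_polynomial_def by (rule exI[of _ "[(c, k)]"]) auto

lemma cosine_polynomial_const: "cosine_polynomial (\<lambda>z. c)"
  using cosine_polynomial_mono[of 0 c] by simp

lemma cosine_polynomial_add:
  assumes "cosine_polynomial f" "cosine_polynomial g"
  shows "cosine_polynomial (\<lambda>z. f z + g z)"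
proof -
  obtain xs ys where "\<forall>(c, k)\<in>set xs. \<forall>i. k $ i \<in> \<int>" "f = (\<lambda>z. \<Sum>(c, k)\<leftarrow>xs. c * cos (k \<bullet> z))"
    "\<forall>(c, k)\<in>set ys. \<forall>i. k $ i \<in> \<int>" "g = (\<lambda>z. \<Sum>(c, k)\<leftarrow>ys. c * cos (k \<bullet> z))"
    using assms unfolding cosine_polynomial_def by blast
  then show ?thesis unfolding cosine_polynomial_def by (intro exI[of _ "xs @ ys"]) auto
qed

lemma cosine_polynomial_induct [consumes 1, case_names zero add]:
  assumes "cosine_polynomial f" "P (\<lambda>z. 0)"
    and "\<And>c k g. \<forall>i. k $ i \<in> \<int> \<Longrightarrow> cosine_polynomial g \<Longrightarrow> P g \<Longrightarrow> P (\<lambda>z. c * cos (k \<bullet> z) + g z)"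
  shows "P f"
proof -
  obtain xs where xs: "\<forall>(c, k)\<in>set xs. \<forall>i. k $ i \<in> \<int>" "f = (\<lambda>z. \<Sum>(c, k)\<leftarrow>xs. c * cos (k \<bullet> z))"
    using assms(1) unfolding cosine_polynomial_def by blast
  have "cosine_polynomial (\<lambda>z. \<Sum>(c, k)\<leftarrow>xs. c * cos (k \<bullet> z)) \<and> P (\<lambda>z. \<Sum>(c, k)\<leftarrow>xs. c * cos (k \<bullet> z))"
    using xs(1)
  proof (induction xs)
    case Nil
    then show ?case using assms(2) cosine_polynomial_const[of 0] by simp
  next
    case (Cons x xs)
    obtain c k where x: "x = (c, k)" by force
    have k: "\<forall>i. k $ i \<in> \<int>" using Cons.prems x by auto
    show ?case using Cons assms(3)[OF k] cosine_polynomial_add[OF cosine_polynomial_mono[OF k]]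
      unfolding x by simp
  qed
  then show ?thesis using xs(2) by simp
qed

lemma cosine_polynomial_mult:
  assumes "cosine_polynomial f" "cosine_polynomial g"
  shows "cosine_polynomial (\<lambda>z. f z * g z)"
  using assms(1)
proof (induction rule: cosine_polynomial_induct)
  case zero
  then show ?case using cosine_polynomial_const[of 0] by simp
next
  case (add c k h)
  have "cosine_polynomial (\<lambda>z. (c * cos (k \<bullet> z)) * g z)"
    using assms(2)
  proof (induction rule: cosine_polynomial_induct)
    case zero
    then show ?case using cosine_polynomial_const[of 0] by simp
  next
    case (add d l r)
    have "(c * cos (k \<bullet> z)) * (d * cos (l \<bullet> z) + r z) =
      (c * d / 2) * cos ((k - l) \<bullet> z) + ((c * d / 2) * cos ((k + l) \<bullet> z) + (c * cos (k \<bullet> z)) * r z)" for z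
      by (simp add: inner_diff_left inner_add_left cos_diff cos_add algebra_simps)
    moreover have "\<forall>i. (k - l) $ i \<in> \<int>" "\<forall>i. (k + l) $ i \<in> \<int>"
      using add \<open>\<forall>i. k $ i \<in> \<int>\<close> by auto
    ultimately show ?case using add
      by (simp only:) (intro cosine_polynomial_add cosine_polynomial_mono)
  qed
  then show ?case using cosine_polynomial_add[OF _ add.IH] by (simp add: distrib_right)
qed

lemma cosine_polynomial_power:
  "cosine_polynomial f \<Longrightarrow> cosine_polynomial (\<lambda>z. f z ^ n)"
  by (induction n) (auto intro: cosine_polynomial_const cosine_polynomial_mult)

lemma cosine_polynomial_prod:
  "finite I \<Longrightarrow> (\<And>i. i \<in> I \<Longrightarrow> cosine_polynomial (f i)) \<Longrightarrow> cosine_polynomial (\<lambda>z. \<Prod>i\<in>I. f i z)"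
  by (induction rule: finite_induct) (auto intro: cosine_polynomial_const cosine_polynomial_mult)

lemma cosine_polynomial_kernel:
  assumes "cosine_polynomial f"
  obtains N a m where "cosine_kernel m" "cosine_kernel.L N a m = f"
proof -
  obtain xs where xs: "\<forall>(c, k)\<in>set xs. \<forall>i. k $ i \<in> \<int>" "f = (\<lambda>z. \<Sum>(c, k)\<leftarrow>xs. c * cos (k \<bullet> z))"
    using assms unfolding cosine_polynomial_def by blast
  define m where "m j = (if j < length xs then snd (xs ! j) else 0)" for j
  define a where "a j = fst (xs ! j)" for j
  have m: "cosine_kernel m"
  proof
    fix j i show "m j $ i \<in> \<int>"
      using xs(1) nth_mem[of j xs] unfolding m_def by (cases "xs ! j") auto
  qed
  have "cosine_kernel.L (length xs) a m z = f z" for z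
    unfolding cosine_kernel.L_def[OF m] xs(2) sum_list_sum_nth
    by (auto simp: atLeast0LessThan a_def m_def split_beta intro!: sum.cong)
  then show thesis using that[OF m] by blast
qed

text \<open>This is \<open>cos\<^sup>2 (z\<^sub>i / 2)\<close>, written as a cosine polynomial.\<close>

definition half_cos :: "3 \<Rightarrow> real ^ 3 \<Rightarrow> real" where
  "half_cos i z = (1 + cos (z $ i)) / 2"

text \<open>Separate exponents allow the recursion below to raise one of them at a time.\<close>

definition cos_product :: "(3 \<Rightarrow> nat) \<Rightarrow> real ^ 3 \<Rightarrow> real" where
  "cos_product e z = (\<Prod>i\<in>UNIV. half_cos i z ^ e i)"

lemma half_cos_bounds: "0 \<le> half_cos i z" "half_cos i z \<le> 1"
  by (simp_all add: half_cos_def) (use cos_ge_minus_one[of "z $ i"] in linarith)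

lemma cos_product_nonneg: "0 \<le> cos_product e z"
  unfolding cos_product_def by (intro prod_nonneg) (simp add: half_cos_bounds)

lemma continuous_half_cos: "continuous_on UNIV (half_cos i)"
  unfolding half_cos_def by (intro continuous_intros) auto

lemma continuous_cos_product: "continuous_on UNIV (cos_product e)"
  unfolding cos_product_def by (intro continuous_intros continuous_half_cos)

lemma periodic_half_cos: "periodic (half_cos i)"
  unfolding periodic_def half_cos_def by (auto simp: axis_def)

lemma periodic_cos_product: "periodic (cos_product e)"
  using periodic_half_cos unfolding periodic_def cos_product_def by simp

lemma torus_dist2_half_cos: "torus_dist2 z = (\<Sum>i\<in>UNIV. 1 - half_cos i z)"
  unfolding torus_dist2_def half_cos_def by (intro sum.cong) (auto simp: field_simps)

lemma cosine_polynomial_cos_product: "cosine_polynomial (cos_product e)"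
proof -
  have "cosine_polynomial (half_cos i)" for i
  proof -
    have "half_cos i = (\<lambda>z. 1 / 2 + 1 / 2 * cos (axis i 1 \<bullet> z))"
      by (auto simp: fun_eq_iff half_cos_def inner_axis' field_simps)
    moreover have "\<forall>j. (axis i 1 :: real ^ 3) $ j \<in> \<int>" by (auto simp: axis_def)
    ultimately show ?thesis
      by (simp only:) (intro cosine_polynomial_add cosine_polynomial_const cosine_polynomial_mono)
  qed
  then show ?thesis unfolding cos_product_def[abs_def]
    by (intro cosine_polynomial_prod cosine_polynomial_power) auto
qed

lemma cos_product_split: "cos_product e z = half_cos i z ^ e i * (\<Prod>j\<in>UNIV - {i}. half_cos j z ^ e j)"
  unfolding cos_product_def by (rule prod.remove) auto

lemma cos_product_other_axis:
  "(\<Prod>j\<in>UNIV - {i}. half_cos j (z + axis i h) ^ e j) = (\<Prod>j\<in>UNIV - {i}. half_cos j z ^ e j)"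
  by (intro prod.cong) (auto simp: half_cos_def axis_def)

text \<open>The derivative of \<open>sin z\<^sub>i\<close> times the product along the axis \<open>i\<close> integrates to zero.  With
  \<open>c = half_cos i z\<close>, the identities \<open>cos z\<^sub>i = 2 c - 1\<close> and \<open>sin\<^sup>2 z\<^sub>i = 4 c (1 - c)\<close> turn it into a combination
  of the products with exponents \<open>e i\<close> and \<open>e i + 1\<close>.\<close>

lemma cos_product_recursion:
  "(\<integral>z. cos_product (e(i := Suc (e i))) z \<partial>torus) =
    (2 * real (e i) + 1) / (2 * real (e i) + 2) * (\<integral>z. cos_product e z \<partial>torus)"
proof -
  let ?n = "real (e i)"
  have "(\<integral>z. (2 * ?n + 2) * cos_product (e(i := Suc (e i))) z - (2 * ?n + 1) * cos_product e z \<partial>torus) = 0"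
  proof (rule torus_integral_partial_derivative[where F = "\<lambda>z. sin (z $ i) * cos_product e z" and i = i])
    show "continuous_on UNIV (\<lambda>z. sin (z $ i) * cos_product e z)"
      by (intro continuous_intros continuous_cos_product)
    show "periodic (\<lambda>z. sin (z $ i) * cos_product e z)"
      using periodic_cos_product unfolding periodic_def by (auto simp: axis_def)
    show "continuous_on UNIV (\<lambda>z. (2 * ?n + 2) * cos_product (e(i := Suc (e i))) z - (2 * ?n + 1) * cos_product e z)"
      by (intro continuous_intros continuous_cos_product)
    fix z
    define R where "R = (\<Prod>j\<in>UNIV - {i}. half_cos j z ^ e j)"
    have F: "sin ((z + axis i h) $ i) * cos_product e (z + axis i h) = sin (z $ i + h) * (((1 + cos (z $ i + h)) / 2) ^ e i * R)" for h
      unfolding cos_product_split[of e _ i] cos_product_other_axis R_def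
      by (simp add: half_cos_def axis_def)
    have upd: "cos_product (e(i := Suc (e i))) z = half_cos i z ^ Suc (e i) * R"
      unfolding cos_product_split[of _ _ i] R_def by (auto intro!: prod.cong)
    have s2: "sin (z $ i) * sin (z $ i) = 4 * half_cos i z * (1 - half_cos i z)"
    proof -
      have "sin (z $ i) * sin (z $ i) = 1 - cos (z $ i) * cos (z $ i)"
        using sin_cos_squared_add[of "z $ i"] unfolding power2_eq_square by linarith
      moreover have "1 - c * c = 4 * ((1 + c) / 2) * (1 - (1 + c) / 2)" for c :: real
        by (simp add: field_simps)
      ultimately show ?thesis unfolding half_cos_def by (simp only:)
    qed
    have c: "cos (z $ i) = 2 * half_cos i z - 1" unfolding half_cos_def by (simp add: field_simps)
    have "((\<lambda>h. sin (z $ i + h) * (((1 + cos (z $ i + h)) / 2) ^ e i * R)) has_real_derivative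
        cos (z $ i) * (half_cos i z ^ e i * R) + sin (z $ i) * (?n * half_cos i z ^ (e i - 1) * (- sin (z $ i) / 2) * R)) (at 0)"
      by (auto intro!: derivative_eq_intros simp: half_cos_def)
    moreover have "cos (z $ i) * (half_cos i z ^ e i * R) + sin (z $ i) * (?n * half_cos i z ^ (e i - 1) * (- sin (z $ i) / 2) * R)
      = (2 * ?n + 2) * cos_product (e(i := Suc (e i))) z - (2 * ?n + 1) * cos_product e z"
    proof (cases "e i")
      case 0
      then show ?thesis unfolding upd cos_product_split[of e z i] R_def[symmetric] c by (simp add: algebra_simps)
    next
      case (Suc p)
      have "sin (z $ i) * (?n * half_cos i z ^ (e i - 1) * (- sin (z $ i) / 2) * R)
          = - (?n * half_cos i z ^ p / 2 * R) * (sin (z $ i) * sin (z $ i))" using Suc by simp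
      then show ?thesis unfolding upd cos_product_split[of e z i] R_def[symmetric] c s2
        using Suc by (simp add: algebra_simps)
    qed
    ultimately show "((\<lambda>h. sin ((z + axis i h) $ i) * cos_product e (z + axis i h)) has_real_derivative
       (2 * ?n + 2) * cos_product (e(i := Suc (e i))) z - (2 * ?n + 1) * cos_product e z) (at 0)"
      unfolding F by simp
  qed
  then have "(2 * ?n + 2) * (\<integral>z. cos_product (e(i := Suc (e i))) z \<partial>torus) = (2 * ?n + 1) * (\<integral>z. cos_product e z \<partial>torus)"
    by (simp add: continuous_integrable_torus continuous_cos_product)
  then show ?thesis by (simp add: field_simps)
qed

definition cos_power_mass :: "nat \<Rightarrow> real" where
  "cos_power_mass n = (\<integral>z. cos_product (\<lambda>_. n) z \<partial>torus)"

lemma cos_power_mass_Suc: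
  "cos_power_mass (Suc n) = ((2 * real n + 1) / (2 * real n + 2)) ^ 3 * cos_power_mass n"
proof -
  have "(\<lambda>_. Suc n) = ((\<lambda>_. n)(1 := Suc n, 2 := Suc n, 3 := Suc n) :: 3 \<Rightarrow> nat)"
    by (simp add: fun_eq_iff forall_3)
  then show ?thesis unfolding cos_power_mass_def
    using cos_product_recursion[of "(\<lambda>_. n)(1 := Suc n, 2 := Suc n)" 3]
      cos_product_recursion[of "(\<lambda>_. n)(1 := Suc n)" 2] cos_product_recursion[of "\<lambda>_. n" 1]
    by (simp add: power3_eq_cube)
qed

lemma cos_power_mass_pos: "0 < cos_power_mass n"
proof (induction n)
  case 0
  have "measure torus (space torus) = measure lborel (cbox 0 (\<chi> i. 2 * pi) :: (real ^ 3) set)"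
    unfolding torus_def by (simp add: measure_restrict_space)
  also have "\<dots> > 0"
    by (subst content_pos_lt_eq) (auto simp: Basis_vec_def inner_axis)
  finally show ?case by (simp add: cos_power_mass_def cos_product_def)
next
  case (Suc n)
  then show ?case unfolding cos_power_mass_Suc by (intro mult_pos_pos zero_less_power divide_pos_pos) auto
qed

lemma cos_power_mass_Suc_ge: "cos_power_mass n \<le> 8 * cos_power_mass (Suc n)"
proof -
  have "(1 / 2) ^ 3 \<le> ((2 * real n + 1) / (2 * real n + 2)) ^ 3"
    by (intro power_mono) (auto simp: field_simps)
  then have "(1 / 2) ^ 3 * cos_power_mass n \<le> cos_power_mass (Suc n)"
    unfolding cos_power_mass_Suc using cos_power_mass_pos[of n] by (intro mult_right_mono) auto
  then show ?thesis by (simp add: power3_eq_cube)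
qed

lemma cos_power_moment:
  "(\<integral>z. (1 - half_cos i z) * cos_product (\<lambda>_. n) z \<partial>torus) = cos_power_mass n / (2 * real n + 2)"
  "(\<integral>z. (1 - half_cos i z)\<^sup>2 * cos_product (\<lambda>_. n) z \<partial>torus) =
     3 * cos_power_mass n / ((2 * real n + 2) * (2 * real n + 4))"
proof -
  let ?e = "\<lambda>_ :: 3. n"
  let ?e1 = "?e(i := Suc n)" and ?e2 = "?e(i := Suc (Suc n))"
  have R: "half_cos i z * cos_product ?e z = cos_product ?e1 z"
    "half_cos i z * (half_cos i z * cos_product ?e z) = cos_product ?e2 z" for z
    unfolding cos_product_split[of _ _ i] by (auto intro!: prod.cong)
  have int: "integrable torus (cos_product e)" for e
    by (intro continuous_integrable_torus continuous_cos_product)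
  have v1: "(\<integral>z. cos_product ?e1 z \<partial>torus) = (2 * real n + 1) / (2 * real n + 2) * cos_power_mass n"
    using cos_product_recursion[of ?e i] by (simp add: cos_power_mass_def)
  have v2: "(\<integral>z. cos_product ?e2 z \<partial>torus) = (2 * real n + 3) / (2 * real n + 4) * (\<integral>z. cos_product ?e1 z \<partial>torus)"
    using cos_product_recursion[of ?e1 i] by (simp add: algebra_simps)
  have "(\<integral>z. (1 - half_cos i z) * cos_product ?e z \<partial>torus) = (\<integral>z. cos_product ?e z - cos_product ?e1 z \<partial>torus)"
    by (simp add: left_diff_distrib R)
  then show "(\<integral>z. (1 - half_cos i z) * cos_product ?e z \<partial>torus) = cos_power_mass n / (2 * real n + 2)"
    using int v1 by (simp add: cos_power_mass_def[symmetric] field_simps)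
  have "(1 - half_cos i z)\<^sup>2 * cos_product ?e z = cos_product ?e z - 2 * cos_product ?e1 z + cos_product ?e2 z" for z
    unfolding R[symmetric] by (simp add: power2_eq_square algebra_simps)
  then have "(\<integral>z. (1 - half_cos i z)\<^sup>2 * cos_product ?e z \<partial>torus)
      = cos_power_mass n - 2 * (\<integral>z. cos_product ?e1 z \<partial>torus) + (\<integral>z. cos_product ?e2 z \<partial>torus)"
    using int by (simp add: cos_power_mass_def[symmetric])
  also have "\<dots> = 3 * cos_power_mass n / ((2 * real n + 2) * (2 * real n + 4))"
    unfolding v2 v1 by (simp add: divide_simps) (simp add: algebra_simps)
  finally show "(\<integral>z. (1 - half_cos i z)\<^sup>2 * cos_product ?e z \<partial>torus) =
     3 * cos_power_mass n / ((2 * real n + 2) * (2 * real n + 4))" .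
qed

lemma torus_dist2_moment:
  "(\<integral>z. torus_dist2 z * cos_product (\<lambda>_. n) z \<partial>torus) = 3 * cos_power_mass n / (2 * real n + 2)"
  "(\<integral>z. (torus_dist2 z)\<^sup>2 * cos_product (\<lambda>_. n) z \<partial>torus) \<le>
     27 * cos_power_mass n / ((2 * real n + 2) * (2 * real n + 4))"
proof -
  let ?P = "cos_product (\<lambda>_. n)"
  have int: "integrable torus (\<lambda>z. (1 - half_cos i z) * ?P z)" "integrable torus (\<lambda>z. (1 - half_cos i z)\<^sup>2 * ?P z)"
     "integrable torus (\<lambda>z. (torus_dist2 z)\<^sup>2 * ?P z)" for i
    by (intro continuous_integrable_torus continuous_intros continuous_half_cos continuous_cos_product continuous_torus_dist2)+
  have "(\<integral>z. torus_dist2 z * ?P z \<partial>torus) = (\<integral>z. (\<Sum>i\<in>UNIV. (1 - half_cos i z) * ?P z) \<partial>torus)"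
    by (simp add: torus_dist2_half_cos sum_distrib_right)
  then show "(\<integral>z. torus_dist2 z * ?P z \<partial>torus) = 3 * cos_power_mass n / (2 * real n + 2)"
    using int by (simp add: cos_power_moment)
  have "(\<integral>z. (torus_dist2 z)\<^sup>2 * ?P z \<partial>torus) \<le> (\<integral>z. 3 * (\<Sum>i\<in>UNIV. (1 - half_cos i z)\<^sup>2 * ?P z) \<partial>torus)"
  proof (rule integral_mono)
    fix z
    have "(x + y + w)\<^sup>2 \<le> 3 * (x\<^sup>2 + y\<^sup>2 + w\<^sup>2)" for x y w :: real
      using sum_squares_bound[of x y] sum_squares_bound[of x w] sum_squares_bound[of y w]
      by (simp add: power2_eq_square algebra_simps)
    then have "(torus_dist2 z)\<^sup>2 \<le> 3 * (\<Sum>i\<in>UNIV. (1 - half_cos i z)\<^sup>2)"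
      unfolding torus_dist2_half_cos sum_3 .
    then have "(torus_dist2 z)\<^sup>2 * ?P z \<le> 3 * (\<Sum>i\<in>UNIV. (1 - half_cos i z)\<^sup>2) * ?P z"
      by (intro mult_right_mono cos_product_nonneg)
    then show "(torus_dist2 z)\<^sup>2 * ?P z \<le> 3 * (\<Sum>i\<in>UNIV. (1 - half_cos i z)\<^sup>2 * ?P z)"
      by (simp add: sum_distrib_right mult.assoc)
  qed (use int in auto)
  also have "\<dots> = 27 * cos_power_mass n / ((2 * real n + 2) * (2 * real n + 4))"
    using int by (simp add: cos_power_moment)
  finally show "(\<integral>z. (torus_dist2 z)\<^sup>2 * ?P z \<partial>torus) \<le> 27 * cos_power_mass n / ((2 * real n + 2) * (2 * real n + 4))" .
qed

text \<open>A derivative lowers one exponent and brings down the factor \<open>|sin z\<^sub>i| / 2 = \<surd>(c (1 - c))\<close>, which is at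
  most the root of \<open>torus_dist2 z\<close>.  The constant 24 is 3, for the components, times 8, the price
  of replacing the mass for \<open>Suc p\<close> by the mass for \<open>p\<close>.\<close>

lemma cos_product_gradient_bound:
  assumes m: "cosine_kernel m" and L: "cosine_kernel.L N a m = (\<lambda>z. cos_product (\<lambda>_. Suc p) z / cos_power_mass (Suc p))"
  shows "norm (cosine_kernel.grad N a m z) \<le> 24 * real (Suc p) * sqrt (torus_dist2 z) * (cos_product (\<lambda>_. p) z / cos_power_mass p)"
proof -
  interpret cosine_kernel N a m by (rule m)
  let ?n = "Suc p"
  let ?P = "cos_product (\<lambda>_. p) z"
  have comp: "\<bar>grad z $ i\<bar> \<le> real ?n * sqrt (torus_dist2 z) * ?P / cos_power_mass ?n" for i
  proof -
    define R where "R = (\<Prod>j\<in>UNIV - {i}. half_cos j z ^ ?n)"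
    have LF: "L (z + axis i h) = ((1 + cos (z $ i + h)) / 2) ^ ?n * R / cos_power_mass ?n" for h
      unfolding L cos_product_split[of _ _ i] cos_product_other_axis R_def
      by (simp add: half_cos_def axis_def)
    note L_has_axis_derivative[of z i]
    moreover have "((\<lambda>h. L (z + axis i h)) has_real_derivative
      (real ?n * half_cos i z ^ p * (- sin (z $ i) / 2)) * R / cos_power_mass ?n) (at 0)"
    proof -
      have "((\<lambda>h. ((1 + cos (z $ i + h)) / 2) ^ k) has_real_derivative
         real k * half_cos i z ^ (k - 1) * (- sin (z $ i) / 2)) (at 0)" for k
        by (auto intro!: derivative_eq_intros simp: half_cos_def)
      from DERIV_cdivide[OF DERIV_cmult_right[OF this[of ?n], of R], of "cos_power_mass ?n"] show ?thesis
        unfolding LF by simp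
    qed
    ultimately have g: "grad z $ i = (real ?n * half_cos i z ^ p * (- sin (z $ i) / 2)) * R / cos_power_mass ?n"
      by (rule DERIV_unique)
    have s: "\<bar>sin (z $ i) / 2\<bar> \<le> sqrt (torus_dist2 z)"
    proof (rule real_le_rsqrt)
      have "(\<bar>sin (z $ i) / 2\<bar>)\<^sup>2 = half_cos i z * (1 - half_cos i z)"
      proof -
        have "sin (z $ i) * sin (z $ i) = 1 - cos (z $ i) * cos (z $ i)"
          using sin_cos_squared_add[of "z $ i"] unfolding power2_eq_square by linarith
        then show ?thesis by (simp add: half_cos_def power2_eq_square field_simps)
      qed
      also have "\<dots> \<le> 1 * (1 - half_cos i z)"
        using half_cos_bounds[of i z] by (intro mult_right_mono) auto
      also have "\<dots> \<le> torus_dist2 z"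
        unfolding torus_dist2_half_cos using half_cos_bounds[of _ z]
        by simp (rule member_le_sum[where f = "\<lambda>i. 1 - half_cos i z"], auto)
      finally show "(\<bar>sin (z $ i) / 2\<bar>)\<^sup>2 \<le> torus_dist2 z" .
    qed
    have R: "0 \<le> R" "R \<le> (\<Prod>j\<in>UNIV - {i}. half_cos j z ^ p)"
      unfolding R_def by (auto intro!: prod_nonneg prod_mono mult_left_le_one_le simp: half_cos_bounds)
    have "\<bar>grad z $ i\<bar> = real ?n * half_cos i z ^ p * \<bar>sin (z $ i) / 2\<bar> * R / cos_power_mass ?n"
      unfolding g using R cos_power_mass_pos[of ?n] half_cos_bounds[of i z] by (simp add: abs_mult)
    also have "\<dots> \<le> real ?n * half_cos i z ^ p * sqrt (torus_dist2 z) * (\<Prod>j\<in>UNIV - {i}. half_cos j z ^ p) / cos_power_mass ?n"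
      using R s cos_power_mass_pos[of ?n] half_cos_bounds[of i z] torus_dist2_nonneg[of z]
      by (intro divide_right_mono mult_mono) auto
    finally show ?thesis unfolding cos_product_split[of _ z i] by (simp add: ac_simps)
  qed
  have "norm (grad z) \<le> (\<Sum>i\<in>UNIV. \<bar>grad z $ i\<bar>)"
    by (rule norm_le_l1_cart)
  also have "\<dots> \<le> (\<Sum>i\<in>(UNIV :: 3 set). real ?n * sqrt (torus_dist2 z) * ?P / cos_power_mass ?n)"
    by (intro sum_mono comp)
  also have "\<dots> = 3 * real ?n * sqrt (torus_dist2 z) * (?P / cos_power_mass ?n)" by simp
  also have "\<dots> \<le> 3 * real ?n * sqrt (torus_dist2 z) * (8 * (?P / cos_power_mass p))"
  proof (rule mult_left_mono)
    have "?P / cos_power_mass ?n \<le> ?P / (cos_power_mass p / 8)"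
      using cos_power_mass_Suc_ge[of p] cos_power_mass_pos[of p] cos_power_mass_pos[of ?n] cos_product_nonneg
      by (intro divide_left_mono) auto
    then show "?P / cos_power_mass ?n \<le> 8 * (?P / cos_power_mass p)" by (simp add: mult.commute)
  qed (use torus_dist2_nonneg in auto)
  also have "3 * n * r * (8 * x) = 24 * n * r * x" for n r x :: real by simp
  finally show ?thesis .
qed

text \<open>Reduces the fractional moment of the kernels to the first and second moments.\<close>

lemma powr_interpolation:
  fixes q \<eta> \<gamma> :: real
  assumes q: "0 \<le> q" and eta: "0 < \<eta>" and g: "1 < \<gamma>" "\<gamma> < 3"
  shows "q powr ((1 + \<gamma>) / 2) \<le> \<eta> powr ((\<gamma> - 1) / 2) * q + \<eta> powr ((\<gamma> - 3) / 2) * q\<^sup>2"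
proof (cases "q = 0")
  case False
  then have q0: "q > 0" using q by simp
  show ?thesis
  proof (cases "q \<le> \<eta>")
    case True
    have "q powr ((1 + \<gamma>) / 2) = q powr ((\<gamma> - 1) / 2 + 1)" by (simp add: field_simps)
    also have "\<dots> = q powr ((\<gamma> - 1) / 2) * q" using q0 by (simp add: powr_add)
    also have "\<dots> \<le> \<eta> powr ((\<gamma> - 1) / 2) * q"
      using True q0 g by (intro mult_right_mono powr_mono2) auto
    finally show ?thesis by (simp add: add_increasing2)
  next
    case False
    have "q powr ((1 + \<gamma>) / 2) = q powr ((\<gamma> - 3) / 2 + 2)" by (simp add: field_simps)
    also have "\<dots> = q powr ((\<gamma> - 3) / 2) * q\<^sup>2" using q0 by (simp add: powr_add powr_numeral)
    also have "\<dots> \<le> \<eta> powr ((\<gamma> - 3) / 2) * q\<^sup>2"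
      using False q0 g eta by (intro mult_right_mono powr_mono2') auto
    finally show ?thesis using q by (simp add: add_increasing)
  qed
qed (use g in simp)

text \<open>For the exponent \<open>n = Suc p\<close> the first and second moments of the squared distance are of order
  \<open>1 / n\<close> and \<open>1 / n\<^sup>2\<close>.  Interpolating at the scale \<open>\<eta> = 1 / n\<close>, the integral of
  \<open>|\<nabla>L(z)| |z|\<^bsup>\<gamma>\<^esup>\<close> is of order \<open>n\<^bsup>-(\<gamma> - 1) / 2\<^esup>\<close>, which is small because \<open>\<gamma> > 1\<close>.\<close>

lemma concentrating_kernels:
  fixes \<gamma> \<epsilon> :: real
  assumes g: "1 < \<gamma>" "\<gamma> < 3" and \<epsilon>: "\<epsilon> > 0"
  obtains N a m M where "cosine_kernel m" "cosine_kernel.averaging N a m"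
    "(\<integral>z. cosine_kernel.L N a m z * torus_dist2 z \<partial>torus) \<le> \<epsilon>"
    "continuous_on UNIV M" "periodic M" "\<And>z. M (- z) = M z" "(\<integral>z. M z \<partial>torus) \<le> \<epsilon>"
    "\<And>z. norm (cosine_kernel.grad N a m z) * torus_dist2 z powr (\<gamma> / 2) \<le> M z"
proof -
  define s where "s = (\<gamma> - 1) / 2"
  have s: "s > 0" using g by (simp add: s_def)
  have "(\<lambda>p. 1 / real (Suc p)) \<longlonglongrightarrow> 0" by (rule LIMSEQ_Suc[OF lim_1_over_n])
  moreover have "((\<lambda>p. (1 / real (Suc p)) powr s) \<longlonglongrightarrow> 0)"
    by (rule tendsto_zero_powrI[OF \<open>(\<lambda>p. 1 / real (Suc p)) \<longlonglongrightarrow> 0\<close> tendsto_const _ s]) auto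
  ultimately have "\<forall>\<^sub>F p in sequentially. 1 / real (Suc p) < \<epsilon> / 3 \<and> (1 / real (Suc p)) powr s < \<epsilon> / 198"
    using \<epsilon> by (intro eventually_conj order_tendstoD) auto
  then obtain p where p: "1 / real (Suc p) < \<epsilon> / 3" "(1 / real (Suc p)) powr s < \<epsilon> / 198"
    by (auto simp: eventually_sequentially)
  define \<eta> where "\<eta> = 1 / real (Suc p)"
  have eta: "\<eta> > 0" by (simp add: \<eta>_def)
  let ?n = "Suc p"
  have "cosine_polynomial (\<lambda>z. 1 / cos_power_mass ?n * cos_product (\<lambda>_. ?n) z)"
    by (intro cosine_polynomial_mult cosine_polynomial_const cosine_polynomial_cos_product)
  then obtain N a m where m: "cosine_kernel m"
    and L: "cosine_kernel.L N a m = (\<lambda>z. cos_product (\<lambda>_. ?n) z / cos_power_mass ?n)"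
    using cosine_polynomial_kernel by (metis (no_types, lifting) ext mult_1 times_divide_eq_left)
  define M where "M z = 24 * real ?n * (\<eta> powr s * torus_dist2 z + \<eta> powr (s - 1) * (torus_dist2 z)\<^sup>2)
     * (cos_product (\<lambda>_. p) z / cos_power_mass p)" for z
  have pos: "cos_power_mass ?n > 0" "cos_power_mass p > 0" by (rule cos_power_mass_pos)+
  show thesis
  proof (rule that[OF m])
    show "cosine_kernel.averaging N a m"
      unfolding cosine_kernel.averaging_def[OF m] L
      using pos cos_product_nonneg by (simp add: cos_power_mass_def[symmetric])
    have "(\<integral>z. cosine_kernel.L N a m z * torus_dist2 z \<partial>torus) = (\<integral>z. torus_dist2 z * cos_product (\<lambda>_. ?n) z \<partial>torus) / cos_power_mass ?n"
      unfolding L by (simp add: mult.commute)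
    also have "\<dots> = 3 / (2 * real ?n + 2)"
      unfolding torus_dist2_moment using pos by simp
    also have "\<dots> \<le> 3 * (1 / real ?n)" by (simp add: field_simps)
    also have "\<dots> \<le> \<epsilon>" using p(1) by linarith
    finally show "(\<integral>z. cosine_kernel.L N a m z * torus_dist2 z \<partial>torus) \<le> \<epsilon>" .
    show "continuous_on UNIV M" unfolding M_def
      using pos by (intro continuous_intros continuous_torus_dist2 continuous_cos_product) auto
    show "periodic M" using periodic_torus_dist2 periodic_cos_product unfolding periodic_def M_def by simp
    show "M (- z) = M z" for z
      unfolding M_def by (simp add: even_torus_dist2 cos_product_def half_cos_def)
    have i1: "integrable torus (\<lambda>z. torus_dist2 z * cos_product (\<lambda>_. p) z)"
      and i2: "integrable torus (\<lambda>z. (torus_dist2 z)\<^sup>2 * cos_product (\<lambda>_. p) z)"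
      by (intro continuous_integrable_torus continuous_intros continuous_cos_product continuous_torus_dist2)+
    have "M z = 24 * real ?n / cos_power_mass p * (\<eta> powr s * (torus_dist2 z * cos_product (\<lambda>_. p) z)
       + \<eta> powr (s - 1) * ((torus_dist2 z)\<^sup>2 * cos_product (\<lambda>_. p) z))" for z
      unfolding M_def by (simp add: field_simps)
    then have "(\<integral>z. M z \<partial>torus) = 24 * real ?n / cos_power_mass p * (\<eta> powr s * (\<integral>z. torus_dist2 z * cos_product (\<lambda>_. p) z \<partial>torus)
       + \<eta> powr (s - 1) * (\<integral>z. (torus_dist2 z)\<^sup>2 * cos_product (\<lambda>_. p) z \<partial>torus))"
      using i1 i2 by simp
    also have "\<dots> \<le> 24 * real ?n / cos_power_mass p * (\<eta> powr s * (3 * cos_power_mass p / (2 * real p + 2))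
       + \<eta> powr (s - 1) * (27 * cos_power_mass p / ((2 * real p + 2) * (2 * real p + 4))))"
      using pos torus_dist2_moment[of p] by (intro mult_left_mono add_mono) auto
    also have "\<dots> = 24 * (\<eta> powr s * (3 / 2)) + 24 * (\<eta> powr (s - 1) * (27 / (2 * (2 * real p + 4))))"
    proof -
      have "24 * n / c * (A * (3 * c / (2 * n)) + B * (27 * c / ((2 * n) * d))) = 24 * (A * (3 / 2)) + 24 * (B * (27 / (2 * d)))"
        if "n > 0" "c > 0" "d > 0" for n c d A B :: real
        using that by (simp add: field_simps)
      moreover have "2 * real p + 2 = 2 * real ?n" by simp
      ultimately show ?thesis using pos by (simp only:)
    qed
    also have "\<dots> \<le> 198 * \<eta> powr s"
    proof -
      have "\<eta> powr (s - 1) * (27 / (2 * (2 * real p + 4))) = \<eta> powr s * (real ?n * (27 / (2 * (2 * real p + 4))))"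
        using eta by (simp add: powr_diff \<eta>_def)
      also have "\<dots> \<le> \<eta> powr s * (27 / 4)"
        by (intro mult_left_mono) (auto simp: field_simps)
      finally show ?thesis by simp
    qed
    also have "\<dots> \<le> \<epsilon>" using p(2) unfolding \<eta>_def by simp
    finally show "(\<integral>z. M z \<partial>torus) \<le> \<epsilon>" .
    fix z
    let ?q = "torus_dist2 z"
    have "norm (cosine_kernel.grad N a m z) * ?q powr (\<gamma> / 2)
      \<le> (24 * real ?n * sqrt ?q * (cos_product (\<lambda>_. p) z / cos_power_mass p)) * ?q powr (\<gamma> / 2)"
      by (intro mult_right_mono cos_product_gradient_bound[OF m L]) auto
    also have "\<dots> = 24 * real ?n * (?q powr ((1 + \<gamma>) / 2)) * (cos_product (\<lambda>_. p) z / cos_power_mass p)"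
      using torus_dist2_nonneg[of z] by (simp add: powr_half_sqrt[symmetric] powr_add[symmetric] add_divide_distrib)
    also have "\<dots> \<le> M z"
      unfolding M_def using powr_interpolation[OF torus_dist2_nonneg[of z] eta g] pos cos_product_nonneg
      by (intro mult_right_mono mult_left_mono) (auto simp: s_def field_simps)
    finally show "norm (cosine_kernel.grad N a m z) * ?q powr (\<gamma> / 2) \<le> M z" .
  qed
qed

section \<open>Test functions\<close>

text \<open>The functions \<open>p(1 / x) e\<^bsup>-1 / x\<^esup>\<close>, extended by zero, are closed under differentiation; they supply
  the smooth cutoffs in time.\<close>

definition flat_exp :: "real poly \<Rightarrow> real \<Rightarrow> real" where
  "flat_exp p x = (if x \<le> 0 then 0 else poly p (1 / x) * exp (- (1 / x)))"

definition flat_deriv :: "real poly \<Rightarrow> real poly" where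
  "flat_deriv p = [:0, 0, 1:] * (p - pderiv p)"

lemma poly_times_exp_minus_tendsto_0: "((\<lambda>y. poly p y * exp (- y)) \<longlongrightarrow> (0::real)) at_top"
proof -
  have "((\<lambda>y. \<Sum>i\<le>degree p. coeff p i * (y ^ i / exp y)) \<longlongrightarrow> (\<Sum>i\<le>degree p. coeff p i * 0)) at_top"
    by (intro tendsto_sum tendsto_mult_left tendsto_power_div_exp_0)
  moreover have "(\<lambda>y. poly p y * exp (- y)) = (\<lambda>y. \<Sum>i\<le>degree p. coeff p i * (y ^ i / exp y))"
    by (simp add: fun_eq_iff poly_altdef sum_distrib_right exp_minus divide_inverse mult.assoc)
  ultimately show ?thesis by simp
qed

lemma flat_exp_has_derivative:
  "(flat_exp p has_real_derivative flat_exp (flat_deriv p) x) (at x)"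
proof -
  consider "x > 0" | "x < 0" | "x = 0" by linarith
  then show ?thesis
  proof cases
    case 1
    have "((\<lambda>x. poly p (1 / x) * exp (- (1 / x))) has_real_derivative
       poly p (1 / x) * (exp (- (1 / x)) * (1 / x\<^sup>2)) + (poly (pderiv p) (1 / x) * (- (1 / x\<^sup>2))) * exp (- (1 / x))) (at x)"
      using 1 by (auto intro!: derivative_eq_intros DERIV_chain2[OF poly_DERIV] simp: power2_eq_square)
    moreover have "poly p (1 / x) * (exp (- (1 / x)) * (1 / x\<^sup>2)) + (poly (pderiv p) (1 / x) * (- (1 / x\<^sup>2))) * exp (- (1 / x))
       = flat_exp (flat_deriv p) x"
      using 1 by (simp add: flat_exp_def flat_deriv_def power2_eq_square algebra_simps)
    ultimately have "((\<lambda>x. poly p (1 / x) * exp (- (1 / x))) has_real_derivative flat_exp (flat_deriv p) x) (at x)" by simp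
    then show ?thesis
      by (rule has_field_derivative_transform_within_open[of _ _ _ "{0<..}"]) (use 1 in \<open>auto simp: flat_exp_def\<close>)
  next
    case 2
    have "((\<lambda>x. 0) has_real_derivative flat_exp (flat_deriv p) x) (at x)"
      using 2 by (simp add: flat_exp_def)
    then show ?thesis
      by (rule has_field_derivative_transform_within_open[of _ _ _ "{..<0}"]) (use 2 in \<open>auto simp: flat_exp_def\<close>)
  next
    case 3
    have "((\<lambda>t. flat_exp p t / t) \<longlongrightarrow> 0) (at_left 0)"
      by (rule tendsto_eventually) (auto simp: flat_exp_def eventually_at_filter)
    moreover have "((\<lambda>t. flat_exp p t / t) \<longlongrightarrow> 0) (at_right 0)"
    proof -
      have "((\<lambda>t. poly (pCons 0 p) (inverse t) * exp (- inverse t)) \<longlongrightarrow> 0) (at_right 0)"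
        by (rule filterlim_compose[OF poly_times_exp_minus_tendsto_0 filterlim_inverse_at_top_right])
      then show ?thesis
        by (rule Lim_transform_eventually) (auto simp: flat_exp_def eventually_at_filter field_simps)
    qed
    ultimately have "((\<lambda>t. flat_exp p t / t) \<longlongrightarrow> 0) (at 0)"
      by (simp add: filterlim_at_split)
    then show ?thesis using 3 by (simp add: DERIV_def flat_exp_def)
  qed
qed

lemma flat_exp_smult: "flat_exp (smult c p) x = c * flat_exp p x"
  by (simp add: flat_exp_def)

lemma flat_exp_one:
  "flat_exp 1 x \<le> 1" "0 \<le> flat_exp 1 x" "0 \<le> flat_exp (flat_deriv 1) x" "x \<le> 0 \<Longrightarrow> flat_exp p x = 0"
  by (auto simp: flat_exp_def flat_deriv_def)

text \<open>At \<open>x = \<tau> - t\<close> these cutoffs approximate the indicator function of \<open>t < \<tau>\<close>.\<close>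

lemma flat_exp_one_scaled_tendsto:
  "(\<lambda>n. flat_exp 1 (real (Suc n) * x)) \<longlonglongrightarrow> (if x \<le> 0 then 0 else 1)"
proof (cases "x \<le> 0")
  case True
  then have "flat_exp 1 (real (Suc n) * x) = 0" for n
    by (intro flat_exp_one(4)) (simp add: mult_nonneg_nonpos)
  then show ?thesis using True by simp
next
  case False
  have "(\<lambda>n. exp (- (1 / x * inverse (real (Suc n))))) \<longlonglongrightarrow> exp (- (1 / x * 0))"
    by (intro tendsto_intros LIMSEQ_inverse_real_of_nat)
  moreover have "flat_exp 1 (real (Suc n) * x) = exp (- (1 / x * inverse (real (Suc n))))" for n
  proof -
    have "\<not> real (Suc n) * x \<le> 0" using False by (simp add: mult_le_0_iff del: of_nat_Suc)
    then show ?thesis by (simp add: flat_exp_def field_simps)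
  qed
  ultimately show ?thesis using False by simp
qed

lemma frechet_derivative_cong_on:
  assumes "x \<in> S" "\<And>y. y \<in> S \<Longrightarrow> f y = g y"
  shows "frechet_derivative f (at x within S) = frechet_derivative g (at x within S)"
  unfolding frechet_derivative_def
  using has_derivative_transform[OF assms(1), of f g] has_derivative_transform[OF assms(1), of g f] assms(2)
  by (metis (no_types, lifting))

lemma C_k_on_cong:
  assumes "\<And>x. x \<in> S \<Longrightarrow> f x = g x"
  shows "C_k_on k S f \<longleftrightarrow> C_k_on k S g"
  using assms
proof (induction k arbitrary: f g)
  case 0
  then show ?case by (simp cong: continuous_on_cong)
next
  case (Suc k)
  have "f differentiable_on S \<longleftrightarrow> g differentiable_on S"
    using Suc.prems has_derivative_transform[of _ S f g] has_derivative_transform[of _ S g f]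
    unfolding differentiable_on_def differentiable_def by metis
  moreover have "C_k_on k S (\<lambda>x. frechet_derivative f (at x within S) b)
     \<longleftrightarrow> C_k_on k S (\<lambda>x. frechet_derivative g (at x within S) b)" for b
    by (rule Suc.IH) (simp add: frechet_derivative_cong_on[of _ S f g] Suc.prems)
  ultimately show ?case by simp
qed

text \<open>Products of flat cutoffs in time and plane waves in space are closed under all derivatives, because
  differentiating a cosine shifts its phase by a quarter period; smoothness follows by induction.\<close>

type_synonym flat_wave = "real poly \<times> (real ^ 3) \<times> real \<times> (real ^ 3)"

definition flat_waves :: "real \<Rightarrow> real \<Rightarrow> flat_wave list \<Rightarrow> real \<times> (real ^ 3) \<Rightarrow> real ^ 3" where
  "flat_waves r \<tau> xs z = (\<Sum>(p, k, c, v)\<leftarrow>xs. (flat_exp p (r * (\<tau> - fst z)) * cos (k \<bullet> snd z + c)) *\<^sub>R v)"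

definition flat_waves_deriv :: "real \<Rightarrow> real \<times> (real ^ 3) \<Rightarrow> flat_wave list \<Rightarrow> flat_wave list" where
  "flat_waves_deriv r b xs = concat (map (\<lambda>(p, k, c, v).
     [(smult (- (r * fst b)) (flat_deriv p), k, c, v), (p, k, c + pi / 2, (k \<bullet> snd b) *\<^sub>R v)]) xs)"

lemma flat_waves_has_derivative:
  "(flat_waves r \<tau> xs has_derivative (\<lambda>b. flat_waves r \<tau> (flat_waves_deriv r b xs) z)) (at z within S)"
proof (rule has_derivative_at_withinI, induction xs)
  case Nil
  then show ?case by (simp add: flat_waves_def[abs_def] flat_waves_deriv_def)
next
  case (Cons x xs)
  obtain p k c v where x: "x = (p, k, c, v)" by (metis prod.collapse)
  have "((\<lambda>z. flat_exp p (r * (\<tau> - fst z))) has_derivative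
      (\<lambda>b. flat_exp (flat_deriv p) (r * (\<tau> - fst z)) * (- (r * fst b)))) (at z)"
    by (rule has_derivative_compose[where f = "\<lambda>z. r * (\<tau> - fst z)" and g = "flat_exp p",
          OF _ flat_exp_has_derivative[THEN has_field_derivative_imp_has_derivative]])
       (auto intro!: derivative_eq_intros)
  moreover have "((\<lambda>z. cos (k \<bullet> snd z + c)) has_derivative (\<lambda>b. - sin (k \<bullet> snd z + c) * (k \<bullet> snd b))) (at z)"
    by (auto intro!: derivative_eq_intros)
  ultimately have "((\<lambda>z. (flat_exp p (r * (\<tau> - fst z)) * cos (k \<bullet> snd z + c)) *\<^sub>R v) has_derivative
      (\<lambda>b. (flat_exp p (r * (\<tau> - fst z)) * (- sin (k \<bullet> snd z + c) * (k \<bullet> snd b))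
        + flat_exp (flat_deriv p) (r * (\<tau> - fst z)) * (- (r * fst b)) * cos (k \<bullet> snd z + c)) *\<^sub>R v)) (at z)"
    by (intro has_derivative_scaleR_left has_derivative_mult)
  note D = has_derivative_add[OF this Cons]
  have "flat_waves r \<tau> (x # xs) = (\<lambda>z. (flat_exp p (r * (\<tau> - fst z)) * cos (k \<bullet> snd z + c)) *\<^sub>R v + flat_waves r \<tau> xs z)"
    by (simp add: fun_eq_iff flat_waves_def x)
  moreover have "flat_waves r \<tau> (flat_waves_deriv r b (x # xs)) z =
     (flat_exp p (r * (\<tau> - fst z)) * (- sin (k \<bullet> snd z + c) * (k \<bullet> snd b))
        + flat_exp (flat_deriv p) (r * (\<tau> - fst z)) * (- (r * fst b)) * cos (k \<bullet> snd z + c)) *\<^sub>R v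
     + flat_waves r \<tau> (flat_waves_deriv r b xs) z" for b
  proof -
    have "cos (k \<bullet> snd z + (c + pi / 2)) = - sin (k \<bullet> snd z + c)"
      unfolding add.assoc[symmetric] by (simp add: cos_add[of _ "pi / 2"])
    moreover have "flat_exp (smult (- (r * fst b)) (flat_deriv p)) y = - (r * fst b) * flat_exp (flat_deriv p) y" for y
      by (rule flat_exp_smult)
    ultimately show ?thesis
      by (simp add: flat_waves_def flat_waves_deriv_def x scaleR_add_left[symmetric] del: smult_minus_left)
         (simp add: algebra_simps)
  qed
  ultimately show ?case using D by simp
qed

lemma flat_waves_smooth:
  assumes "T > 0"
  shows "smooth_on ({0..<T} \<times> UNIV) (flat_waves r \<tau> xs)"
proof -
  let ?S = "{0..<T} \<times> (UNIV :: (real ^ 3) set)"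
  have "C_k_on k ?S (flat_waves r \<tau> xs)" for k
  proof (induction k arbitrary: xs)
    case 0
    show ?case unfolding C_k_on.simps
      by (rule differentiable_imp_continuous_on)
         (auto simp: differentiable_on_def intro!: differentiableI flat_waves_has_derivative)
  next
    case (Suc k)
    have d: "flat_waves r \<tau> xs differentiable_on ?S"
      by (auto simp: differentiable_on_def intro!: differentiableI flat_waves_has_derivative)
    have "C_k_on k ?S (\<lambda>z. frechet_derivative (flat_waves r \<tau> xs) (at z within ?S) b)" for b
    proof (subst C_k_on_cong)
      fix z assume z: "z \<in> ?S"
      have "frechet_derivative (flat_waves r \<tau> xs) (at z within ?S) = (\<lambda>b. flat_waves r \<tau> (flat_waves_deriv r b xs) z)"
      proof (rule frechet_derivative_unique_within)
        show "(flat_waves r \<tau> xs has_derivative frechet_derivative (flat_waves r \<tau> xs) (at z within ?S)) (at z within ?S)"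
          using bspec[OF d[unfolded differentiable_on_def] z] by (simp only: frechet_derivative_works)
        show "(flat_waves r \<tau> xs has_derivative (\<lambda>b. flat_waves r \<tau> (flat_waves_deriv r b xs) z)) (at z within ?S)"
          by (rule flat_waves_has_derivative)
        fix i :: "real \<times> (real ^ 3)" and e :: real
        assume i: "i \<in> Basis" and e: "e > 0"
        have i1: "fst i = 0 \<or> fst i = 1" using i by (auto simp: Basis_prod_def)
        obtain t x where tx: "z = (t, x)" "0 \<le> t" "t < T" using z by auto
        show "\<exists>d. 0 < \<bar>d\<bar> \<and> \<bar>d\<bar> < e \<and> z + d *\<^sub>R i \<in> ?S"
          by (rule exI[of _ "min e (T - t) / 2"]) (use i1 tx e in \<open>cases i, auto simp: min_def field_simps\<close>)
      qed
      then show "frechet_derivative (flat_waves r \<tau> xs) (at z within ?S) b = flat_waves r \<tau> (flat_waves_deriv r b xs) z"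
        by simp
    qed (rule Suc.IH)
    then show ?case using d by simp
  qed
  then show ?thesis unfolding smooth_on_def by blast
qed

context cosine_kernel
begin

lemma mollify_flat_waves:
  "flat_exp 1 (r * (\<tau> - t)) *\<^sub>R mollify u x = flat_waves r \<tau>
     (concat (map (\<lambda>k. [(1, m k, 0, a k *\<^sub>R cos_coeff u k), (1, m k, - (pi / 2), a k *\<^sub>R sin_coeff u k)]) [0..<N])) (t, x)"
proof -
  have "flat_waves r \<tau> (concat (map (\<lambda>k. [(1, m k, 0, a k *\<^sub>R cos_coeff u k), (1, m k, - (pi / 2), a k *\<^sub>R sin_coeff u k)]) ks)) (t, x)
    = (\<Sum>k\<leftarrow>ks. flat_exp 1 (r * (\<tau> - t)) *\<^sub>R a k *\<^sub>R (cos (m k \<bullet> x) *\<^sub>R cos_coeff u k + sin (m k \<bullet> x) *\<^sub>R sin_coeff u k))" for ks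
    by (induction ks) (simp_all add: flat_waves_def algebra_simps cos_diff)
  then show ?thesis
    by (simp add: mollify_def scaleR_sum_right interv_sum_list_conv_sum_set_nat atLeast0LessThan)
qed

lemma partial_scaled_mollify: "partial j (\<lambda>x. c *\<^sub>R mollify u x) x = c *\<^sub>R partial j (mollify u) x"
proof -
  have "mollify u differentiable (at x)" using mollify_has_derivative differentiableI by blast
  then have d: "(mollify u has_derivative frechet_derivative (mollify u) (at x)) (at x)"
    by (simp add: frechet_derivative_works)
  show ?thesis unfolding partial_def
    using frechet_derivative_at[OF has_derivative_scaleR_right[OF d, of c], symmetric] by simp
qed

lemma test_function:
  assumes T: "T > 0" and \<tau>: "\<tau> < T" and r: "r > 0" and t: "transversal u"
  shows "(\<lambda>t x. flat_exp 1 (r * (\<tau> - t)) *\<^sub>R mollify u x) \<in> test_functions T"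
  unfolding test_functions_def mem_Collect_eq
proof (intro conjI ballI allI)
  show "smooth_on ({0..<T} \<times> UNIV) (\<lambda>(t, x). flat_exp 1 (r * (\<tau> - t)) *\<^sub>R mollify u x)"
    unfolding mollify_flat_waves using flat_waves_smooth[OF T] by (simp add: split_beta)
  show "periodic (\<lambda>x. flat_exp 1 (r * (\<tau> - t)) *\<^sub>R mollify u x)" for t
    using periodic_mollify[of u] by (simp add: periodic_def)
  show "\<exists>\<sigma><T. \<forall>t x. \<sigma> < t \<and> 0 \<le> t \<and> t < T \<longrightarrow> flat_exp 1 (r * (\<tau> - t)) *\<^sub>R mollify u x = 0"
    by (rule exI[of _ \<tau>]) (use \<tau> r in \<open>auto simp: flat_exp_def mult_le_0_iff\<close>)
  show "divergence (\<lambda>x. flat_exp 1 (r * (\<tau> - t)) *\<^sub>R mollify u x) x = 0" for t x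
  proof -
    have "divergence (\<lambda>x. flat_exp 1 (r * (\<tau> - t)) *\<^sub>R mollify u x) x = flat_exp 1 (r * (\<tau> - t)) * divergence (mollify u) x"
      unfolding divergence_def partial_scaled_mollify by (simp add: sum_distrib_left)
    then show ?thesis using divergence_mollify[OF t] by simp
  qed
qed

lemma time_deriv_test_function:
  "time_deriv (\<lambda>t x. flat_exp 1 (r * (\<tau> - t)) *\<^sub>R mollify u x) t x =
     (- r * flat_exp (flat_deriv 1) (r * (\<tau> - t))) *\<^sub>R mollify u x"
proof -
  have "((\<lambda>t. flat_exp 1 (r * (\<tau> - t))) has_real_derivative flat_exp (flat_deriv 1) (r * (\<tau> - t)) * (- r)) (at t)"
    by (rule DERIV_chain2[OF flat_exp_has_derivative]) (auto intro!: derivative_eq_intros)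
  then have "((\<lambda>t. flat_exp 1 (r * (\<tau> - t)) *\<^sub>R mollify u x) has_vector_derivative
     (flat_exp (flat_deriv 1) (r * (\<tau> - t)) * (- r)) *\<^sub>R mollify u x) (at t)"
    by (auto intro!: derivative_eq_intros)
  then show ?thesis unfolding time_deriv_def by (simp add: vector_derivative_at mult.commute)
qed

lemma convective_form_scaled_mollify:
  "convective_form v (\<lambda>x. c *\<^sub>R mollify u x) = c * convective_form v (mollify u)"
  unfolding convective_form_def partial_scaled_mollify
  by (simp add: sum_distrib_left mult.left_commute flip: integral_mult_right_zero)

end

section \<open>The weak formulation integrated in time\<close>

lemma integrable_time_continuous:
  fixes f :: "real \<Rightarrow> real"
  assumes "continuous_on {0..T} f"
  shows "integrable (lebesgue_on {0<..<T}) f" "(\<integral>t. f t \<partial>lebesgue_on {0<..<T}) = integral {0..T} f"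
proof -
  have "set_integrable lebesgue {0<..<T} f"
    by (rule set_integrable_subset[OF absolutely_integrable_continuous_real[OF assms]]) auto
  then show *: "integrable (lebesgue_on {0<..<T}) f"
    by (simp add: integrable_restrict_space set_integrable_def)
  show "(\<integral>t. f t \<partial>lebesgue_on {0<..<T}) = integral {0..T} f"
    using lebesgue_integral_eq_integral[OF *] by (simp add: integral_open_interval_real)
qed

text \<open>The kernels \<open>k n\<close> are minus the time derivatives of the cutoffs.  They are non-negative with total mass
  tending to one, and at times before \<open>\<tau> - \<delta>\<close> they are at most \<open>1 / ((n + 1) \<delta>\<^sup>2)\<close>; after \<open>\<tau>\<close> they vanish.\<close>

lemma flat_kernel_tendsto:
  fixes G :: "real \<Rightarrow> real"
  assumes G: "continuous_on {0..T} G" and \<tau>: "0 < \<tau>" "\<tau> < T"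
  defines "k \<equiv> \<lambda>n t. real (Suc n) * flat_exp (flat_deriv 1) (real (Suc n) * (\<tau> - t))"
  shows "integrable (lebesgue_on {0<..<T}) (\<lambda>t. k n t * G t)"
    and "(\<lambda>n. \<integral>t. k n t * G t \<partial>lebesgue_on {0<..<T}) \<longlonglongrightarrow> G \<tau>"
proof -
  let ?I = "lebesgue_on {0<..<T}"
  define cut where "cut n t = flat_exp 1 (real (Suc n) * (\<tau> - t))" for n t
  have kc: "continuous_on A (k n)" for A n
  proof -
    have "continuous_on UNIV (flat_exp (flat_deriv 1))"
      by (rule DERIV_continuous_on[OF has_field_derivative_at_within[OF flat_exp_has_derivative]])
    then have "continuous_on A (\<lambda>t. flat_exp (flat_deriv 1) (real (Suc n) * (\<tau> - t)))"
      by (rule continuous_on_compose2) (intro continuous_intros, simp)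
    then show ?thesis unfolding k_def by (intro continuous_on_mult continuous_on_const)
  qed
  have k0: "0 \<le> k n t" for n t unfolding k_def by (simp add: flat_exp_one)
  have kd: "(cut n has_real_derivative - k n t) (at t within A)" for n t A
  proof -
    have "((\<lambda>t. flat_exp 1 (real (Suc n) * (\<tau> - t))) has_real_derivative
        flat_exp (flat_deriv 1) (real (Suc n) * (\<tau> - t)) * (- real (Suc n))) (at t)"
      by (rule DERIV_chain2[OF flat_exp_has_derivative]) (auto intro!: derivative_eq_intros)
    then show ?thesis unfolding k_def cut_def[abs_def] by (simp add: has_field_derivative_at_within algebra_simps)
  qed
  have cG: "continuous_on {0..T} (\<lambda>t. k n t * (G t - c))" for n c
    by (intro continuous_intros kc G)
  show int: "integrable ?I (\<lambda>t. k n t * G t)" for n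
    using integrable_time_continuous(1)[OF cG[of n 0]] by simp
  have kint: "integrable ?I (k n)" for n by (rule integrable_time_continuous(1)[OF kc])
  have mass: "(\<integral>t. k n t \<partial>?I) = cut n 0" for n
  proof -
    have "((\<lambda>t. - k n t) has_integral cut n T - cut n 0) {0..T}"
      by (rule fundamental_theorem_of_calculus)
         (use \<tau> kd in \<open>auto simp: has_real_derivative_iff_has_vector_derivative[symmetric]\<close>)
    from has_integral_neg[OF this] have "(k n has_integral - (cut n T - cut n 0)) {0..T}" by simp
    then have "integral {0..T} (k n) = cut n 0 - cut n T" by (simp add: integral_unique)
    moreover have "cut n T = 0" unfolding cut_def using \<tau> by (intro flat_exp_one(4)) (auto simp: mult_le_0_iff)
    ultimately show ?thesis using integrable_time_continuous(2)[OF kc[of _ n]] by simp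
  qed
  obtain B where B: "B \<ge> 0" "\<And>t. t \<in> {0..T} \<Longrightarrow> \<bar>G t - G \<tau>\<bar> \<le> B"
  proof -
    have "compact ((\<lambda>t. G t - G \<tau>) ` {0..T})"
      by (intro compact_continuous_image continuous_intros G) auto
    then obtain B where "\<forall>t\<in>{0..T}. \<bar>G t - G \<tau>\<bar> \<le> B"
      using compact_imp_bounded[of "(\<lambda>t. G t - G \<tau>) ` {0..T}"] by (auto simp: bounded_iff)
    then show thesis using that[of B] \<tau> by force
  qed
  have D: "(\<lambda>n. \<integral>t. k n t * (G t - G \<tau>) \<partial>?I) \<longlonglongrightarrow> 0"
  proof (rule LIMSEQ_I)
    fix r :: real assume r: "r > 0"
    define \<epsilon> where "\<epsilon> = r / 2"
    have e: "\<epsilon> > 0" using r by (simp add: \<epsilon>_def)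
    obtain \<delta> where \<delta>: "\<delta> > 0" "\<And>t. t \<in> {0..T} \<Longrightarrow> \<bar>t - \<tau>\<bar> < \<delta> \<Longrightarrow> \<bar>G t - G \<tau>\<bar> \<le> \<epsilon>"
    proof -
      obtain d where "d > 0" "\<forall>t\<in>{0..T}. dist t \<tau> < d \<longrightarrow> dist (G t) (G \<tau>) < \<epsilon>"
        using G \<tau> e unfolding continuous_on_iff by force
      then show thesis using that[of d] by (auto simp: dist_real_def less_imp_le)
    qed
    have far: "k n t \<le> 1 / (real (Suc n) * \<delta>\<^sup>2)" if "t \<le> \<tau> - \<delta>" for n t
    proof -
      have s: "\<tau> - t > 0" "\<delta> \<le> \<tau> - t" using that \<delta>(1) by auto
      have y: "\<not> real (Suc n) * (\<tau> - t) \<le> 0" using s by (simp add: mult_le_0_iff del: of_nat_Suc)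
      have "k n t = real (Suc n) * ((1 / (real (Suc n) * (\<tau> - t)))\<^sup>2 * exp (- (1 / (real (Suc n) * (\<tau> - t)))))"
        unfolding k_def flat_exp_def flat_deriv_def using y by (simp add: power2_eq_square del: of_nat_Suc)
      also have "\<dots> \<le> real (Suc n) * ((1 / (real (Suc n) * (\<tau> - t)))\<^sup>2 * 1)"
        using y by (intro mult_left_mono) auto
      also have "\<dots> = 1 / (real (Suc n) * (\<tau> - t)\<^sup>2)"
      proof -
        have "r * ((1 / (r * y))\<^sup>2 * 1) = 1 / (r * y\<^sup>2)" for r y :: real
          by (simp add: power2_eq_square)
        then show ?thesis .
      qed
      also have "\<dots> \<le> 1 / (real (Suc n) * \<delta>\<^sup>2)"
        using s \<delta>(1) by (intro divide_left_mono mult_left_mono power_mono) auto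
      finally show ?thesis .
    qed
    have pt: "\<bar>k n t * (G t - G \<tau>)\<bar> \<le> \<epsilon> * k n t + B / (real (Suc n) * \<delta>\<^sup>2)" if t: "t \<in> {0..T}" for n t
    proof -
      have nn: "0 \<le> B / (real (Suc n) * \<delta>\<^sup>2)" using B by simp
      consider "\<bar>t - \<tau>\<bar> < \<delta>" | "t \<le> \<tau> - \<delta>" | "t \<ge> \<tau>" by linarith
      then show ?thesis
      proof cases
        case 1
        have "\<bar>k n t * (G t - G \<tau>)\<bar> \<le> k n t * \<epsilon>"
          unfolding abs_mult using k0[of n t] \<delta>(2)[OF t 1] by (intro mult_mono) auto
        then show ?thesis using nn by (simp add: mult.commute)
      next
        case 2
        have "\<bar>k n t * (G t - G \<tau>)\<bar> \<le> 1 / (real (Suc n) * \<delta>\<^sup>2) * B"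
          unfolding abs_mult using k0[of n t] far[OF 2] B(2)[OF t] by (intro mult_mono) auto
        then show ?thesis using e k0[of n t] by (simp add: add_increasing)
      next
        case 3
        have "k n t = 0" unfolding k_def using 3 by (simp add: flat_exp_one(4) mult_nonneg_nonpos)
        then show ?thesis using nn by simp
      qed
    qed
    have bound: "\<bar>\<integral>t. k n t * (G t - G \<tau>) \<partial>?I\<bar> \<le> \<epsilon> + T * B / \<delta>\<^sup>2 * inverse (real (Suc n))" for n
    proof -
      have ci: "integrable ?I (\<lambda>t. c)" for c :: real
        using integrable_time_continuous(1)[of T "\<lambda>_. c"] by simp
      have cv: "(\<integral>t. c \<partial>?I) = T * c" for c :: real
        using integrable_time_continuous(2)[of T "\<lambda>_. c"] \<tau> by simp
      have "norm (\<integral>t. k n t * (G t - G \<tau>) \<partial>?I) \<le> (\<integral>t. \<epsilon> * k n t + B / (real (Suc n) * \<delta>\<^sup>2) \<partial>?I)"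
        using integrable_time_continuous(1)[OF cG] kint ci pt
        by (intro Bochner_Integration.integral_norm_bound_integral Bochner_Integration.integrable_add integrable_mult_right) auto
      also have "\<dots> = \<epsilon> * cut n 0 + T * (B / (real (Suc n) * \<delta>\<^sup>2))"
        using kint ci by (simp add: mass cv del: of_nat_Suc lebesgue_integral_const)
      also have "\<epsilon> * cut n 0 \<le> \<epsilon>" unfolding cut_def using e flat_exp_one(1) by (simp add: mult_left_le)
      finally show ?thesis by (simp add: divide_inverse ac_simps del: of_nat_Suc)
    qed
    have "(\<lambda>n. \<epsilon> + T * B / \<delta>\<^sup>2 * inverse (real (Suc n))) \<longlonglongrightarrow> \<epsilon> + T * B / \<delta>\<^sup>2 * 0"
      by (intro tendsto_intros LIMSEQ_inverse_real_of_nat)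
    then have "\<forall>\<^sub>F n in sequentially. \<epsilon> + T * B / \<delta>\<^sup>2 * inverse (real (Suc n)) < r"
      by (rule order_tendstoD(2)) (use r in \<open>simp add: \<epsilon>_def\<close>)
    then obtain n0 where "\<And>n. n \<ge> n0 \<Longrightarrow> \<epsilon> + T * B / \<delta>\<^sup>2 * inverse (real (Suc n)) < r"
      unfolding eventually_sequentially by blast
    then show "\<exists>n0. \<forall>n\<ge>n0. norm ((\<integral>t. k n t * (G t - G \<tau>) \<partial>?I) - 0) < r"
      using bound by (intro exI[of _ n0]) (auto intro: le_less_trans)
  qed
  have chi: "(\<lambda>n. cut n 0) \<longlonglongrightarrow> 1"
    using flat_exp_one_scaled_tendsto[of \<tau>] \<tau> unfolding cut_def by simp
  have "(\<integral>t. k n t * G t \<partial>?I) = (\<integral>t. k n t * (G t - G \<tau>) \<partial>?I) + cut n 0 * G \<tau>" for n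
    using int[of n] kint[of n] by (simp add: right_diff_distrib mass)
  then show "(\<lambda>n. \<integral>t. k n t * G t \<partial>?I) \<longlonglongrightarrow> G \<tau>"
    using tendsto_add[OF D tendsto_mult_right[OF chi, of "G \<tau>"]] by simp
qed

lemma borel_measurable_lebesgue_AE_eq:
  fixes f g :: "'a::euclidean_space \<Rightarrow> 'b::topological_space"
  assumes g: "g \<in> borel_measurable lebesgue" and ae: "AE x in lebesgue. f x = g x"
  shows "f \<in> borel_measurable lebesgue"
proof (rule measurableI)
  fix A :: "'b set" assume A: "A \<in> sets borel"
  have gA: "g -` A \<inter> space lebesgue \<in> sets lebesgue" by (rule measurable_sets[OF g A])
  show "f -` A \<inter> space lebesgue \<in> sets lebesgue"
  proof (rule completion.in_sets_AE[OF _ gA])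
    show "AE x in lebesgue. (x \<in> g -` A \<inter> space lebesgue) = (x \<in> f -` A \<inter> space lebesgue)"
      using ae by eventually_elim auto
  qed auto
qed simp

lemma lebesgue_measurable_borel_version:
  fixes F :: "'a::euclidean_space \<Rightarrow> real ^ 3"
  assumes F: "F \<in> borel_measurable lebesgue"
  obtains F' where "F' \<in> borel_measurable borel" "AE z in lborel. F z = F' z"
proof -
  have "\<exists>g. g \<in> borel_measurable lborel \<and> (AE z in lborel. F z $ i = g z)" for i
  proof -
    have "(\<lambda>z. F z $ i) \<in> borel_measurable lebesgue" by (rule measurable_compose[OF F]) (intro borel_measurable_continuous_onI continuous_intros)
    from completion_ex_borel_measurable_real[OF this] show ?thesis by blast
  qed
  then obtain g where g: "\<And>i. g i \<in> borel_measurable lborel" "\<And>i. AE z in lborel. F z $ i = g i z" by metis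
  have gb: "g i \<in> borel_measurable borel" for i using g(1) by simp
  show thesis
  proof (rule that[of "\<lambda>z. \<Sum>i\<in>UNIV. g i z *\<^sub>R (axis i 1 :: real ^ 3)"])
    show "(\<lambda>z. \<Sum>i\<in>UNIV. g i z *\<^sub>R (axis i 1 :: real ^ 3)) \<in> borel_measurable borel"
      by (intro borel_measurable_sum borel_measurable_scaleR gb borel_measurable_const)
    have "AE z in lborel. \<forall>i\<in>(UNIV :: 3 set). F z $ i = g i z"
      by (rule AE_finite_allI) (use g(2) in auto)
    then show "AE z in lborel. F z = (\<Sum>i\<in>UNIV. g i z *\<^sub>R (axis i 1 :: real ^ 3))"
      by eventually_elim (simp add: vec_eq_iff forall_3 sum_3 axis_def)
  qed
qed

text \<open>Fubini's theorem on the measurability of integrals concerns product measurable functions, whereas \<open>v\<close> is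
  measurable for the completed measure.  A Borel version of \<open>v\<close> agrees with \<open>v\<close> at almost every time almost
  everywhere in space, and completeness transfers measurability back.\<close>

lemma measurable_torus_integral_in_time:
  fixes v :: "real \<Rightarrow> real ^ 3 \<Rightarrow> real ^ 3" and \<Phi> :: "(real ^ 3) \<times> (real ^ 3) \<Rightarrow> real"
  assumes v: "(\<lambda>(t, x). v t x) \<in> borel_measurable (lebesgue_on ({0<..<T} \<times> UNIV))"
    and \<Phi>: "\<Phi> \<in> borel_measurable borel"
  shows "(\<lambda>t. \<integral>x. \<Phi> (x, v t x) \<partial>torus) \<in> borel_measurable (lebesgue_on {0<..<T})"
proof -
  let ?S = "{0<..<T} \<times> (UNIV :: (real ^ 3) set)"
  have "?S \<in> sets lborel" using borel_open[OF open_Times[of "{0<..<T}" "UNIV :: (real ^ 3) set"]] by simp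
  then have S: "?S \<in> sets lebesgue" by (rule sets_completionI_sets)
  have "(\<lambda>z. indicator ?S z *\<^sub>R (case z of (t, x) \<Rightarrow> v t x)) \<in> borel_measurable lebesgue"
    using v S by (subst (asm) borel_measurable_restrict_space_iff) auto
  then obtain F where F [measurable]: "F \<in> borel_measurable borel"
    and ae: "AE z in lborel. indicator ?S z *\<^sub>R (case z of (t, x) \<Rightarrow> v t x) = F z"
    using lebesgue_measurable_borel_version by blast
  have "AE t in lborel. AE x in lborel. indicator ?S (t, x) *\<^sub>R v t x = F (t, x)"
    using lborel_pair.AE_pair[OF ae[folded lborel_prod]] by simp
  then have ae2: "AE t in lborel. t \<in> {0<..<T} \<longrightarrow> (\<integral>x. \<Phi> (x, v t x) \<partial>torus) = (\<integral>x. \<Phi> (x, F (t, x)) \<partial>torus)"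
  proof eventually_elim
    case (elim t)
    show ?case
    proof
      assume t: "t \<in> {0<..<T}"
      have a: "AE x in lebesgue. \<Phi> (x, v t x) = \<Phi> (x, F (t, x))"
        using AE_completion[OF elim] by eventually_elim (use t in \<open>simp add: indicator_def\<close>)
      have m: "(\<lambda>x. \<Phi> (x, F (t, x))) \<in> borel_measurable lebesgue"
      proof (intro measurable_completion)
        have "(\<lambda>x. (x, F (t, x))) \<in> borel \<rightarrow>\<^sub>M borel" by measurable
        from measurable_compose[OF this \<Phi>] show "(\<lambda>x. \<Phi> (x, F (t, x))) \<in> borel_measurable lborel" by simp
      qed
      show "(\<integral>x. \<Phi> (x, v t x) \<partial>torus) = (\<integral>x. \<Phi> (x, F (t, x)) \<partial>torus)"
        by (rule integral_cong_AE[OF borel_measurable_torusI[OF borel_measurable_lebesgue_AE_eq[OF m a]]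
              borel_measurable_torusI[OF m] AE_torusI[OF a]])
    qed
  qed
  have "(\<lambda>t. \<integral>x. \<Phi> (x, F (t, x)) \<partial>torus) \<in> borel_measurable borel"
  proof (rule torus.borel_measurable_lebesgue_integral)
    have [measurable]: "(\<lambda>x. x) \<in> torus \<rightarrow>\<^sub>M borel" using continuous_measurable_torus[of "\<lambda>x. x"] by simp
    have s [measurable]: "snd \<in> borel \<Otimes>\<^sub>M torus \<rightarrow>\<^sub>M borel"
      by (rule measurable_compose[OF measurable_snd continuous_measurable_torus[of "\<lambda>x. x"]]) simp
    have "(\<lambda>z. (snd z, F (fst z, snd z))) \<in> borel \<Otimes>\<^sub>M torus \<rightarrow>\<^sub>M borel" by measurable
    from measurable_compose[OF this \<Phi>]
    show "(\<lambda>(t, x). \<Phi> (x, F (t, x))) \<in> borel_measurable (borel \<Otimes>\<^sub>M torus)" by (simp add: split_beta')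
  qed
  then have "(\<lambda>t. indicator {0<..<T} t *\<^sub>R (\<integral>x. \<Phi> (x, F (t, x)) \<partial>torus)) \<in> borel_measurable lebesgue"
    by (intro measurable_completion) simp
  moreover have "AE t in lebesgue. indicator {0<..<T} t *\<^sub>R (\<integral>x. \<Phi> (x, v t x) \<partial>torus)
        = indicator {0<..<T} t *\<^sub>R (\<integral>x. \<Phi> (x, F (t, x)) \<partial>torus)"
    using AE_completion[OF ae2] by eventually_elim (auto simp: indicator_def)
  ultimately have "(\<lambda>t. indicator {0<..<T} t *\<^sub>R (\<integral>x. \<Phi> (x, v t x) \<partial>torus)) \<in> borel_measurable lebesgue"
    by (rule borel_measurable_lebesgue_AE_eq)
  then show ?thesis by (subst borel_measurable_restrict_space_iff) auto
qed

lemma AE_time: "AE t in lebesgue_on {0<..<T}. 0 < t \<and> t < (T :: real)"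
  using AE_space[of "lebesgue_on {0<..<T}"] by simp

lemma weak_euler_energy_bound:
  assumes "weak_euler_solution T v\<^sub>0 v"
  obtains E where "0 \<le> E" "AE t in lebesgue_on {0<..<T}. v t \<in> H_space \<and> v t \<in> L2_torus \<and> L2_inner (v t) (v t) \<le> E"
proof -
  obtain C where C: "AE t in lebesgue_on {0<..<T}. v t \<in> H_space \<and> L2_norm (v t) \<le> C"
    using assms unfolding weak_euler_solution_def ess_bounded_in_H_def by blast
  from C have "AE t in lebesgue_on {0<..<T}. v t \<in> H_space \<and> v t \<in> L2_torus \<and> L2_inner (v t) (v t) \<le> C\<^sup>2"
    by eventually_elim (auto simp: H_space_def L2_inner_le_square)
  then show thesis using that[of "C\<^sup>2"] by simp
qed

lemma representativeD:
  assumes "weakly_continuous_representative T v\<^sub>0 v w"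
  shows "AE t in lebesgue_on {0<..<T}. AE x in lebesgue. w t x = v t x"
    and "t \<in> {0..T} \<Longrightarrow> w t \<in> L2_torus"
    and "\<psi> \<in> L2_torus \<Longrightarrow> continuous_on {0..T} (\<lambda>t. L2_inner (w t) \<psi>)"
    and "AE x in lebesgue. w 0 x = v\<^sub>0 x"
  using assms by (auto simp: weakly_continuous_representative_def)

context cosine_kernel
begin

definition cos_flux :: "(real ^ 3 \<Rightarrow> real ^ 3) \<Rightarrow> nat \<Rightarrow> real ^ 3" where
  "cos_flux u k = (\<integral>x. (cos (m k \<bullet> x) * (m k \<bullet> u x)) *\<^sub>R u x \<partial>torus)"

definition sin_flux :: "(real ^ 3 \<Rightarrow> real ^ 3) \<Rightarrow> nat \<Rightarrow> real ^ 3" where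
  "sin_flux u k = (\<integral>x. (sin (m k \<bullet> x) * (m k \<bullet> u x)) *\<^sub>R u x \<partial>torus)"

lemma flux_mode_integrable:
  assumes u: "u \<in> L2_torus" and c: "continuous_on UNIV c" "\<And>x. \<bar>c x\<bar> \<le> (1::real)"
  shows "integrable torus (\<lambda>x. (c x * (m k \<bullet> u x)) *\<^sub>R u x)"
    and "norm (\<integral>x. (c x * (m k \<bullet> u x)) *\<^sub>R u x \<partial>torus) \<le> norm (m k) * L2_inner u u"
proof -
  note [measurable] = L2_torusD(2)[OF u] continuous_measurable_torus[OF c(1)]
  have pt: "norm ((c x * (m k \<bullet> u x)) *\<^sub>R u x) \<le> norm (m k) * (norm (u x))\<^sup>2" for x
  proof -
    have "norm ((c x * (m k \<bullet> u x)) *\<^sub>R u x) \<le> (1 * (norm (m k) * norm (u x))) * norm (u x)"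
      unfolding norm_scaleR abs_mult
      by (intro mult_right_mono mult_mono c(2) Cauchy_Schwarz_ineq2) auto
    then show ?thesis by (simp add: power2_eq_square mult.assoc)
  qed
  have i: "integrable torus (\<lambda>x. norm (m k) * (norm (u x))\<^sup>2)" using L2_torusD(3)[OF u] by simp
  show *: "integrable torus (\<lambda>x. (c x * (m k \<bullet> u x)) *\<^sub>R u x)"
    by (rule Bochner_Integration.integrable_bound[OF i]) (use pt in \<open>auto intro!: AE_I2 order.trans[OF pt]\<close>)
  have "norm (\<integral>x. (c x * (m k \<bullet> u x)) *\<^sub>R u x \<partial>torus) \<le> (\<integral>x. norm (m k) * (norm (u x))\<^sup>2 \<partial>torus)"
    by (intro Bochner_Integration.integral_norm_bound_integral * i pt)
  then show "norm (\<integral>x. (c x * (m k \<bullet> u x)) *\<^sub>R u x \<partial>torus) \<le> norm (m k) * L2_inner u u"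
    by (simp add: L2_inner_self)
qed

lemma convective_form_modes:
  assumes u: "u \<in> L2_torus"
  shows "convective_form u (mollify w) = (\<Sum>k<N. a k * (cos_flux u k \<bullet> sin_coeff w k - sin_flux u k \<bullet> cos_coeff w k))"
proof -
  have eq: "(\<Sum>i\<in>UNIV. \<Sum>j\<in>UNIV. u x $ i * u x $ j * partial j (mollify w) x $ i)
    = (\<Sum>k<N. a k * (((cos (m k \<bullet> x) * (m k \<bullet> u x)) *\<^sub>R u x) \<bullet> sin_coeff w k
        - ((sin (m k \<bullet> x) * (m k \<bullet> u x)) *\<^sub>R u x) \<bullet> cos_coeff w k))" for x
  proof -
    have "(\<Sum>i\<in>UNIV. \<Sum>j\<in>UNIV. u x $ i * u x $ j * partial j (mollify w) x $ i)
      = (\<Sum>k<N. (\<Sum>i\<in>UNIV. \<Sum>j\<in>UNIV. u x $ i * u x $ j * ((a k * m k $ j) *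
         (cos (m k \<bullet> x) * sin_coeff w k $ i - sin (m k \<bullet> x) * cos_coeff w k $ i))))"
      unfolding partial_mollify_modes by (simp add: sum_3 sum_distrib_left sum.distrib)
    also have "\<dots> = (\<Sum>k<N. a k * (((cos (m k \<bullet> x) * (m k \<bullet> u x)) *\<^sub>R u x) \<bullet> sin_coeff w k
        - ((sin (m k \<bullet> x) * (m k \<bullet> u x)) *\<^sub>R u x) \<bullet> cos_coeff w k))"
    proof (rule sum.cong[OF refl])
      fix k
      have "(\<Sum>i\<in>UNIV. \<Sum>j\<in>UNIV. u x $ i * u x $ j * ((a k * m k $ j) * (c * S $ i - s * C $ i)))
        = a k * ((c * (m k \<bullet> u x)) * (u x \<bullet> S) - (s * (m k \<bullet> u x)) * (u x \<bullet> C))" for c s :: real and C S :: "real ^ 3"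
        by (simp add: sum_3 inner_vec_def algebra_simps)
      from this[of "cos (m k \<bullet> x)" "sin_coeff w k" "sin (m k \<bullet> x)" "cos_coeff w k"]
      show "(\<Sum>i\<in>UNIV. \<Sum>j\<in>UNIV. u x $ i * u x $ j * ((a k * m k $ j) *
         (cos (m k \<bullet> x) * sin_coeff w k $ i - sin (m k \<bullet> x) * cos_coeff w k $ i))) =
        a k * (((cos (m k \<bullet> x) * (m k \<bullet> u x)) *\<^sub>R u x) \<bullet> sin_coeff w k
        - ((sin (m k \<bullet> x) * (m k \<bullet> u x)) *\<^sub>R u x) \<bullet> cos_coeff w k)" by simp
    qed
    finally show ?thesis .
  qed
  have i: "integrable torus (\<lambda>x. (cos (m k \<bullet> x) * (m k \<bullet> u x)) *\<^sub>R u x)"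
    "integrable torus (\<lambda>x. (sin (m k \<bullet> x) * (m k \<bullet> u x)) *\<^sub>R u x)" for k
    by (rule flux_mode_integrable(1)[OF u]; auto intro!: continuous_intros)+
  show ?thesis unfolding convective_form_def eq cos_flux_def sin_flux_def
    using i by (simp add: integral_inner_left integrable_inner_left del: inner_scaleR_left)
qed

text \<open>Bounds the supremum of the gradient of the mollified field, up to a constant.\<close>

definition coeff_size :: "(real ^ 3 \<Rightarrow> real ^ 3) \<Rightarrow> real" where
  "coeff_size w = (\<Sum>k<N. \<bar>a k\<bar> * norm (m k) * (norm (cos_coeff w k) + norm (sin_coeff w k)))"

lemma convective_form_bound:
  assumes u: "u \<in> L2_torus"
  shows "\<bar>convective_form u (mollify w)\<bar> \<le> L2_inner u u * coeff_size w"
proof -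
  have f: "norm (cos_flux u k) \<le> norm (m k) * L2_inner u u" "norm (sin_flux u k) \<le> norm (m k) * L2_inner u u" for k
    unfolding cos_flux_def sin_flux_def
    by (rule flux_mode_integrable(2)[OF u]; auto intro!: continuous_intros)+
  have "\<bar>convective_form u (mollify w)\<bar> \<le> (\<Sum>k<N. \<bar>a k\<bar> * (norm (m k) * L2_inner u u * norm (sin_coeff w k) + norm (m k) * L2_inner u u * norm (cos_coeff w k)))"
    unfolding convective_form_modes[OF u]
  proof (rule order.trans[OF sum_abs sum_mono])
    fix k
    have "\<bar>cos_flux u k \<bullet> sin_coeff w k - sin_flux u k \<bullet> cos_coeff w k\<bar> \<le>
       norm (cos_flux u k) * norm (sin_coeff w k) + norm (sin_flux u k) * norm (cos_coeff w k)"
      by (intro order.trans[OF abs_triangle_ineq4] add_mono Cauchy_Schwarz_ineq2)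
    also have "\<dots> \<le> norm (m k) * L2_inner u u * norm (sin_coeff w k) + norm (m k) * L2_inner u u * norm (cos_coeff w k)"
      by (intro add_mono mult_right_mono f) auto
    finally show "\<bar>a k * (cos_flux u k \<bullet> sin_coeff w k - sin_flux u k \<bullet> cos_coeff w k)\<bar> \<le>
      \<bar>a k\<bar> * (norm (m k) * L2_inner u u * norm (sin_coeff w k) + norm (m k) * L2_inner u u * norm (cos_coeff w k))"
      unfolding abs_mult by (intro mult_left_mono) auto
  qed
  also have "\<dots> = L2_inner u u * coeff_size w"
    unfolding coeff_size_def sum_distrib_left by (intro sum.cong) (auto simp: algebra_simps)
  finally show ?thesis .
qed

text \<open>Test with a cutoff in time that approximates the indicator of \<open>[0, \<tau>)\<close> times the mollified field.
  Along the cutoffs, the term with the time derivative tends to the value at \<open>\<tau>\<close> of the continuous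
  representative, and dominated convergence handles the convective term.\<close>

lemma weak_formulation_integrated:
  assumes T: "T > 0" and \<tau>: "0 \<le> \<tau>" "\<tau> < T" and v0: "v\<^sub>0 \<in> L2_torus"
    and euler: "weak_euler_solution T v\<^sub>0 v" and rep: "weakly_continuous_representative T v\<^sub>0 v w"
    and t: "transversal u"
  shows "integrable (lebesgue_on {0<..<T}) (\<lambda>t. convective_form (v t) (mollify u))"
    and "L2_inner (w \<tau>) (mollify u) - L2_inner v\<^sub>0 (mollify u) =
      (\<integral>t. indicator {..<\<tau>} t * convective_form (v t) (mollify u) \<partial>lebesgue_on {0<..<T})"
proof -
  let ?I = "lebesgue_on {0<..<T}" and ?\<psi> = "mollify u"
  define \<Gamma> where "\<Gamma> t = convective_form (v t) ?\<psi>" for t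
  define G where "G t = L2_inner (w t) ?\<psi>" for t
  have vm: "(\<lambda>(t, x). v t x) \<in> borel_measurable (lebesgue_on ({0<..<T} \<times> UNIV))"
    using euler by (simp add: weak_euler_solution_def)
  have \<Gamma>m [measurable]: "\<Gamma> \<in> borel_measurable ?I"
  proof -
    have "continuous_on UNIV (\<lambda>z :: (real ^ 3) \<times> (real ^ 3). partial j ?\<psi> (fst z) $ i)" for i j
      unfolding partial_mollify_modes by (intro continuous_intros)
    then have "(\<lambda>z :: (real ^ 3) \<times> (real ^ 3). partial j ?\<psi> (fst z) $ i) \<in> borel_measurable borel" for i j
      by (rule borel_measurable_continuous_onI)
    moreover have "(\<lambda>z :: (real ^ 3) \<times> (real ^ 3). snd z $ i) \<in> borel_measurable borel" for i
      by (intro borel_measurable_continuous_onI continuous_intros)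
    ultimately have "(\<lambda>z. \<Sum>i\<in>UNIV. \<Sum>j\<in>UNIV. snd z $ i * snd z $ j * partial j ?\<psi> (fst z) $ i) \<in> borel_measurable borel"
      by (intro borel_measurable_sum borel_measurable_times)
    from measurable_torus_integral_in_time[OF vm this] show ?thesis
      unfolding \<Gamma>_def[abs_def] convective_form_def by simp
  qed
  obtain E where E: "0 \<le> E" "AE t in ?I. v t \<in> H_space \<and> v t \<in> L2_torus \<and> L2_inner (v t) (v t) \<le> E"
    by (rule weak_euler_energy_bound[OF euler])
  note ae = representativeD(1)[OF rep] and wL = representativeD(2)[OF rep]
  have Gc: "continuous_on {0..T} G"
    unfolding G_def by (rule representativeD(3)[OF rep mollify_L2])
  have fin: "integrable ?I (\<lambda>_. c)" for c :: real
    using integrable_time_continuous(1)[of T "\<lambda>_. c"] by simp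
  have \<Gamma>i: "integrable ?I \<Gamma>"
  proof (rule Bochner_Integration.integrable_bound[OF fin \<Gamma>m])
    show "AE t in ?I. norm (\<Gamma> t) \<le> norm (E * coeff_size u)"
      using E(2)
    proof eventually_elim
      case (elim t)
      have "0 \<le> coeff_size u" unfolding coeff_size_def by (intro sum_nonneg) auto
      then have "L2_inner (v t) (v t) * coeff_size u \<le> E * coeff_size u" "0 \<le> E * coeff_size u"
        using elim E(1) by (auto intro: mult_right_mono)
      then show ?case
        using convective_form_bound[of "v t" u] elim unfolding \<Gamma>_def by simp
    qed
  qed
  then show "integrable ?I (\<lambda>t. convective_form (v t) ?\<psi>)" unfolding \<Gamma>_def .
  have Gv: "AE t in ?I. L2_inner (v t) ?\<psi> = G t"
    using ae E(2) AE_time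
  proof eventually_elim
    case (elim t)
    then have "AE x in lebesgue. v t x = w t x" by (auto elim: eventually_mono)
    then show ?case unfolding G_def
      using elim wL[of t] by (intro L2_inner_cong_AE) (auto simp: L2_torusD mollify_L2)
  qed
  show "L2_inner (w \<tau>) ?\<psi> - L2_inner v\<^sub>0 ?\<psi> =
      (\<integral>t. indicator {..<\<tau>} t * convective_form (v t) ?\<psi> \<partial>?I)"
  proof (cases "\<tau> = 0")
    case True
    have "L2_inner (w 0) ?\<psi> = L2_inner v\<^sub>0 ?\<psi>"
      using wL[of 0] v0 T representativeD(4)[OF rep]
      by (intro L2_inner_cong_AE) (auto simp: L2_torusD mollify_L2)
    moreover have "(\<integral>t. indicator {..<\<tau>} t * convective_form (v t) ?\<psi> \<partial>?I) = (\<integral>t. 0 \<partial>?I)"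
      by (rule Bochner_Integration.integral_cong) (auto simp: True)
    ultimately show ?thesis using True by simp
  next
    case False
    then have \<tau>0: "0 < \<tau>" using \<tau> by simp
    define cut where "cut n t = flat_exp 1 (real (Suc n) * (\<tau> - t))" for n t
    define k where "k n t = real (Suc n) * flat_exp (flat_deriv 1) (real (Suc n) * (\<tau> - t))" for n t
    have cutm [measurable]: "cut n \<in> borel_measurable ?I" for n
    proof -
      have "continuous_on UNIV (flat_exp 1)"
        by (rule DERIV_continuous_on[OF has_field_derivative_at_within[OF flat_exp_has_derivative]])
      then have "continuous_on UNIV (\<lambda>t. flat_exp 1 (real (Suc n) * (\<tau> - t)))"
        by (rule continuous_on_compose2) (intro continuous_intros, simp)
      then have "continuous_on UNIV (cut n)"
        unfolding cut_def[abs_def] .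
      then show ?thesis
        by (intro measurable_restrict_space1 measurable_completion) (simp add: borel_measurable_continuous_onI)
    qed
    have bound: "\<bar>cut n t\<bar> \<le> 1" for n t unfolding cut_def using flat_exp_one(1,2) by (simp add: abs_of_nonneg)
    have weak: "- (\<integral>t. k n t * G t \<partial>?I) + (\<integral>t. cut n t * \<Gamma> t \<partial>?I) = - cut n 0 * L2_inner v\<^sub>0 ?\<psi>" for n
    proof -
      let ?\<phi> = "\<lambda>t x. flat_exp 1 (real (Suc n) * (\<tau> - t)) *\<^sub>R ?\<psi> x"
      have "?\<phi> \<in> test_functions T" by (rule test_function[OF T \<tau>(2) _ t]) simp
      then have "(\<integral>t. L2_inner (v t) (time_deriv ?\<phi> t) + convective_form (v t) (?\<phi> t) \<partial>?I) = - L2_inner v\<^sub>0 (?\<phi> 0)"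
        using euler unfolding weak_euler_solution_def by blast
      moreover have "L2_inner (v t) (time_deriv ?\<phi> t) + convective_form (v t) (?\<phi> t) = - k n t * L2_inner (v t) ?\<psi> + cut n t * \<Gamma> t" for t
        unfolding time_deriv_test_function[abs_def] convective_form_scaled_mollify \<Gamma>_def cut_def k_def
        by (simp add: L2_inner_def del: of_nat_Suc)
      moreover have "L2_inner v\<^sub>0 (?\<phi> 0) = cut n 0 * L2_inner v\<^sub>0 ?\<psi>" unfolding cut_def by (simp add: L2_inner_def)
      ultimately have *: "(\<integral>t. - k n t * L2_inner (v t) ?\<psi> + cut n t * \<Gamma> t \<partial>?I) = - (cut n 0 * L2_inner v\<^sub>0 ?\<psi>)"
        by simp
      have i1: "integrable ?I (\<lambda>t. k n t * G t)"
        using flat_kernel_tendsto(1)[OF Gc \<tau>0 \<tau>(2)] unfolding k_def .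
      have i2: "integrable ?I (\<lambda>t. cut n t * \<Gamma> t)"
        by (rule Bochner_Integration.integrable_bound[OF \<Gamma>i]) (use bound in \<open>auto simp: abs_mult intro!: AE_I2 mult_left_le_one_le\<close>)
      have e: "AE t in ?I. - (k n t * G t) + cut n t * \<Gamma> t = - k n t * L2_inner (v t) ?\<psi> + cut n t * \<Gamma> t"
        using Gv by eventually_elim simp
      have ii: "integrable ?I (\<lambda>t. - (k n t * G t) + cut n t * \<Gamma> t)" using i1 i2 by simp
      have "(\<integral>t. - (k n t * G t) + cut n t * \<Gamma> t \<partial>?I) = (\<integral>t. - k n t * L2_inner (v t) ?\<psi> + cut n t * \<Gamma> t \<partial>?I)"
      proof (rule integral_cong_AE[OF borel_measurable_integrable[OF ii] _ e])
        have "(\<lambda>t. indicator {0<..<T} t *\<^sub>R (- (k n t * G t) + cut n t * \<Gamma> t)) \<in> borel_measurable lebesgue"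
          using borel_measurable_integrable[OF ii] by (subst (asm) borel_measurable_restrict_space_iff) auto
        then have "(\<lambda>t. indicator {0<..<T} t *\<^sub>R (- k n t * L2_inner (v t) ?\<psi> + cut n t * \<Gamma> t)) \<in> borel_measurable lebesgue"
          by (rule borel_measurable_lebesgue_AE_eq)
             (use e in \<open>auto simp: AE_restrict_space_iff indicator_def elim: eventually_mono\<close>)
        then show "(\<lambda>t. - k n t * L2_inner (v t) ?\<psi> + cut n t * \<Gamma> t) \<in> borel_measurable ?I"
          by (subst borel_measurable_restrict_space_iff) auto
      qed
      then show ?thesis using * i1 i2 by simp
    qed
    have "(\<lambda>n. \<integral>t. cut n t * \<Gamma> t \<partial>?I) \<longlonglongrightarrow> (\<integral>t. indicator {..<\<tau>} t * \<Gamma> t \<partial>?I)"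
    proof (rule integral_dominated_convergence[where w = "\<lambda>t. \<bar>\<Gamma> t\<bar>"])
      show "integrable ?I (\<lambda>t. \<bar>\<Gamma> t\<bar>)" using \<Gamma>i by simp
      show "AE t in ?I. (\<lambda>n. cut n t * \<Gamma> t) \<longlonglongrightarrow> indicator {..<\<tau>} t * \<Gamma> t"
      proof (rule AE_I2)
        fix t
        have "(\<lambda>n. cut n t) \<longlonglongrightarrow> indicator {..<\<tau>} t"
          using flat_exp_one_scaled_tendsto[of "\<tau> - t"] unfolding cut_def by (auto simp: indicator_def not_le)
        then show "(\<lambda>n. cut n t * \<Gamma> t) \<longlonglongrightarrow> indicator {..<\<tau>} t * \<Gamma> t" by (rule tendsto_mult_right)
      qed
      show "AE t in ?I. norm (cut n t * \<Gamma> t) \<le> \<bar>\<Gamma> t\<bar>" for n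
        by (rule AE_I2) (use bound in \<open>auto simp: abs_mult intro!: mult_left_le_one_le\<close>)
      have "(\<lambda>t. indicator {..<\<tau>} t :: real) \<in> borel_measurable ?I"
        by (intro measurable_restrict_space1 measurable_completion) simp
      then show "(\<lambda>t. indicator {..<\<tau>} t * \<Gamma> t) \<in> borel_measurable ?I" by measurable
    qed measurable
    moreover have "(\<lambda>n. - (\<integral>t. k n t * G t \<partial>?I)) \<longlonglongrightarrow> - G \<tau>"
      using tendsto_minus[OF flat_kernel_tendsto(2)[OF Gc \<tau>0 \<tau>(2)]] unfolding k_def .
    ultimately have "(\<lambda>n. - cut n 0 * L2_inner v\<^sub>0 ?\<psi>) \<longlonglongrightarrow> - G \<tau> + (\<integral>t. indicator {..<\<tau>} t * \<Gamma> t \<partial>?I)"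
      unfolding weak[symmetric] by (intro tendsto_add)
    moreover have "(\<lambda>n. - cut n 0 * L2_inner v\<^sub>0 ?\<psi>) \<longlonglongrightarrow> - 1 * L2_inner v\<^sub>0 ?\<psi>"
      using flat_exp_one_scaled_tendsto[of \<tau>] \<tau>0 unfolding cut_def by (intro tendsto_mult tendsto_minus tendsto_const) simp
    ultimately have "- G \<tau> + (\<integral>t. indicator {..<\<tau>} t * \<Gamma> t \<partial>?I) = - 1 * L2_inner v\<^sub>0 ?\<psi>"
      by (rule LIMSEQ_unique)
    then show ?thesis unfolding G_def \<Gamma>_def by simp
  qed
qed

end

section \<open>Conservation of energy\<close>

text \<open>A set of full measure is dense.\<close>

lemma AE_le_imp_le_continuous:
  fixes G :: "real \<Rightarrow> real"
  assumes G: "continuous_on {0..T} G" and T: "T > 0" and ae: "AE t in lebesgue_on {0<..<T}. G t \<le> c"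
    and t: "t \<in> {0..T}"
  shows "G t \<le> c"
proof -
  define C where "C = {..0} \<union> {T..} \<union> ({0..T} \<inter> G -` {..c})"
  have "closed ({0..T} \<inter> G -` {..c})"
    by (rule continuous_closed_preimage[OF G closed_atLeastAtMost closed_atMost])
  then have cl: "closed C" unfolding C_def by (intro closed_Un) auto
  have "AE t in lebesgue. t \<in> {0<..<T} \<longrightarrow> G t \<le> c"
    using ae by (simp add: AE_restrict_space_iff)
  then have "AE t in lebesgue. t \<in> C"
    by eventually_elim (auto simp: C_def)
  then have all: "s \<in> C" for s by (rule mem_closed_if_AE_lebesgue[OF cl])
  have "G s \<le> c" if "s \<in> {0<..<T}" for s
    using all[of s] that by (auto simp: C_def)
  moreover have "closure {0<..<T} = {0..T}" using T by (rule closure_greaterThanLessThan)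
  ultimately show ?thesis using G t continuous_le_on_closure[of "{0<..<T}" G t c] by auto
qed

text \<open>Along a uniform partition of \<open>[0, t]\<close> the bounds for the pieces add up, with total error \<open>\<eta> t\<close>.\<close>

lemma increment_bound_of_local_bounds:
  fixes g \<Phi> :: "real \<Rightarrow> real"
  assumes loc: "\<And>\<eta>. \<eta> > 0 \<Longrightarrow> \<exists>\<delta>>0. \<forall>s t. 0 \<le> s \<and> s \<le> t \<and> t < T \<and> t - s < \<delta> \<longrightarrow> \<bar>g t - g s\<bar> \<le> \<Phi> t - \<Phi> s + \<eta> * (t - s)"
    and t: "0 \<le> t" "t < T"
  shows "\<bar>g t - g 0\<bar> \<le> \<Phi> t - \<Phi> 0"
proof (rule field_le_epsilon)
  fix e :: real assume e: "e > 0"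
  define \<eta> where "\<eta> = e / (t + 1)"
  have eta: "\<eta> > 0" using e t by (simp add: \<eta>_def)
  obtain \<delta> where \<delta>: "\<delta> > 0" "\<And>s t. 0 \<le> s \<Longrightarrow> s \<le> t \<Longrightarrow> t < T \<Longrightarrow> t - s < \<delta> \<Longrightarrow> \<bar>g t - g s\<bar> \<le> \<Phi> t - \<Phi> s + \<eta> * (t - s)"
    using loc[OF eta] by blast
  obtain N :: nat where N: "t / \<delta> < real N" using reals_Archimedean2 by blast
  then have N0: "N > 0" using t \<delta>(1) by (metis divide_nonneg_pos not_less of_nat_0 gr0I)
  define h where "h = t / real N"
  have h: "0 \<le> h" "h < \<delta>" "real N * h = t"
    using N N0 t \<delta>(1) by (auto simp: h_def field_simps)
  have "\<bar>g (real i * h) - g 0\<bar> \<le> \<Phi> (real i * h) - \<Phi> 0 + \<eta> * (real i * h)" if "i \<le> N" for i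
    using that
  proof (induction i)
    case (Suc i)
    have le: "real (Suc i) * h \<le> t"
      using Suc.prems h by (metis mult_right_mono of_nat_le_iff)
    have "\<bar>g (real (Suc i) * h) - g (real i * h)\<bar> \<le> \<Phi> (real (Suc i) * h) - \<Phi> (real i * h) + \<eta> * (real (Suc i) * h - real i * h)"
      by (rule \<delta>(2)) (use h le t in \<open>auto simp: algebra_simps\<close>)
    moreover have "\<bar>g (real i * h) - g 0\<bar> \<le> \<Phi> (real i * h) - \<Phi> 0 + \<eta> * (real i * h)"
      using Suc by simp
    ultimately show ?case by (simp add: right_diff_distrib)
  qed simp
  from this[of N] have "\<bar>g t - g 0\<bar> \<le> \<Phi> t - \<Phi> 0 + \<eta> * t" using h by simp
  also have "\<eta> * t \<le> e" using e t by (simp add: \<eta>_def field_simps)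
  finally show "\<bar>g t - g 0\<bar> \<le> \<Phi> t - \<Phi> 0 + e" by simp
qed

text \<open>The wave is the gradient of \<open>sin (m \<cdot> x + c)\<close>, so this is integration by parts against a
  divergence-free field.  The phase \<open>c\<close> covers sines and cosines at once.\<close>

lemma solenoidal_orthogonal_gradient:
  assumes psi: "\<psi> \<in> solenoidal_fields" and m: "\<And>i. m $ i \<in> \<int>"
  shows "L2_inner \<psi> (\<lambda>x. cos (m \<bullet> x + c) *\<^sub>R m) = 0"
proof -
  have per: "periodic \<psi>" and sm: "smooth_on UNIV \<psi>" and div: "\<And>x. divergence \<psi> x = 0"
    using psi by (auto simp: solenoidal_fields_def)
  have C1: "C_k_on (Suc 0) UNIV \<psi>" and C0: "C_k_on 0 UNIV \<psi>" using sm unfolding smooth_on_def by blast+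
  have cont: "continuous_on UNIV \<psi>" using C0 by simp
  have der: "(\<psi> has_derivative frechet_derivative \<psi> (at x)) (at x)" for x
    using C1 by (simp add: differentiable_on_def frechet_derivative_works)
  have pc: "continuous_on UNIV (partial i \<psi>)" for i
  proof -
    have "axis i 1 \<in> (Basis :: (real ^ 3) set)" by (auto simp: Basis_vec_def)
    then show ?thesis using C1 by (simp add: partial_def[abs_def])
  qed
  define D where "D i x = partial i \<psi> x $ i * sin (m \<bullet> x + c) + \<psi> x $ i * (cos (m \<bullet> x + c) * m $ i)" for i x
  have Dc: "continuous_on UNIV (D i)" for i
    unfolding D_def by (intro continuous_intros pc cont)
  have zero: "(\<integral>x. D i x \<partial>torus) = 0" for i
  proof (rule torus_integral_partial_derivative[where F = "\<lambda>x. \<psi> x $ i * sin (m \<bullet> x + c)" and i = i, OF _ _ _ Dc])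
    show "continuous_on UNIV (\<lambda>x. \<psi> x $ i * sin (m \<bullet> x + c))" by (intro continuous_intros cont)
    show "periodic (\<lambda>x. \<psi> x $ i * sin (m \<bullet> x + c))"
      using per cos_plus_mode[OF m, of _ _ "c - pi / 2"] unfolding periodic_def
      by (simp add: cos_diff algebra_simps)
    fix x
    have "((\<lambda>h. \<psi> (x + axis i h)) has_derivative (\<lambda>h. h *\<^sub>R partial i \<psi> x)) (at 0)"
      unfolding partial_def by (rule has_derivative_along_axis[OF der])
    from bounded_linear.has_derivative[OF bounded_linear_vec_nth this, of i]
    have 1: "((\<lambda>h. \<psi> (x + axis i h) $ i) has_real_derivative partial i \<psi> x $ i) (at 0)"
      by (simp add: has_field_derivative_def mult_commute_abs)
    have 2: "((\<lambda>h. sin (m \<bullet> (x + axis i h) + c)) has_real_derivative cos (m \<bullet> x + c) * m $ i) (at 0)"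
      unfolding inner_add_right inner_axis by (auto intro!: derivative_eq_intros)
    have a0: "x + axis i 0 = x" by (auto simp: vec_eq_iff axis_def)
    show "((\<lambda>h. \<psi> (x + axis i h) $ i * sin (m \<bullet> (x + axis i h) + c)) has_real_derivative D i x) (at 0)"
      using DERIV_mult[OF 1 2] unfolding D_def by (simp add: a0 ac_simps)
  qed
  have "(\<Sum>i\<in>UNIV. D i x) = \<psi> x \<bullet> (cos (m \<bullet> x + c) *\<^sub>R m)" for x
  proof -
    have "(\<Sum>i\<in>UNIV. D i x) = divergence \<psi> x * sin (m \<bullet> x + c) + \<psi> x \<bullet> (cos (m \<bullet> x + c) *\<^sub>R m)"
      unfolding D_def divergence_def by (simp add: sum_3 inner_vec_def algebra_simps)
    then show ?thesis using div by simp
  qed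
  then have "L2_inner \<psi> (\<lambda>x. cos (m \<bullet> x + c) *\<^sub>R m) = (\<integral>x. (\<Sum>i\<in>UNIV. D i x) \<partial>torus)"
    unfolding L2_inner_def by simp
  also have "\<dots> = 0" using zero continuous_integrable_torus[OF Dc] by simp
  finally show ?thesis .
qed

lemma cosine_wave_L2:
  assumes "\<And>i. m $ i \<in> \<int>"
  shows "(\<lambda>x. cos (m \<bullet> x + c) *\<^sub>R e) \<in> L2_torus"
  by (rule L2_torus_continuous) (auto intro!: continuous_intros simp: periodic_def cos_plus_mode[OF assms])

lemma H_space_orthogonal_gradient:
  assumes u: "u \<in> H_space" and m: "\<And>i. m $ i \<in> \<int>"
  shows "L2_inner u (\<lambda>x. cos (m \<bullet> x + c) *\<^sub>R m) = 0"
proof -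
  let ?e = "\<lambda>x. cos (m \<bullet> x + c) *\<^sub>R m"
  have eL: "?e \<in> L2_torus" by (rule cosine_wave_L2[OF m])
  have uL: "u \<in> L2_torus" using u by (simp add: H_space_def)
  define E where "E = L2_inner ?e ?e"
  have E: "E \<ge> 0" unfolding E_def by simp
  have "\<bar>L2_inner u ?e\<bar> \<le> 0"
  proof (rule field_le_epsilon)
    fix r :: real assume r: "r > 0"
    define \<eta> where "\<eta> = r / (1 + E)"
    have eta: "\<eta> > 0" using r E by (simp add: \<eta>_def)
    obtain \<psi> where psi: "\<psi> \<in> solenoidal_fields" "L2_norm (\<lambda>x. u x - \<psi> x) < \<eta>"
      using u eta unfolding H_space_def by blast
    have "continuous_on UNIV \<psi>" "periodic \<psi>"
      using psi(1) unfolding solenoidal_fields_def smooth_on_def by (auto dest: spec[of _ 0])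
    then have psiL: "\<psi> \<in> L2_torus" by (rule L2_torus_continuous)
    define d where "d x = u x - \<psi> x" for x
    have dL: "d \<in> L2_torus" unfolding d_def using L2_torus_diff[OF uL psiL] .
    have "L2_inner u ?e = L2_inner d ?e + L2_inner \<psi> ?e"
      unfolding L2_inner_def d_def inner_diff_left
      using L2_inner_integrable[OF uL eL] L2_inner_integrable[OF psiL eL] by simp
    then have "L2_inner u ?e = L2_inner d ?e" using solenoidal_orthogonal_gradient[OF psi(1) m] by simp
    moreover have "2 * \<bar>L2_inner d ?e\<bar> \<le> 1 / \<eta> * L2_inner d d + E / (1 / \<eta>)"
      unfolding E_def using eta by (intro L2_inner_Young dL eL) auto
    moreover have "L2_inner d d \<le> \<eta>\<^sup>2"
      using psi(2) unfolding d_def[abs_def] by (intro L2_inner_le_square) simp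
    then have "1 / \<eta> * L2_inner d d \<le> \<eta>"
      using eta by (simp add: field_simps power2_eq_square)
    ultimately have "2 * \<bar>L2_inner u ?e\<bar> \<le> \<eta> * (1 + E)" by (simp add: algebra_simps)
    also have "\<dots> = r" using E by (simp add: \<eta>_def)
    finally show "\<bar>L2_inner u ?e\<bar> \<le> 0 + r" using r by simp
  qed
  then show ?thesis by simp
qed

context cosine_kernel
begin

lemma coeff_inner:
  assumes u: "u \<in> L2_torus"
  shows "cos_coeff u k \<bullet> e = L2_inner u (\<lambda>x. cos (m k \<bullet> x + 0) *\<^sub>R e)"
    and "sin_coeff u k \<bullet> e = L2_inner u (\<lambda>x. cos (m k \<bullet> x + - (pi / 2)) *\<^sub>R e)"
  unfolding cos_coeff_def sin_coeff_def L2_inner_def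
  using integrable_mode[OF L2_torusD(4)[OF u], of k]
  by (simp_all add: integral_inner_left[symmetric] cos_diff del: integral_inner_left)

lemma transversal_iff:
  assumes u: "u \<in> L2_torus"
  shows "transversal u \<longleftrightarrow> (\<forall>k. L2_inner u (\<lambda>x. cos (m k \<bullet> x + 0) *\<^sub>R m k) = 0 \<and>
     L2_inner u (\<lambda>x. cos (m k \<bullet> x + - (pi / 2)) *\<^sub>R m k) = 0)"
  unfolding transversal_def coeff_inner[OF u, symmetric] by (simp add: inner_commute)

lemma transversal_H:
  assumes "u \<in> H_space"
  shows "transversal u"
proof -
  have uL: "u \<in> L2_torus" using assms by (simp add: H_space_def)
  show ?thesis unfolding transversal_iff[OF uL]
    by (intro allI conjI H_space_orthogonal_gradient assms integer_modes)
qed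

lemma coeff_cong_AE:
  assumes "u \<in> L2_torus" "u' \<in> L2_torus" "AE x in lebesgue. u x = u' x"
  shows "cos_coeff u k = cos_coeff u' k" "sin_coeff u k = sin_coeff u' k"
proof -
  have "cos_coeff u k \<bullet> e = cos_coeff u' k \<bullet> e" "sin_coeff u k \<bullet> e = sin_coeff u' k \<bullet> e" for e
    unfolding coeff_inner[OF assms(1)] coeff_inner[OF assms(2)]
    by (intro L2_inner_cong_AE assms L2_torusD cosine_wave_L2 integer_modes)+
  then show "cos_coeff u k = cos_coeff u' k" "sin_coeff u k = sin_coeff u' k"
    by (auto intro: vector_eq_rdot[THEN iffD1])
qed

lemma mollified_energy_cong_AE:
  assumes "u \<in> L2_torus" "u' \<in> L2_torus" "AE x in lebesgue. u x = u' x"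
  shows "L2_inner u (mollify u) = L2_inner u' (mollify u')"
  unfolding inner_mollify[OF L2_torusD(4)[OF assms(1)]] inner_mollify[OF L2_torusD(4)[OF assms(2)]]
    coeff_cong_AE[OF assms] ..

lemma coeff_continuous:
  assumes rep: "weakly_continuous_representative T v\<^sub>0 v w"
  shows "continuous_on {0..T} (\<lambda>t. cos_coeff (w t) k)" "continuous_on {0..T} (\<lambda>t. sin_coeff (w t) k)"
proof -
  note wL = representativeD(2)[OF rep]
  have c: "continuous_on {0..T} (\<lambda>t. L2_inner (w t) (\<lambda>x. cos (m k \<bullet> x + c) *\<^sub>R e))" for c e
    by (rule representativeD(3)[OF rep cosine_wave_L2[OF integer_modes]])
  have "continuous_on {0..T} (\<lambda>t. cos_coeff (w t) k \<bullet> e)" "continuous_on {0..T} (\<lambda>t. sin_coeff (w t) k \<bullet> e)" for e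
    by (rule continuous_on_eq[OF c[of 0 e]], simp only: coeff_inner(1)[OF wL])
       (rule continuous_on_eq[OF c[of "- (pi / 2)" e]], simp only: coeff_inner(2)[OF wL])
  then show "continuous_on {0..T} (\<lambda>t. cos_coeff (w t) k)" "continuous_on {0..T} (\<lambda>t. sin_coeff (w t) k)"
    by (auto intro: continuous_on_componentwise[THEN iffD2])
qed

text \<open>The pairing with a wave is continuous in time and vanishes at almost every time.\<close>

lemma transversal_representative:
  assumes T: "T > 0" and euler: "weak_euler_solution T v\<^sub>0 v"
    and rep: "weakly_continuous_representative T v\<^sub>0 v w" and t: "t \<in> {0..T}"
  shows "transversal (w t)"
proof -
  note wL = representativeD(2)[OF rep]
  have "L2_inner (w t) (\<lambda>x. cos (m k \<bullet> x + c) *\<^sub>R m k) = 0" for k c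
  proof -
    let ?e = "\<lambda>x. cos (m k \<bullet> x + c) *\<^sub>R m k"
    have eL: "?e \<in> L2_torus" by (rule cosine_wave_L2[OF integer_modes])
    have cont: "continuous_on {0..T} (\<lambda>t. \<bar>L2_inner (w t) ?e\<bar>)"
      by (intro continuous_intros representativeD(3)[OF rep eL])
    obtain E where "AE s in lebesgue_on {0<..<T}. v s \<in> H_space \<and> v s \<in> L2_torus \<and> L2_inner (v s) (v s) \<le> E"
      by (rule weak_euler_energy_bound[OF euler])
    with representativeD(1)[OF rep] AE_time have "AE s in lebesgue_on {0<..<T}. \<bar>L2_inner (w s) ?e\<bar> \<le> 0"
    proof eventually_elim
      case (elim s)
      have "L2_inner (w s) ?e = L2_inner (v s) ?e"
        using elim wL[of s] by (intro L2_inner_cong_AE L2_torusD eL) auto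
      then show ?case using H_space_orthogonal_gradient[of "v s", OF _ integer_modes] elim by simp
    qed
    from AE_le_imp_le_continuous[OF cont T this t] show ?thesis by simp
  qed
  then show ?thesis using transversal_iff[OF wL[OF t]] by blast
qed

lemma convective_form_mollify_split:
  assumes u: "u \<in> L2_torus"
    and A: "\<And>k. cos_coeff p k = 2 *\<^sub>R cos_coeff q k + cos_coeff d k"
    and B: "\<And>k. sin_coeff p k = 2 *\<^sub>R sin_coeff q k + sin_coeff d k"
  shows "convective_form u (mollify p) = 2 * convective_form u (mollify q) + convective_form u (mollify d)"
  unfolding convective_form_modes[OF u] A B
  by (simp add: sum_distrib_left sum.distrib[symmetric] inner_add_right algebra_simps)

definition coeff_dist :: "(real ^ 3 \<Rightarrow> real ^ 3) \<Rightarrow> (real ^ 3 \<Rightarrow> real ^ 3) \<Rightarrow> real" where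
  "coeff_dist u u' = (\<Sum>k<N. \<bar>a k\<bar> * norm (m k) * (norm (cos_coeff u k - cos_coeff u' k) + norm (sin_coeff u k - sin_coeff u' k)))"

text \<open>The distance is a continuous function of the pair of times on a compact square, and it vanishes on
  the diagonal.\<close>

lemma coeff_dist_uniform:
  assumes rep: "weakly_continuous_representative T v\<^sub>0 v w" and e: "\<eta> > 0"
  obtains \<delta> where "\<delta> > 0" "\<And>s t. s \<in> {0..T} \<Longrightarrow> t \<in> {0..T} \<Longrightarrow> \<bar>t - s\<bar> < \<delta> \<Longrightarrow> coeff_dist (w t) (w s) < \<eta>"
proof -
  let ?S = "{0..T} \<times> {0..T}"
  note cc = continuous_on_compose2[OF coeff_continuous(1)[OF rep]] continuous_on_compose2[OF coeff_continuous(2)[OF rep]]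
  have "continuous_on ?S (\<lambda>z. coeff_dist (w (fst z)) (w (snd z)))"
    unfolding coeff_dist_def
    by (intro continuous_on_sum continuous_on_mult continuous_on_add continuous_on_const continuous_on_norm continuous_on_diff
        cc continuous_on_fst continuous_on_snd continuous_on_id) auto
  then have "uniformly_continuous_on ?S (\<lambda>z. coeff_dist (w (fst z)) (w (snd z)))"
    by (rule compact_uniformly_continuous) (intro compact_Times compact_Icc)
  then obtain d where d: "d > 0" "\<And>y z. y \<in> ?S \<Longrightarrow> z \<in> ?S \<Longrightarrow> dist z y < d \<Longrightarrow>
     dist (coeff_dist (w (fst z)) (w (snd z))) (coeff_dist (w (fst y)) (w (snd y))) < \<eta>"
    using e unfolding uniformly_continuous_on_def by metis
  show thesis
  proof (rule that[OF d(1)])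
    fix s t assume st: "s \<in> {0..T}" "t \<in> {0..T}" "\<bar>t - s\<bar> < d"
    have "dist (t, s) (t, t) < d" using st by (simp add: dist_Pair_Pair dist_real_def)
    then have "dist (coeff_dist (w t) (w s)) (coeff_dist (w t) (w t)) < \<eta>"
      using d(2)[of "(t, t)" "(t, s)"] st by simp
    then show "coeff_dist (w t) (w s) < \<eta>" by (simp add: coeff_dist_def dist_real_def)
  qed
qed

text \<open>On a short interval \<open>[s, t)\<close>, test with the mollification of \<open>w(t) + w(s)\<close>: by symmetry this yields
  exactly the increment of the regularised energy.  On that interval the field is close to \<open>2 w(r)\<close>, so
  the integrand is twice the flux at time \<open>r\<close> up to an error that is small compared with the length
  \<open>t - s\<close>, and the errors disappear as the partition is refined.\<close>

lemma regularized_energy_drift: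
  assumes T: "T > 0" and v0: "v\<^sub>0 \<in> L2_torus"
    and euler: "weak_euler_solution T v\<^sub>0 v" and rep: "weakly_continuous_representative T v\<^sub>0 v w"
    and \<phi>: "integrable (lebesgue_on {0<..<T}) \<phi>" "\<And>r. r \<in> {0<..<T} \<Longrightarrow> 0 \<le> \<phi> r"
    and flux: "AE r in lebesgue_on {0<..<T}. \<bar>convective_form (v r) (mollify (v r))\<bar> \<le> \<phi> r"
    and t: "t \<in> {0..T}"
  shows "\<bar>L2_inner (w t) (mollify (w t)) - L2_inner (w 0) (mollify (w 0))\<bar> \<le> 2 * (\<integral>r. \<phi> r \<partial>lebesgue_on {0<..<T})"
proof -
  let ?I = "lebesgue_on {0<..<T}"
  define g where "g t = L2_inner (w t) (mollify (w t))" for t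
  define \<Phi> where "\<Phi> t = (\<integral>r. indicator {..<t} r * (2 * \<phi> r) \<partial>?I)" for t
  note wL = representativeD(2)[OF rep]
  obtain E where E: "0 \<le> E" "AE t in ?I. v t \<in> H_space \<and> v t \<in> L2_torus \<and> L2_inner (v t) (v t) \<le> E"
    by (rule weak_euler_energy_bound[OF euler])
  have ind: "integrable ?I (\<lambda>r. indicator A r * f r)" if "integrable ?I f" "A \<in> sets borel" for A and f :: "real \<Rightarrow> real"
  proof -
    have fm: "f \<in> borel_measurable ?I" using that by simp
    have "(\<lambda>r. indicator A r :: real) \<in> borel_measurable borel" using that(2) by measurable
    then have im: "(\<lambda>r. indicator A r :: real) \<in> borel_measurable ?I"
      by (intro measurable_restrict_space1 measurable_completion) simp
    show ?thesis
      by (rule Bochner_Integration.integrable_bound[OF that(1) borel_measurable_times[OF im fm]])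
         (auto simp: indicator_def)
  qed
  have one: "integrable ?I (\<lambda>_. c)" for c :: real
    using integrable_time_continuous(1)[of T "\<lambda>_. c"] by simp
  have loc: "\<exists>\<delta>>0. \<forall>s t. 0 \<le> s \<and> s \<le> t \<and> t < T \<and> t - s < \<delta> \<longrightarrow> \<bar>g t - g s\<bar> \<le> \<Phi> t - \<Phi> s + \<eta> * (t - s)"
    if eta: "\<eta> > 0" for \<eta>
  proof -
    \<comment> \<open>the factor 2 is for the two times \<open>s\<close> and \<open>t\<close>; \<open>E + 1\<close> instead of \<open>E\<close> keeps the quotient defined\<close>
    define \<eta>' where "\<eta>' = \<eta> / (2 * (E + 1))"
    have C1: "E + 1 > 0" using E(1) by simp
    have eta': "\<eta>' > 0" using eta C1 by (simp add: \<eta>'_def)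
    obtain \<delta> where \<delta>: "\<delta> > 0" "\<And>s t. s \<in> {0..T} \<Longrightarrow> t \<in> {0..T} \<Longrightarrow> \<bar>t - s\<bar> < \<delta> \<Longrightarrow> coeff_dist (w t) (w s) < \<eta>'"
      using coeff_dist_uniform[OF rep eta'] by blast
    have "\<bar>g t - g s\<bar> \<le> \<Phi> t - \<Phi> s + \<eta> * (t - s)" if st: "0 \<le> s" "s \<le> t" "t < T" "t - s < \<delta>" for s t
    proof -
      have sT: "s \<in> {0..T}" "t \<in> {0..T}" "s < T" using st by auto
      define u where "u x = w t x + w s x" for x
      have ui: "cos_coeff u k = cos_coeff (w t) k + cos_coeff (w s) k" "sin_coeff u k = sin_coeff (w t) k + sin_coeff (w s) k" for k
        unfolding cos_coeff_def sin_coeff_def u_def scaleR_add_right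
        using integrable_mode[OF L2_torusD(4)[OF wL[OF sT(1)]]] integrable_mode[OF L2_torusD(4)[OF wL[OF sT(2)]]]
        by simp_all
      have ut: "transversal u"
        using transversal_representative[OF T euler rep sT(1)] transversal_representative[OF T euler rep sT(2)]
        unfolding transversal_def ui by (simp add: inner_add_right)
      define \<Gamma> where "\<Gamma> r = convective_form (v r) (mollify u)" for r
      have \<Gamma>i: "integrable ?I \<Gamma>"
        using weak_formulation_integrated(1)[OF T _ st(3) v0 euler rep ut] st unfolding \<Gamma>_def by simp
      \<comment> \<open>the pairing \<open>(u, L * u')\<close> is symmetric, so the mixed terms cancel\<close>
      have "g t - g s = L2_inner (w t) (mollify u) - L2_inner (w s) (mollify u)"
        unfolding g_def inner_mollify[OF L2_torusD(4)[OF wL[OF sT(1)]]] inner_mollify[OF L2_torusD(4)[OF wL[OF sT(2)]]] ui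
        by (simp add: sum_subtractf[symmetric] inner_add_right inner_commute algebra_simps)
      also have "\<dots> = (\<integral>r. indicator {..<t} r * \<Gamma> r \<partial>?I) - (\<integral>r. indicator {..<s} r * \<Gamma> r \<partial>?I)"
        using weak_formulation_integrated(2)[OF T _ st(3) v0 euler rep ut] weak_formulation_integrated(2)[OF T _ sT(3) v0 euler rep ut] st
        unfolding \<Gamma>_def by simp
      also have "\<dots> = (\<integral>r. indicator {..<t} r * \<Gamma> r - indicator {..<s} r * \<Gamma> r \<partial>?I)"
        by (intro Bochner_Integration.integral_diff[symmetric] ind \<Gamma>i) auto
      finally have gt: "g t - g s = (\<integral>r. indicator {..<t} r * \<Gamma> r - indicator {..<s} r * \<Gamma> r \<partial>?I)" .
      have "\<bar>g t - g s\<bar> \<le> (\<integral>r. indicator {..<t} r * (2 * \<phi> r) - indicator {..<s} r * (2 * \<phi> r) + \<eta> * indicator {s..<t} r \<partial>?I)"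
        unfolding gt real_norm_def[symmetric]
      proof (rule order.trans[OF integral_norm_bound integral_mono_AE])
        show "integrable ?I (\<lambda>r. norm (indicator {..<t} r * \<Gamma> r - indicator {..<s} r * \<Gamma> r))"
          by (intro integrable_norm Bochner_Integration.integrable_diff ind \<Gamma>i) auto
        have "integrable ?I (\<lambda>r. \<eta> * (indicator {s..<t} r * 1))"
          by (intro integrable_mult_right ind one) auto
        then show "integrable ?I (\<lambda>r. indicator {..<t} r * (2 * \<phi> r) - indicator {..<s} r * (2 * \<phi> r) + \<eta> * indicator {s..<t} r)"
          using \<phi>(1) by (intro Bochner_Integration.integrable_add Bochner_Integration.integrable_diff ind) auto
        show "AE r in ?I. norm (indicator {..<t} r * \<Gamma> r - indicator {..<s} r * \<Gamma> r)
           \<le> indicator {..<t} r * (2 * \<phi> r) - indicator {..<s} r * (2 * \<phi> r) + \<eta> * indicator {s..<t} r"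
          using E(2) representativeD(1)[OF rep] AE_time flux
        proof eventually_elim
          case (elim r)
          show ?case
          proof (cases "r \<in> {s..<t}")
            case False
            then have "r < s \<or> r \<ge> t" by auto
            then show ?thesis using st by (auto simp: indicator_def)
          next
            case True
            have rT: "r \<in> {0..T}" using elim by auto
            have vL: "v r \<in> L2_torus" using elim by simp
            define d where "d x = u x - 2 *\<^sub>R w r x" for x
            have di: "cos_coeff d k = cos_coeff u k - 2 *\<^sub>R cos_coeff (w r) k" "sin_coeff d k = sin_coeff u k - 2 *\<^sub>R sin_coeff (w r) k" for k
            proof -
              have "integrable torus u" unfolding u_def
                using L2_torusD(4)[OF wL[OF sT(1)]] L2_torusD(4)[OF wL[OF sT(2)]] by simp
              then show "cos_coeff d k = cos_coeff u k - 2 *\<^sub>R cos_coeff (w r) k" "sin_coeff d k = sin_coeff u k - 2 *\<^sub>R sin_coeff (w r) k"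
                using integrable_mode[of u] integrable_mode[OF L2_torusD(4)[OF wL[OF rT]]]
                unfolding cos_coeff_def sin_coeff_def d_def scaleR_diff_right scaleR_left_commute[of _ 2]
                by (simp_all del: scaleR_scaleR)
            qed
            have wv: "cos_coeff (w r) k = cos_coeff (v r) k" "sin_coeff (w r) k = sin_coeff (v r) k" for k
              using coeff_cong_AE[OF wL[OF rT] vL] elim by auto
            have "\<Gamma> r = 2 * convective_form (v r) (mollify (v r)) + convective_form (v r) (mollify d)"
              unfolding \<Gamma>_def by (rule convective_form_mollify_split[OF vL]) (simp_all add: di wv)
            then have "\<bar>\<Gamma> r\<bar> \<le> 2 * \<bar>convective_form (v r) (mollify (v r))\<bar> + \<bar>convective_form (v r) (mollify d)\<bar>"
              by linarith
            also have "\<bar>convective_form (v r) (mollify d)\<bar> \<le> L2_inner (v r) (v r) * coeff_size d"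
              by (rule convective_form_bound[OF vL])
            also have "\<dots> \<le> (E + 1) * (2 * \<eta>')"
            proof (rule mult_mono)
              show "L2_inner (v r) (v r) \<le> E + 1" using elim by simp
              have "coeff_size d \<le> coeff_dist (w t) (w r) + coeff_dist (w s) (w r)"
                unfolding coeff_size_def coeff_dist_def sum.distrib[symmetric]
              proof (rule sum_mono)
                fix k
                have e: "p + q - 2 *\<^sub>R r = (p - r) + (q - r)" for p q r :: "real ^ 3"
                  by (simp add: scaleR_2)
                have "norm (cos_coeff d k) + norm (sin_coeff d k) \<le>
                   (norm (cos_coeff (w t) k - cos_coeff (w r) k) + norm (sin_coeff (w t) k - sin_coeff (w r) k)) +
                   (norm (cos_coeff (w s) k - cos_coeff (w r) k) + norm (sin_coeff (w s) k - sin_coeff (w r) k))"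
                  unfolding di ui e
                  using norm_triangle_ineq[of "cos_coeff (w t) k - cos_coeff (w r) k" "cos_coeff (w s) k - cos_coeff (w r) k"]
                    norm_triangle_ineq[of "sin_coeff (w t) k - sin_coeff (w r) k" "sin_coeff (w s) k - sin_coeff (w r) k"]
                  by linarith
                then show "\<bar>a k\<bar> * norm (m k) * (norm (cos_coeff d k) + norm (sin_coeff d k)) \<le>
                   \<bar>a k\<bar> * norm (m k) * (norm (cos_coeff (w t) k - cos_coeff (w r) k) + norm (sin_coeff (w t) k - sin_coeff (w r) k)) +
                   \<bar>a k\<bar> * norm (m k) * (norm (cos_coeff (w s) k - cos_coeff (w r) k) + norm (sin_coeff (w s) k - sin_coeff (w r) k))"
                  unfolding distrib_left[symmetric] by (intro mult_left_mono) auto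
              qed
              moreover have "coeff_dist (w t) (w r) < \<eta>'" "coeff_dist (w s) (w r) < \<eta>'"
                using \<delta>(2)[OF rT sT(2)] \<delta>(2)[OF rT sT(1)] True st(4) by auto
              ultimately show "coeff_size d \<le> 2 * \<eta>'" by linarith
              show "0 \<le> coeff_size d" unfolding coeff_size_def by (intro sum_nonneg) auto
            qed (use C1 in simp)
            also have "(E + 1) * (2 * \<eta>') = \<eta>"
            proof -
              have "c * (2 * (\<eta> / (2 * c))) = \<eta>" if "c > 0" for c :: real using that by simp
              then show ?thesis using C1 unfolding \<eta>'_def by blast
            qed
            finally have "\<bar>\<Gamma> r\<bar> \<le> 2 * \<phi> r + \<eta>" using elim by linarith
            then show ?thesis using True by (simp add: indicator_def)
          qed
        qed
      qed
      also have "\<dots> = \<Phi> t - \<Phi> s + \<eta> * (\<integral>r. indicator {s..<t} r * 1 \<partial>?I)"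
        using ind[of "\<lambda>r. 2 * \<phi> r" "{..<t}"] ind[of "\<lambda>r. 2 * \<phi> r" "{..<s}"] ind[OF one[of 1], of "{s..<t}"] \<phi>(1)
        unfolding \<Phi>_def by simp
      also have "(\<integral>r. indicator {s..<t} r * 1 \<partial>?I) \<le> t - s"
      proof -
        have "(\<integral>r. indicator {s..<t} r * (1::real) \<partial>?I) = (\<integral>r. indicator {0<..<T} r *\<^sub>R (indicator {s..<t} r * 1) \<partial>lebesgue)"
          by (rule integral_restrict_space) simp
        also have "\<dots> = (\<integral>r. indicator ({0<..<T} \<inter> {s..<t}) r \<partial>lebesgue)"
          by (intro Bochner_Integration.integral_cong) (auto simp: indicator_def)
        also have "\<dots> = measure lebesgue ({0<..<T} \<inter> {s..<t})" by simp
        also have "\<dots> \<le> measure lebesgue {s..t}"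
          by (rule measure_mono_fmeasurable) auto
        also have "\<dots> = t - s" using st by simp
        finally show ?thesis .
      qed
      finally show ?thesis using eta by (simp add: mult_left_mono)
    qed
    then show ?thesis using \<delta>(1) by blast
  qed
  have inner: "\<bar>g t - g 0\<bar> \<le> 2 * (\<integral>r. \<phi> r \<partial>?I)" if "0 \<le> t" "t < T" for t
  proof -
    have "\<bar>g t - g 0\<bar> \<le> \<Phi> t - \<Phi> 0" by (rule increment_bound_of_local_bounds[OF loc that])
    also have "\<Phi> 0 = (\<integral>r. 0 \<partial>?I)" unfolding \<Phi>_def
      by (rule Bochner_Integration.integral_cong) auto
    also have "\<Phi> t \<le> (\<integral>r. 2 * \<phi> r \<partial>?I)" unfolding \<Phi>_def
    proof (rule integral_mono)
      show "integrable ?I (\<lambda>r. indicator {..<t} r * (2 * \<phi> r))" "integrable ?I (\<lambda>r. 2 * \<phi> r)"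
        using \<phi>(1) by (intro ind integrable_mult_right; simp)+
      show "indicator {..<t} r * (2 * \<phi> r) \<le> 2 * \<phi> r" if "r \<in> space ?I" for r
        using \<phi>(2)[of r] that by (auto simp: indicator_def)
    qed
    finally show ?thesis by simp
  qed
  have gc: "continuous_on {0..T} g"
  proof -
    have "continuous_on {0..T} (\<lambda>t. \<Sum>k<N. a k * (cos_coeff (w t) k \<bullet> cos_coeff (w t) k + sin_coeff (w t) k \<bullet> sin_coeff (w t) k))"
      by (intro continuous_intros coeff_continuous[OF rep])
    then show ?thesis
      by (rule continuous_on_eq) (simp only: g_def inner_mollify[OF L2_torusD(4)[OF wL]])
  qed
  have "continuous_on {0..T} (\<lambda>t. \<bar>g t - g 0\<bar>)" by (intro continuous_intros gc)
  from AE_le_imp_le_continuous[OF this T AE_I2 t] show ?thesis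
    using inner unfolding g_def by auto
qed

end

theorem theorem4p1:
  fixes T \<alpha> \<delta> :: real
    and v\<^sub>0 :: "real ^ 3 \<Rightarrow> real ^ 3"
    and v w :: "real \<Rightarrow> real ^ 3 \<Rightarrow> real ^ 3"
  assumes "T > 0"
    and "1 / 3 < \<alpha>" and "\<alpha> < 1"
    and "\<delta> > 0"
    and "v\<^sub>0 \<in> H_space"
    and "weak_euler_solution T v\<^sub>0 v"
    and "L_beta_Holder (1 / \<alpha> + \<delta>) T \<alpha> v"
    and "weakly_continuous_representative T v\<^sub>0 v w"
  shows "\<forall>t\<in>{0..T}. L2_norm (w t) = L2_norm v\<^sub>0"
proof -
  note T = assms(1) and euler = assms(6) and rep = assms(8) and v0H = assms(5)
  let ?I = "lebesgue_on {0<..<T}"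
  define \<beta> where "\<beta> = 1 / \<alpha> + \<delta>"
  \<comment> \<open>\<open>b \<le> 3\<close> is needed to split the cubic term, \<open>\<alpha> b > 1\<close> for the decay of the kernel moments, and
    \<open>b \<le> \<beta>\<close> for integrability in time\<close>
  define b where "b = min 3 \<beta>"
  have \<alpha>: "\<alpha> > 0" using assms(2) by simp
  have ab: "1 < \<alpha> * b" "\<alpha> * b < 3" and b: "1 \<le> b" "b \<le> 3" "b \<le> \<beta>"
  proof -
    have "1 < \<alpha> * \<beta>" using \<alpha> assms(4) by (simp add: \<beta>_def distrib_left)
    then show "1 < \<alpha> * b" using assms(2) by (auto simp: b_def min_def)
    show b3: "b \<le> 3" "b \<le> \<beta>" by (auto simp: b_def)
    have "1 / \<alpha> \<ge> 1" using \<alpha> assms(3) by simp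
    then show b1: "1 \<le> b" using assms(4) by (auto simp: b_def \<beta>_def)
    have "\<alpha> * b < 1 * b" using b1 assms(3) by (intro mult_strict_right_mono) auto
    then show "\<alpha> * b < 3" using b3 by simp
  qed
  have v0L: "v\<^sub>0 \<in> L2_torus" using v0H by (simp add: H_space_def)
  note wL = representativeD(2)[OF rep]
  obtain f where f: "\<And>t. t \<in> {0..T} \<Longrightarrow> 0 \<le> f t"
    "AE t in lebesgue_on {0..T}. \<forall>x y. norm (v t x - v t y) \<le> f t * norm (x - y) powr \<alpha>"
    "integrable (lebesgue_on {0..T}) (\<lambda>t. f t powr \<beta>)"
    using assms(7) unfolding L_beta_Holder_def \<beta>_def by blast
  have f2: "AE t in ?I. \<forall>x y. norm (v t x - v t y) \<le> f t * norm (x - y) powr \<alpha>"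
    using f(2) by (auto simp: AE_restrict_space_iff elim: eventually_mono)
  have f3: "integrable ?I (\<lambda>t. f t powr \<beta>)"
  proof -
    have "set_integrable lebesgue {0..T} (\<lambda>t. f t powr \<beta>)"
      using f(3) by (simp add: integrable_restrict_space set_integrable_def)
    then have "set_integrable lebesgue {0<..<T} (\<lambda>t. f t powr \<beta>)"
      by (rule set_integrable_subset) auto
    then show ?thesis by (simp add: integrable_restrict_space set_integrable_def)
  qed
  obtain E where E: "0 \<le> E" "AE t in ?I. v t \<in> H_space \<and> v t \<in> L2_torus \<and> L2_inner (v t) (v t) \<le> E"
    by (rule weak_euler_energy_bound[OF euler])
  have vper: "periodic (v t)" if "t \<in> {0<..<T}" for t
    using euler that by (simp add: weak_euler_solution_def)
  define J where "J = (\<integral>t. 1 + f t powr \<beta> \<partial>?I)"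
  have J1: "integrable ?I (\<lambda>t. 1 + f t powr \<beta>)"
    using f3 integrable_time_continuous(1)[of T "\<lambda>_. 1"] by (intro Bochner_Integration.integrable_add) auto
  have J0: "J \<ge> 0" unfolding J_def by (rule Bochner_Integration.integral_nonneg) simp
  define Q where "Q = 36 powr (\<alpha> * b / 2) * (measure torus (space torus) + E)"
  have Q0: "Q \<ge> 0" unfolding Q_def using E(1) by simp
  have kernel: "\<exists>N a m. cosine_kernel m \<and> cosine_kernel.averaging N a m \<and>
      (\<integral>z. cosine_kernel.L N a m z * torus_dist2 z \<partial>torus) \<le> \<epsilon> \<and>
      (\<forall>t\<in>{0..T}. \<bar>L2_inner (w t) (cosine_kernel.mollify N a m (w t)) - L2_inner (w 0) (cosine_kernel.mollify N a m (w 0))\<bar>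
         \<le> 2 * (\<epsilon> * Q * J))"
    if \<epsilon>: "\<epsilon> > 0" for \<epsilon>
  proof -
    obtain N a m M where K: "cosine_kernel m" "cosine_kernel.averaging N a m"
      "(\<integral>z. cosine_kernel.L N a m z * torus_dist2 z \<partial>torus) \<le> \<epsilon>"
      and M: "continuous_on UNIV M" "periodic M" "\<And>z. M (- z) = M z" "(\<integral>z. M z \<partial>torus) \<le> \<epsilon>"
      "\<And>z. norm (cosine_kernel.grad N a m z) * torus_dist2 z powr (\<alpha> * b / 2) \<le> M z"
      by (rule concentrating_kernels[OF ab \<epsilon>]) (rule that; assumption)
    interpret cosine_kernel N a m by (rule K(1))
    define \<phi> where "\<phi> r = \<epsilon> * Q * (1 + f r powr \<beta>)" for r
    have M0: "0 \<le> (\<integral>z. M z \<partial>torus)"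
      by (rule Bochner_Integration.integral_nonneg, rule order.trans[OF _ M(5)]) simp
    have flux: "AE r in ?I. \<bar>convective_form (v r) (mollify (v r))\<bar> \<le> \<phi> r"
      using f2 E(2) AE_time[of T]
    proof eventually_elim
      case (elim r)
      have f0: "0 \<le> f r" using elim f(1)[of r] by auto
      have cont: "continuous_on UNIV (v r)"
        by (rule Holder_imp_continuous[OF \<alpha>]) (use elim in blast)
      have "\<bar>convective_form (v r) (mollify (v r))\<bar> \<le>
        f r powr b * 36 powr (\<alpha> * b / 2) * (\<integral>z. M z \<partial>torus) * (measure torus (space torus) + L2_inner (v r) (v r))"
        by (rule flux_bound[OF cont _ _ f0 \<alpha> b(1,2) _ M(1,2,3,5)])
           (use elim vper transversal_H in auto)
      also have "\<dots> \<le> (1 + f r powr \<beta>) * 36 powr (\<alpha> * b / 2) * \<epsilon> * (measure torus (space torus) + E)"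
      proof -
        have "f r powr b \<le> 1 + f r powr \<beta>"
        proof (cases "f r \<le> 1")
          case True
          then have "f r powr b \<le> 1" using f0 b by (intro powr_le1) auto
          then show ?thesis by (simp add: add_increasing2)
        next
          case False
          then have "f r powr b \<le> f r powr \<beta>" using b by (intro powr_mono) auto
          then show ?thesis by simp
        qed
        moreover have "L2_inner (v r) (v r) \<le> E" using elim by simp
        ultimately show ?thesis using M(4) M0 \<epsilon> E(1)
          by (intro mult_mono add_mono) (auto intro!: mult_nonneg_nonneg add_nonneg_nonneg)
      qed
      also have "\<dots> = \<phi> r" unfolding \<phi>_def Q_def by simp
      finally show ?case .
    qed
    have \<phi>i: "integrable ?I \<phi>" unfolding \<phi>_def using J1 by (intro integrable_mult_right)
    have "(\<integral>r. \<phi> r \<partial>?I) = \<epsilon> * Q * J" unfolding \<phi>_def J_def by (rule integral_mult_right_zero)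
    moreover have "0 \<le> \<phi> r" for r unfolding \<phi>_def using \<epsilon> Q0 by simp
    ultimately have "\<bar>L2_inner (w t) (mollify (w t)) - L2_inner (w 0) (mollify (w 0))\<bar> \<le> 2 * (\<epsilon> * Q * J)"
      if "t \<in> {0..T}" for t
      using regularized_energy_drift[OF T v0L euler rep \<phi>i _ flux that] by metis
    then show ?thesis
      by (intro exI[of _ N] exI[of _ a] exI[of _ m] conjI allI ballI K)
  qed
  note w0 = representativeD(4)[OF rep]
  have T0: "0 \<in> {0..T}" using T by simp
  have inner0: "L2_inner (w 0) (w 0) = L2_inner v\<^sub>0 v\<^sub>0"
    by (rule L2_inner_self_cong_AE[OF wL[OF T0] v0L w0])
  \<comment> \<open>If the field at time \<open>s\<close> lies in \<open>H\<close>, its energy is at most that at any other time \<open>t\<close>: up to small errors,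
    it equals its regularisation, which hardly changes from \<open>s\<close> to \<open>t\<close>, and at time \<open>t\<close> the regularised
    energy is below the energy.\<close>
  have transfer: "L2_inner u u \<le> L2_inner (w t) (w t)"
    if u: "u \<in> H_space" "AE x in lebesgue. w s x = u x" and s: "s \<in> {0..T}" and t: "t \<in> {0..T}" for u s t
  proof (rule field_le_epsilon)
    fix e :: real assume e: "e > 0"
    have uL: "u \<in> L2_torus" using u(1) by (simp add: H_space_def)
    obtain K where K: "K \<ge> 0" "\<And>N a m. cosine_kernel m \<Longrightarrow> cosine_kernel.averaging N a m \<Longrightarrow>
     L2_inner u u - L2_inner u (cosine_kernel.mollify N a m u)
       \<le> e / 2 + K * (\<integral>z. cosine_kernel.L N a m z * torus_dist2 z \<partial>torus)"
      using energy_defect_bound[OF u(1), of "e / 2"] e by auto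
    \<comment> \<open>the kernel scale must make both the defect \<open>K * \<epsilon>\<close> and two drifts \<open>2 * (\<epsilon> * Q * J)\<close> small\<close>
    define \<epsilon> where "\<epsilon> = e / 2 / (K + 4 * (Q * J) + 1)"
    have den: "K + 4 * (Q * J) + 1 > 0" using K(1) Q0 J0 by (simp add: add_nonneg_pos)
    have \<epsilon>: "\<epsilon> > 0" using e den by (simp add: \<epsilon>_def)
    have small: "K * \<epsilon> + 4 * (\<epsilon> * Q * J) \<le> e / 2"
    proof -
      have "K * \<epsilon> + 4 * (\<epsilon> * Q * J) \<le> \<epsilon> * (K + 4 * (Q * J) + 1)" using \<epsilon> by (simp add: algebra_simps)
      also have "\<dots> = e / 2"
      proof -
        have "e / 2 / d * d = e / 2" if "d > 0" for d using that by simp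
        then show ?thesis using den unfolding \<epsilon>_def by blast
      qed
      finally show ?thesis .
    qed
    obtain N a m where k: "cosine_kernel m" "cosine_kernel.averaging N a m"
      "(\<integral>z. cosine_kernel.L N a m z * torus_dist2 z \<partial>torus) \<le> \<epsilon>"
      and drift: "\<And>t. t \<in> {0..T} \<Longrightarrow> \<bar>L2_inner (w t) (cosine_kernel.mollify N a m (w t)) - L2_inner (w 0) (cosine_kernel.mollify N a m (w 0))\<bar>
         \<le> 2 * (\<epsilon> * Q * J)"
      using kernel[OF \<epsilon>] by blast
    interpret cosine_kernel N a m by (rule k(1))
    have "L2_inner u u \<le> L2_inner u (mollify u) + (e / 2 + K * \<epsilon>)"
      using K(2)[OF k(1,2)] mult_left_mono[OF k(3) K(1)] by linarith
    also have "L2_inner u (mollify u) = L2_inner (w s) (mollify (w s))"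
      by (rule mollified_energy_cong_AE[OF wL[OF s] uL u(2), symmetric])
    also have "\<dots> \<le> L2_inner (w t) (mollify (w t)) + 4 * (\<epsilon> * Q * J)"
      using drift[OF s] drift[OF t] by linarith
    also have "L2_inner (w t) (mollify (w t)) \<le> L2_inner (w t) (w t)"
      by (rule mollified_energy_le[OF k(2) wL[OF t]])
    finally show "L2_inner u u \<le> L2_inner (w t) (w t) + e" using small by linarith
  qed
  have upper_ae: "AE s in ?I. L2_inner (w s) (w s) \<le> L2_inner v\<^sub>0 v\<^sub>0"
    using E(2) representativeD(1)[OF rep] AE_time[of T]
  proof eventually_elim
    case (elim s)
    have sT: "s \<in> {0..T}" using elim by auto
    have vL: "v s \<in> L2_torus" using elim by simp
    have "L2_inner (w s) (w s) = L2_inner (v s) (v s)"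
      by (rule L2_inner_self_cong_AE[OF wL[OF sT] vL]) (use elim in auto)
    also have "\<dots> \<le> L2_inner (w 0) (w 0)"
      by (rule transfer[of _ s]) (use elim sT T0 in auto)
    finally show ?case using inner0 by simp
  qed
  show ?thesis
  proof
    fix t assume t: "t \<in> {0..T}"
    have lower: "L2_inner v\<^sub>0 v\<^sub>0 \<le> L2_inner (w t) (w t)"
      by (rule transfer[OF v0H w0 T0 t])
    \<comment> \<open>lower semicontinuity of the norm: pair \<open>w s\<close> with \<open>w t\<close> and let \<open>s\<close> tend to \<open>t\<close>\<close>
    have cont: "continuous_on {0..T} (\<lambda>s. L2_inner (w s) (w t))"
      by (rule representativeD(3)[OF rep wL[OF t]])
    have "AE s in ?I. L2_inner (w s) (w t) \<le> (L2_inner v\<^sub>0 v\<^sub>0 + L2_inner (w t) (w t)) / 2"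
      using upper_ae AE_time[of T]
    proof eventually_elim
      case (elim s)
      then have "s \<in> {0..T}" by auto
      from L2_inner_Young[OF wL[OF this] wL[OF t], of 1] show ?case using elim by simp
    qed
    from AE_le_imp_le_continuous[OF cont T this t]
    have "L2_inner (w t) (w t) \<le> L2_inner v\<^sub>0 v\<^sub>0" by simp
    then show "L2_norm (w t) = L2_norm v\<^sub>0" using lower by (simp add: L2_norm_def)
  qed
qed

end
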